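(* Let $(\Lambda(U,V),d)$ be any two-stage, elliptic minimal model over $\mathbb{Q}$. Then $$\dim H\big(\Lambda(U,V)\big)\ \geq\ 2^{\dim V-\dim U^{\mathrm{even}}}.$$
   Context: All vector spaces and algebras are over $\mathbb{Q}$. For a graded vector space $W$ concentrated in degrees $\ge 2$ (all spaces are assumed 1-connected), $\Lambda W$ is the free graded commutative algebra on $W$. A minimal model is a differential graded algebra $(\Lambda W,d)$ with $d$ of degree $+1$ such that $dw$ is a polynomial with no linear term for each $w\in W$. It is elliptic if $W$ and $H(\Lambda W,d)$ are both finite-dimensional. It is two-stage if there is a graded decomposition $W=U\oplus V$ with $dU=0$ and $dV\subseteq\Lambda U$; one then writes $\Lambda(U,V)$, with this decomposition understood. In the elliptic two-stage case $V$ is always concentrated in odd degrees, while $U$ may have generators of even and odd degree. $\dim$ of a graded vector space denotes its total dimension. $U^{\mathrm{even}}$ is the even degree part of $U$. *)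

theory Defs
  imports Complex_Main "HOL-Library.Poly_Mapping"
begin

text \<open>
  A graded rational vector space \<open>W\<close> is presented by a set \<open>X\<close> of symbols with degrees
  \<open>deg\<close>, forming a homogeneous basis of \<open>W\<close>.  A monomial is a finitely supported exponent
  function, and elements of \<open>\<Lambda>W\<close> are finite rational linear combinations of the
  monomials in \<open>X\<close> in which every generator of odd degree has exponent at most one, i.e.
  \<open>\<Lambda>W\<close> is the polynomial algebra on the even part tensor the exterior algebra on the
  odd part.  The linear order on generators only selects the order in which
  odd generators are written in a monomial.
\<close>

type_synonym 'g monom = "'g \<Rightarrow>\<^sub>0 nat"
type_synonym 'g gca = "'g monom \<Rightarrow>\<^sub>0 rat"

definition scaleQ :: "rat \<Rightarrow> 'g gca \<Rightarrow> 'g gca" where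
  "scaleQ c p = Poly_Mapping.map ((*) c) p"

lemma lookup_scaleQ: "Poly_Mapping.lookup (scaleQ c p) m = c * Poly_Mapping.lookup p m"
  unfolding scaleQ_def by (simp add: Poly_Mapping.map.rep_eq when_def)

interpretation Q: vector_space scaleQ
  by unfold_locales
     (auto intro!: poly_mapping_eqI simp: lookup_scaleQ lookup_add algebra_simps)

definition monom_deg :: "('g \<Rightarrow> nat) \<Rightarrow> 'g monom \<Rightarrow> nat" where
  "monom_deg deg m = (\<Sum>x\<in>Poly_Mapping.keys m. Poly_Mapping.lookup m x * deg x)"

definition odd_keys :: "('g \<Rightarrow> nat) \<Rightarrow> 'g monom \<Rightarrow> 'g set" where
  "odd_keys deg m = {x \<in> Poly_Mapping.keys m. odd (deg x)}"

definition free_gca :: "'g set \<Rightarrow> ('g \<Rightarrow> nat) \<Rightarrow> 'g gca set" where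
  "free_gca X deg = {p. \<forall>m\<in>Poly_Mapping.keys p.
    Poly_Mapping.keys m \<subseteq> X \<and> (\<forall>x\<in>odd_keys deg m. Poly_Mapping.lookup m x = 1)}"

definition gen :: "'g \<Rightarrow> 'g gca" where
  "gen x = Poly_Mapping.single (Poly_Mapping.single x 1) 1"

definition gone :: "'g gca" where
  "gone = Poly_Mapping.single 0 1"

text \<open>
  The product of two monomials vanishes if they share an odd generator; otherwise the
  sign is that of the shuffle sorting the odd generators of the concatenation.  The
  multiplication \<open>(*)\<close> of the library on \<open>'g gca\<close>, which carries no signs, is not used.
\<close>

definition monom_sign :: "('g::linorder \<Rightarrow> nat) \<Rightarrow> 'g monom \<Rightarrow> 'g monom \<Rightarrow> rat" where
  "monom_sign deg m n =
    (if odd_keys deg m \<inter> odd_keys deg n \<noteq> {} then 0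
     else (- 1) ^ card {(x, y). x \<in> odd_keys deg m \<and> y \<in> odd_keys deg n \<and> y < x})"

definition gmul :: "('g::linorder \<Rightarrow> nat) \<Rightarrow> 'g gca \<Rightarrow> 'g gca \<Rightarrow> 'g gca" where
  "gmul deg p q =
    (\<Sum>m\<in>Poly_Mapping.keys p. \<Sum>n\<in>Poly_Mapping.keys q.
       Poly_Mapping.single (m + n)
         (monom_sign deg m n * Poly_Mapping.lookup p m * Poly_Mapping.lookup q n))"

definition homogeneous :: "('g \<Rightarrow> nat) \<Rightarrow> nat \<Rightarrow> 'g gca \<Rightarrow> bool" where
  "homogeneous deg k p \<longleftrightarrow> (\<forall>m\<in>Poly_Mapping.keys p. monom_deg deg m = k)"

definition gen_space :: "'g set \<Rightarrow> 'g gca set" where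
  "gen_space X = Q.span (gen ` X)"

definition graded_subspace :: "('g \<Rightarrow> nat) \<Rightarrow> 'g gca set \<Rightarrow> bool" where
  "graded_subspace deg S \<longleftrightarrow> Q.subspace S \<and> S \<subseteq> Q.span {p \<in> S. \<exists>k. homogeneous deg k p}"

definition even_part :: "('g \<Rightarrow> nat) \<Rightarrow> 'g gca set \<Rightarrow> 'g gca set" where
  "even_part deg S = Q.span {p \<in> S. \<exists>k. even k \<and> homogeneous deg k p}"

definition subalgebra :: "('g::linorder \<Rightarrow> nat) \<Rightarrow> 'g gca set \<Rightarrow> bool" where
  "subalgebra deg A \<longleftrightarrow>
    Q.subspace A \<and> gone \<in> A \<and> (\<forall>p\<in>A. \<forall>q\<in>A. gmul deg p q \<in> A)"

text \<open>For a graded subspace \<open>S\<close> of \<open>W\<close>, this is \<open>\<Lambda>S\<close> inside \<open>\<Lambda>W\<close>.\<close>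

definition gen_subalgebra :: "('g::linorder \<Rightarrow> nat) \<Rightarrow> 'g gca set \<Rightarrow> 'g gca set" where
  "gen_subalgebra deg S = \<Inter> {A. subalgebra deg A \<and> S \<subseteq> A}"

text \<open>A differential is only constrained on \<open>free_gca X deg\<close>, where \<open>\<Lambda>W\<close> lives.\<close>

definition differential ::
    "'g::linorder set \<Rightarrow> ('g \<Rightarrow> nat) \<Rightarrow> ('g gca \<Rightarrow> 'g gca) \<Rightarrow> bool" where
  "differential X deg d \<longleftrightarrow>
    (\<forall>p\<in>free_gca X deg. d p \<in> free_gca X deg) \<and>
    (\<forall>p\<in>free_gca X deg. \<forall>q\<in>free_gca X deg. d (p + q) = d p + d q) \<and>
    (\<forall>c. \<forall>p\<in>free_gca X deg. d (scaleQ c p) = scaleQ c (d p)) \<and>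
    (\<forall>k. \<forall>p\<in>free_gca X deg. homogeneous deg k p \<longrightarrow> homogeneous deg (k + 1) (d p)) \<and>
    (\<forall>k. \<forall>p\<in>free_gca X deg. \<forall>q\<in>free_gca X deg. homogeneous deg k p \<longrightarrow>
       d (gmul deg p q) = gmul deg (d p) q + scaleQ ((- 1) ^ k) (gmul deg p (d q))) \<and>
    (\<forall>p\<in>free_gca X deg. d (d p) = 0)"

text \<open>
  The coefficient of \<open>single x 1\<close> is the coefficient of the generator \<open>x\<close> in the linear term.
\<close>

definition minimal_model ::
    "'g::linorder set \<Rightarrow> ('g \<Rightarrow> nat) \<Rightarrow> ('g gca \<Rightarrow> 'g gca) \<Rightarrow> bool" where
  "minimal_model X deg d \<longleftrightarrow>
    (\<forall>x\<in>X. 2 \<le> deg x) \<and> differential X deg d \<and>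
    (\<forall>w\<in>gen_space X. \<forall>x\<in>X. Poly_Mapping.lookup (d w) (Poly_Mapping.single x 1) = 0)"

definition cocycles :: "'g set \<Rightarrow> ('g \<Rightarrow> nat) \<Rightarrow> ('g gca \<Rightarrow> 'g gca) \<Rightarrow> 'g gca set" where
  "cocycles X deg d = {p \<in> free_gca X deg. d p = 0}"

definition coboundaries :: "'g set \<Rightarrow> ('g \<Rightarrow> nat) \<Rightarrow> ('g gca \<Rightarrow> 'g gca) \<Rightarrow> 'g gca set" where
  "coboundaries X deg d = d ` free_gca X deg"

text \<open>
  Bases and dimension of a quotient \<open>Z/B\<close> of subspaces \<open>B \<subseteq> Z\<close>: \<open>S\<close> is a set of
  representatives of the elements of a basis of \<open>Z/B\<close>.
\<close>

definition quotient_basis :: "'g gca set \<Rightarrow> 'g gca set \<Rightarrow> 'g gca set \<Rightarrow> bool" where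
  "quotient_basis Z B S \<longleftrightarrow> S \<subseteq> Z \<and>
    (\<forall>T c. finite T \<and> T \<subseteq> S \<and> (\<Sum>s\<in>T. scaleQ (c s) s) \<in> B \<longrightarrow> (\<forall>s\<in>T. c s = 0)) \<and>
    (\<forall>z\<in>Z. \<exists>T c. finite T \<and> T \<subseteq> S \<and> z - (\<Sum>s\<in>T. scaleQ (c s) s) \<in> B)"

definition finite_dim_quotient :: "'g gca set \<Rightarrow> 'g gca set \<Rightarrow> bool" where
  "finite_dim_quotient Z B \<longleftrightarrow> (\<exists>S. finite S \<and> quotient_basis Z B S)"

definition dim_quotient :: "'g gca set \<Rightarrow> 'g gca set \<Rightarrow> nat" where
  "dim_quotient Z B = card (SOME S. quotient_basis Z B S)"

definition dim_cohomology :: "'g set \<Rightarrow> ('g \<Rightarrow> nat) \<Rightarrow> ('g gca \<Rightarrow> 'g gca) \<Rightarrow> nat" where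
  "dim_cohomology X deg d = dim_quotient (cocycles X deg d) (coboundaries X deg d)"

definition elliptic :: "'g set \<Rightarrow> ('g \<Rightarrow> nat) \<Rightarrow> ('g gca \<Rightarrow> 'g gca) \<Rightarrow> bool" where
  "elliptic X deg d \<longleftrightarrow>
    (\<exists>S. finite S \<and> gen_space X \<subseteq> Q.span S) \<and>
    finite_dim_quotient (cocycles X deg d) (coboundaries X deg d)"

definition two_stage ::
    "'g::linorder set \<Rightarrow> ('g \<Rightarrow> nat) \<Rightarrow> ('g gca \<Rightarrow> 'g gca) \<Rightarrow> 'g gca set \<Rightarrow> 'g gca set \<Rightarrow> bool"
  where
  "two_stage X deg d U V \<longleftrightarrow>
    graded_subspace deg U \<and> graded_subspace deg V \<and>
    gen_space X = {u + v | u v. u \<in> U \<and> v \<in> V} \<and> U \<inter> V = {0} \<and>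
    (\<forall>u\<in>U. d u = 0) \<and> (\<forall>v\<in>V. d v \<in> gen_subalgebra deg U)"

end

theory Submission
  imports Defs "HOL-Library.Function_Algebras" "HOL-Library.Multiset"
begin

text \<open>
  Write \<open>n = dim V\<close> and \<open>r = dim U^even\<close>, and let \<open>A = \<Lambda>(U,V)\<close>.

  Ellipticity and minimality force \<open>V\<close> to lie in odd degrees.  Killing the generators of \<open>U\<close> one after the
  other, the even ones first, preserves the vanishing of cohomology in high degrees
  (\<open>acyclic_above_kill_even\<close>, \<open>acyclic_above_kill_odd\<close>).  What remains is \<open>\<Lambda>V\<close> with zero differential, so no
  generator of \<open>V\<close> can have powers of arbitrarily high degree (\<open>deg_odd_V\<close>).  Minimality enters because \<open>dV\<close> has
  no terms linear in \<open>U\<close>: a pair \<open>dv = u\<close> with \<open>v\<close> even and \<open>u\<close> odd contributes nothing to the cohomology.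

  An even generator \<open>u\<close> of \<open>U\<close> is a regular cocycle, so the exact sequence \<open>0 \<rightarrow> A \<rightarrow> A \<rightarrow> A/u \<rightarrow> 0\<close> shows that passing
  from \<open>A\<close> to \<open>A/u\<close> at most doubles the total dimension of the cohomology (\<open>hdim_le_cokernel\<close>).  Killing all even
  generators of \<open>U\<close> costs a factor \<open>2 ^ r\<close> (\<open>hdim_le_kill_even_U\<close>), and it remains to bound the cohomology of the
  quotient below by \<open>2 ^ n\<close>.

  This quotient is the Koszul complex \<open>M \<otimes> \<Lambda>V\<close> of \<open>n\<close> commuting nilpotent operators \<open>x\<^sub>i\<close>, the multiplications by
  \<open>d v\<^sub>i\<close>, on the finite-dimensional space \<open>M = \<Lambda>(U^odd)\<close> (\<open>coords_d\<close>).  Its total rank is at least \<open>2 ^ n\<close>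
  (\<open>koszul_total_rank\<close>) by an argument in the spirit of Walker's proof of the total rank conjecture.  Consider
  the Koszul complex \<open>K\<close> of the operators \<open>x\<^sub>i \<otimes> 1 - 1 \<otimes> x\<^sub>i\<close> on \<open>M \<otimes> M\<close>.  Filtering the second factor by invariant
  subspaces gives \<open>dim H(K) \<le> dim M * dim H(M \<otimes> \<Lambda>V)\<close> (\<open>hdim_le_doubled\<close>).  The swap of the two factors anticommutes
  with the differential of \<open>K\<close>, which therefore exchanges symmetric and antisymmetric tensors, and an Euler
  characteristic count (\<open>card_le_two_periodic\<close>) gives \<open>dim H(K) \<ge> trace (swap) = 2 ^ n * dim M\<close>.

  Since \<open>U\<close> and \<open>V\<close> are arbitrary graded subspaces of the space of generators, all of this is carried out in
  coordinates adapted to them, which are reached through the universal property of the free graded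
  commutative algebra (\<open>gca_map\<close>, \<open>adapted_basis\<close>).
\<close>

section \<open>Dimension of quotients and relative cohomology\<close>

context vector_space
begin

definition qdim_le :: "'b set \<Rightarrow> 'b set \<Rightarrow> nat \<Rightarrow> bool" where
  "qdim_le Z B k \<longleftrightarrow>
    (\<exists>S. finite S \<and> card S \<le> k \<and> S \<subseteq> Z \<and> (\<forall>z\<in>Z. \<exists>s\<in>span S. z - s \<in> B))"

end

context vector_space
begin

lemma span_lift_mod:
  assumes "subspace B" "\<And>t. t \<in> T \<Longrightarrow> f t - t \<in> B" "s \<in> span T"
  shows "\<exists>s'\<in>span (f ` T). s' - s \<in> B"
  using assms(3)
proof (induction rule: span_induct_alt)
  case base
  then show ?case
    using assms(1) span_zero subspace_0 by (intro bexI[of _ 0]) auto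
next
  case (step c x y)
  then obtain s' where s': "s' \<in> span (f ` T)" "s' - y \<in> B"
    by blast
  have "scale c (f x - x) + (s' - y) \<in> B"
    using assms(1,2) step s' by (blast intro: subspace_add subspace_scale)
  then have "(scale c (f x) + s') - (scale c x + y) \<in> B"
    by (simp add: algebra_simps)
  moreover have "scale c (f x) + s' \<in> span (f ` T)"
    using s' step by (blast intro: span_add span_scale span_base)
  ultimately show ?case
    by blast
qed

lemma qdim_leE:
  assumes "qdim_le Z B k"
  obtains S where "finite S" "card S \<le> k" "S \<subseteq> Z" "\<forall>z\<in>Z. \<exists>s\<in>span S. z - s \<in> B"
  using assms unfolding qdim_le_def by blast

text \<open>
  A basis of those elements of \<open>span S\<close> that represent elements of \<open>Z'\<close> has at most \<open>card S\<close> members, and each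
  of them can be moved into \<open>Z'\<close> modulo \<open>B\<close>.
\<close>

lemma qdim_le_subspace:
  assumes B: "subspace B" and Z': "subspace Z'" and sub: "Z' \<subseteq> Z" and q: "qdim_le Z B k"
  shows "qdim_le Z' B k"
proof -
  obtain S where S: "finite S" "card S \<le> k" "S \<subseteq> Z" "\<forall>z\<in>Z. \<exists>s\<in>span S. z - s \<in> B"
    using q by (rule qdim_leE)
  define Y where "Y = {s \<in> span S. \<exists>z\<in>Z'. z - s \<in> B}"
  obtain T where T: "T \<subseteq> Y" "independent T" "Y \<subseteq> span T"
    using maximal_independent_subset by blast
  have "T \<subseteq> span S"
    using T(1) unfolding Y_def by blast
  then have fT: "finite T" "card T \<le> card S"
    using independent_span_bound S(1) T(2) by blast+
  have "\<forall>t\<in>T. \<exists>z\<in>Z'. z - t \<in> B"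
    using T(1) unfolding Y_def by blast
  then obtain f where f: "\<And>t. t \<in> T \<Longrightarrow> f t \<in> Z'" "\<And>t. t \<in> T \<Longrightarrow> f t - t \<in> B"
    by metis
  show ?thesis
    unfolding qdim_le_def
  proof (intro exI[of _ "f ` T"] conjI ballI)
    show "finite (f ` T)"
      using fT by simp
    show "card (f ` T) \<le> k"
      using fT(2) card_image_le[OF fT(1), of f] S(2) by linarith
    show "f ` T \<subseteq> Z'"
      using f by blast
    fix z assume z: "z \<in> Z'"
    then obtain s where s: "s \<in> span S" "z - s \<in> B"
      using S(4) sub by blast
    then have "s \<in> span T"
      using z T(3) unfolding Y_def by blast
    then obtain s' where s': "s' \<in> span (f ` T)" "s' - s \<in> B"
      using span_lift_mod[of B T f s] B f by blast
    have "(z - s) - (s' - s) \<in> B"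
      using B s(2) s'(2) by (rule subspace_diff)
    then show "\<exists>s\<in>span (f ` T). z - s \<in> B"
      using s'(1) by (intro bexI[of _ s']) simp_all
  qed
qed

text \<open>
  Replacing the elements of \<open>T\<close> by representatives in \<open>span S\<close> keeps them distinct and independent.
\<close>

lemma card_le_if_independent_mod:
  assumes B: "subspace B" and S: "finite S" "\<And>z. z \<in> T \<Longrightarrow> \<exists>s\<in>span S. z - s \<in> B"
    and T: "finite T" and ind: "\<And>c. (\<Sum>t\<in>T. scale (c t) t) \<in> B \<Longrightarrow> \<forall>t\<in>T. c t = 0"
  shows "card T \<le> card S"
proof -
  obtain f where f: "\<And>t. t \<in> T \<Longrightarrow> f t \<in> span S" "\<And>t. t \<in> T \<Longrightarrow> t - f t \<in> B"
    using S(2) by metis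
  have key: "\<forall>t\<in>T. c t = 0" if 0: "(\<Sum>t\<in>T. scale (c t) (f t)) = 0" for c
  proof (rule ind)
    have "(\<Sum>t\<in>T. scale (c t) (t - f t)) \<in> B"
      using B f(2) by (intro subspace_sum subspace_scale) auto
    then show "(\<Sum>t\<in>T. scale (c t) t) \<in> B"
      using 0 by (simp add: scale_right_diff_distrib sum_subtractf)
  qed
  have inj: "inj_on f T"
  proof (rule inj_onI, rule ccontr)
    fix x y assume xy: "x \<in> T" "y \<in> T" "f x = f y" "x \<noteq> y"
    define c where "c t = (if t = x then 1 else if t = y then - 1 else (0::'a))" for t
    have "(\<Sum>t\<in>T. scale (c t) (f t)) = (\<Sum>t\<in>{x, y}. scale (c t) (f t))"
      using xy T by (intro sum.mono_neutral_right) (auto simp: c_def)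
    also have "\<dots> = 0"
      using xy by (simp add: c_def)
    finally have "c x = 0"
      using key xy(1) by blast
    then show False
      by (simp add: c_def)
  qed
  have "independent (f ` T)"
  proof (rule independent_if_scalars_zero)
    show "finite (f ` T)"
      using T by simp
    fix g y assume "(\<Sum>x\<in>f ` T. scale (g x) x) = 0" "y \<in> f ` T"
    then show "g y = 0"
      using key[of "g \<circ> f"] inj by (auto simp: sum.reindex)
  qed
  then have "card (f ` T) \<le> card S"
    using independent_span_bound[OF S(1)] f(1) by blast
  then show ?thesis
    using inj by (simp add: card_image)
qed

text \<open>
  Complexes are handled as pairs of a linear endomorphism \<open>d\<close> and a stable subspace \<open>I\<close> containing
  the image of \<open>d \<circ> d\<close>; such a pair stands for the complex induced by \<open>d\<close> on the quotient by \<open>I\<close>.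
  Passing to a quotient complex thus only enlarges \<open>I\<close>.
\<close>

definition hdim_le :: "('b \<Rightarrow> 'b) \<Rightarrow> 'b set \<Rightarrow> nat \<Rightarrow> bool" where
  "hdim_le d I k \<longleftrightarrow> qdim_le {z. d z \<in> I} {d b + i | b i. i \<in> I} k"

end

context vector_space
begin

lemma subspace_coboundaries_mod:
  assumes d: "Vector_Spaces.linear scale scale d" and J: "subspace J" and I: "subspace I"
  shows "subspace {d b + i | b i. b \<in> J \<and> i \<in> I}"
proof -
  interpret d: Vector_Spaces.linear scale scale d by (rule d)
  have "subspace (d ` J)"
    by (rule d.subspace_image[OF J])
  then have "subspace {x + y | x y. x \<in> d ` J \<and> y \<in> I}"
    using I by (rule subspace_sums)
  moreover have "{x + y | x y. x \<in> d ` J \<and> y \<in> I} = {d b + i | b i. b \<in> J \<and> i \<in> I}"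
    by blast
  ultimately show ?thesis
    by simp
qed

text \<open>
  The long exact cohomology sequence of \<open>0 \<rightarrow> J/I \<rightarrow> C/I \<rightarrow> C/J \<rightarrow> 0\<close>, read at its middle term.
\<close>

lemma hdim_le_extension:
  assumes d: "Vector_Spaces.linear scale scale d" and I: "subspace I" and J: "subspace J" and IJ: "I \<subseteq> J"
    and dd: "\<And>x. d (d x) \<in> I"
    and q: "hdim_le d J k" and s: "qdim_le {z \<in> J. d z \<in> I} {d b + i | b i. b \<in> J \<and> i \<in> I} l"
  shows "hdim_le d I (k + l)"
proof -
  interpret d: Vector_Spaces.linear scale scale d by (rule d)
  have BJ: "subspace {d b + i | b i. i \<in> J}"
    using subspace_coboundaries_mod[OF d subspace_UNIV J] by simp
  have ZI: "subspace {z. d z \<in> I}"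
    by (rule d.subspace_linear_preimage[OF I])
  have "{z. d z \<in> I} \<subseteq> {z. d z \<in> J}"
    using IJ by blast
  then have "qdim_le {z. d z \<in> I} {d b + i | b i. i \<in> J} k"
    using q[unfolded hdim_le_def] by (rule qdim_le_subspace[OF BJ ZI])
  then obtain S where S: "finite S" "card S \<le> k" "S \<subseteq> {z. d z \<in> I}"
    and Sz: "\<forall>z\<in>{z. d z \<in> I}. \<exists>s\<in>span S. z - s \<in> {d b + i | b i. i \<in> J}"
    by (rule qdim_leE)
  obtain T where T: "finite T" "card T \<le> l" "T \<subseteq> {z \<in> J. d z \<in> I}"
    and Tz: "\<forall>z\<in>{z \<in> J. d z \<in> I}.
      \<exists>t\<in>span T. z - t \<in> {d b + i | b i. b \<in> J \<and> i \<in> I}"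
    using s by (rule qdim_leE)
  show ?thesis
    unfolding hdim_le_def qdim_le_def
  proof (intro exI[of _ "S \<union> T"] conjI ballI)
    show "finite (S \<union> T)"
      using S T by simp
    show "card (S \<union> T) \<le> k + l"
      using S T card_Un_le[of S T] by linarith
    show "S \<union> T \<subseteq> {z. d z \<in> I}"
      using S T by blast
    fix z assume z0: "z \<in> {z. d z \<in> I}"
    then have z: "d z \<in> I" by simp
    obtain s b j where sbj: "s \<in> span S" "z - s = d b + j" "j \<in> J"
      using bspec[OF Sz z0] by blast
    have "d s \<in> I"
      using span_minimal[OF S(3) ZI] sbj(1) by blast
    moreover have "d j = d z - d s - d (d b)"
    proof -
      have "j = z - s - d b"
        using sbj(2) by (simp add: algebra_simps)
      then show ?thesis
        by (simp add: d.diff)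
    qed
    ultimately have "d j \<in> I"
      using subspace_diff[OF I subspace_diff[OF I z] dd] by simp
    then have "j \<in> {z \<in> J. d z \<in> I}"
      using sbj(3) by simp
    from bspec[OF Tz this] obtain t c i where tci: "t \<in> span T" "j - t = d c + i" "i \<in> I"
      by blast
    have "z - (s + t) = (z - s) - t"
      by (simp add: algebra_simps)
    also have "\<dots> = d (b + c) + i"
      unfolding sbj(2) using tci(2) by (simp add: d.add algebra_simps)
    finally have "z - (s + t) = d (b + c) + i" .
    moreover have "s + t \<in> span (S \<union> T)"
      using sbj(1) tci(1) by (auto simp: span_Un)
    ultimately show "\<exists>s\<in>span (S \<union> T). z - s \<in> {d b + i | b i. i \<in> I}"
      using tci(3) by blast
  qed
qed

text \<open>
  The long exact sequence of \<open>0 \<rightarrow> C/I \<rightarrow> C/I \<rightarrow> C/(I + u C) \<rightarrow> 0\<close>, for a chain map \<open>u\<close> that is injective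
  modulo \<open>I\<close>, bounds the cohomology of the cokernel by twice that of \<open>C/I\<close>.
\<close>

lemma hdim_le_cokernel:
  assumes d: "Vector_Spaces.linear scale scale d" and I: "subspace I"
    and dI: "\<And>x. x \<in> I \<Longrightarrow> d x \<in> I" and dd: "\<And>x. d (d x) \<in> I"
    and u: "Vector_Spaces.linear scale scale u" and uI: "\<And>x. x \<in> I \<Longrightarrow> u x \<in> I" and ud: "\<And>x. u (d x) - d (u x) \<in> I"
    and inj: "\<And>x. u x \<in> I \<Longrightarrow> x \<in> I"
    and q: "hdim_le d I k"
  shows "hdim_le d {u x + i | x i. i \<in> I} (2 * k)"
proof -
  interpret d: Vector_Spaces.linear scale scale d by (rule d)
  note uh = u[folded module_hom_iff_linear]
  note u_add = module_hom.add[OF uh] and u_scale = module_hom.scale[OF uh] and u_zero = module_hom.zero[OF uh]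
  let ?B = "{d b + i | b i. i \<in> I}"
  let ?J = "{u x + i | x i. i \<in> I}"
  have B: "subspace ?B"
    using subspace_coboundaries_mod[OF d subspace_UNIV I] by simp
  have J: "subspace ?J"
    using subspace_coboundaries_mod[OF u subspace_UNIV I] by simp
  have JI: "u x + i \<in> ?J" if "i \<in> I" for x i
    using that by blast
  have IJ: "I \<subseteq> ?J"
  proof
    fix i assume "i \<in> I"
    then show "i \<in> ?J"
      using u_zero by (intro CollectI exI[of _ 0] exI[of _ i]) auto
  qed
  define Y where "Y = {y. \<exists>z. d z - u y \<in> I}"
  have Y: "subspace Y"
  proof (rule subspaceI)
    show "0 \<in> Y"
      unfolding Y_def using subspace_0[OF I] u_zero by (auto intro!: exI[of _ 0])
  next
    fix x y assume "x \<in> Y" "y \<in> Y"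
    then obtain z z' where "d z - u x \<in> I" "d z' - u y \<in> I"
      unfolding Y_def by blast
    then have "(d z - u x) + (d z' - u y) \<in> I"
      using I by (rule subspace_add[rotated])
    then have "d (z + z') - u (x + y) \<in> I"
      by (simp add: d.add u_add algebra_simps)
    then show "x + y \<in> Y"
      unfolding Y_def by blast
  next
    fix c x assume "x \<in> Y"
    then obtain z where "d z - u x \<in> I"
      unfolding Y_def by blast
    then have "scale c (d z - u x) \<in> I"
      using I by (rule subspace_scale[rotated])
    then have "d (scale c z) - u (scale c x) \<in> I"
      by (simp add: d.scale u_scale scale_right_diff_distrib)
    then show "scale c x \<in> Y"
      unfolding Y_def by blast
  qed
  have YZ: "Y \<subseteq> {z. d z \<in> I}"
  proof
    fix y assume "y \<in> Y"
    then obtain z where z: "d z - u y \<in> I"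
      unfolding Y_def by blast
    have "u (d y) = (u (d y) - d (u y)) + d (d z) - d (d z - u y)"
      by (simp add: d.diff)
    then have "u (d y) \<in> I"
      using ud dd dI[OF z] I by (metis subspace_add subspace_diff)
    then show "y \<in> {z. d z \<in> I}"
      using inj by blast
  qed
  obtain S where S: "finite S" "card S \<le> k" "S \<subseteq> {z. d z \<in> I}"
    and Sz: "\<forall>z\<in>{z. d z \<in> I}. \<exists>s\<in>span S. z - s \<in> ?B"
    using q[unfolded hdim_le_def] by (rule qdim_leE)
  have "qdim_le Y ?B k"
    using q unfolding hdim_le_def by (rule qdim_le_subspace[OF B Y YZ])
  then obtain T where T: "finite T" "card T \<le> k" "T \<subseteq> Y"
    and Ty: "\<forall>y\<in>Y. \<exists>t\<in>span T. y - t \<in> ?B"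
    by (rule qdim_leE)
  have "\<forall>t\<in>T. \<exists>z. d z - u t \<in> I"
    using T(3) unfolding Y_def by blast
  then obtain f where "\<forall>t\<in>T. d (f t) - u t \<in> I"
    by (rule bchoice[THEN exE])
  then have f: "\<And>t. t \<in> T \<Longrightarrow> d (f t) - u t \<in> I"
    by blast
  have dlift: "\<exists>s\<in>span (f ` T). d s - u t \<in> I" if "t \<in> span T" for t
    using that
  proof (induction rule: span_induct_alt)
    case base
    then show ?case
      using subspace_0[OF I] span_zero u_zero by (intro bexI[of _ 0]) auto
  next
    case (step c x y)
    then obtain s where s: "s \<in> span (f ` T)" "d s - u y \<in> I"
      by blast
    have "scale c (d (f x) - u x) + (d s - u y) \<in> I"
      using I f step(1) s(2) by (blast intro: subspace_add subspace_scale)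
    then have "d (scale c (f x) + s) - u (scale c x + y) \<in> I"
      by (simp add: d.add u_add d.scale u_scale algebra_simps)
    moreover have "scale c (f x) + s \<in> span (f ` T)"
      using s step(1) by (blast intro: span_add span_scale span_base)
    ultimately show ?case
      by blast
  qed
  show ?thesis
    unfolding hdim_le_def qdim_le_def
  proof (intro exI[of _ "S \<union> f ` T"] conjI ballI)
    show "finite (S \<union> f ` T)"
      using S T by simp
    show "card (S \<union> f ` T) \<le> 2 * k"
      using S(2) T card_Un_le[of S "f ` T"] card_image_le[of T f] by linarith
    show "S \<union> f ` T \<subseteq> {z. d z \<in> ?J}"
    proof
      fix x assume "x \<in> S \<union> f ` T"
      then show "x \<in> {z. d z \<in> ?J}"
      proof
        assume "x \<in> S"
        then have "d x \<in> I"
          using S(3) by blast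
        then show ?thesis
          using IJ by (simp add: subset_iff)
      next
        assume "x \<in> f ` T"
        then obtain t where t: "x = f t" "d (f t) - u t \<in> I"
          using f by blast
        have "d x = u t + (d (f t) - u t)"
          using t by simp
        also have "\<dots> \<in> ?J"
          using t(2) by (rule JI)
        finally show ?thesis
          by simp
      qed
    qed
    fix z assume "z \<in> {z. d z \<in> ?J}"
    then obtain i y where iy: "d z = u y + i" "i \<in> I"
      by blast
    then have "y \<in> Y"
      unfolding Y_def by (intro CollectI exI[of _ z]) simp
    from bspec[OF Ty this] obtain t b i' where t: "t \<in> span T" "y - t = d b + i'" "i' \<in> I"
      by blast
    obtain s where s: "s \<in> span (f ` T)" "d s - u t \<in> I"
      using dlift[OF t(1)] by blast
    have y: "y = t + (d b + i')"
      using t(2) by (simp add: algebra_simps)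
    have eq: "d (z - s - u b) = i + (u (d b) - d (u b)) + u i' - (d s - u t)"
      by (simp add: d.diff iy(1) y u_add)
    have "z - s - u b \<in> {z. d z \<in> I}"
      unfolding mem_Collect_eq eq
      by (rule subspace_diff[OF I subspace_add[OF I subspace_add[OF I iy(2) ud] uI[OF t(3)]] s(2)])
    from bspec[OF Sz this] obtain s' c i'' where s': "s' \<in> span S" "z - s - u b - s' = d c + i''" "i'' \<in> I"
      by blast
    have "z - (s' + s) = (z - s - u b - s') + u b"
      by (simp add: algebra_simps)
    also have "\<dots> = d c + (i'' + u b)"
      unfolding s'(2) by (simp add: add_ac)
    finally have "z - (s' + s) = d c + (i'' + u b)" .
    moreover have "i'' + u b \<in> ?J"
      using JI[OF s'(3), of b] by (simp add: add.commute)
    ultimately have "z - (s' + s) \<in> {d b + i | b i. i \<in> ?J}"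
      by blast
    moreover have "s' + s \<in> span (S \<union> f ` T)"
      using s(1) s'(1) by (auto simp: span_Un)
    ultimately show "\<exists>s\<in>span (S \<union> f ` T). z - s \<in> {d b + i | b i. i \<in> ?J}"
      by (rule bexI)
  qed
qed

text \<open>
  A graded Euler characteristic bound for two-periodic complexes: with \<open>r\<close> the rank of \<open>D\<close> on \<open>P\<close> and
  \<open>r'\<close> its rank on \<open>Q\<close>, the cohomology in \<open>P\<close> has dimension \<open>dim P - r - r'\<close>, and \<open>r + r' \<le> dim Q\<close>
  because the image of \<open>P\<close> lies in the kernel on \<open>Q\<close>.
\<close>

lemma card_le_two_periodic:
  assumes D: "Vector_Spaces.linear scale scale D" and P: "subspace P"
    and DP: "\<And>x. x \<in> P \<Longrightarrow> D x \<in> Q"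
    and DD: "\<And>x. x \<in> P \<Longrightarrow> D (D x) = 0"
    and EP: "independent EP" "EP \<subseteq> P" and EQ: "finite EQ" "Q \<subseteq> span EQ"
    and S: "finite S" "\<And>z. z \<in> P \<Longrightarrow> D z = 0 \<Longrightarrow> \<exists>s\<in>span S. \<exists>q\<in>Q. z = s + D q"
  shows "card EP \<le> card S + card EQ"
proof -
  interpret D: Vector_Spaces.linear scale scale D by (rule D)
  have sDP: "subspace (D ` P)"
    by (rule D.subspace_image[OF P])
  obtain R where R: "R \<subseteq> D ` P" "independent R" "D ` P \<subseteq> span R"
    using maximal_independent_subset by blast
  have RQ: "R \<subseteq> Q"
    using R(1) DP by blast
  obtain R' where R': "R \<subseteq> R'" "R' \<subseteq> Q" "independent R'" "Q \<subseteq> span R'"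
    using maximal_independent_subset_extend[OF RQ R(2)] by blast
  have cR': "finite R'" "card R' \<le> card EQ"
    using independent_span_bound[OF EQ(1) R'(3)] R'(2) EQ(2) by blast+
  have fR: "finite R"
    using R'(1) cR'(1) finite_subset by blast
  obtain g where g: "\<And>x. x \<in> R \<Longrightarrow> g x \<in> P" "\<And>x. x \<in> R \<Longrightarrow> D (g x) = x"
    using R(1) by (metis image_iff subset_eq)
  define G where "G = g ` R \<union> S \<union> D ` (R' - R)"
  have fG: "finite G"
    unfolding G_def using fR S(1) cR'(1) by simp
  have "card G \<le> card (g ` R \<union> S) + card (D ` (R' - R))"
    unfolding G_def by (rule card_Un_le)
  also have "\<dots> \<le> (card (g ` R) + card S) + card (D ` (R' - R))"
    using card_Un_le by simp
  also have "\<dots> \<le> card R + card S + card (R' - R)"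
    using card_image_le[OF fR, of g] card_image_le[of "R' - R" D] cR'(1) by (simp add: add_mono)
  also have "\<dots> = card S + card R'"
    using card_Diff_subset[OF fR R'(1)] card_mono[OF cR'(1) R'(1)] by simp
  also have "\<dots> \<le> card S + card EQ"
    using cR'(2) by simp
  finally have cG: "card G \<le> card S + card EQ" .
  have DQ: "D q \<in> span (D ` (R' - R))" if "q \<in> Q" for q
  proof -
    have "D q \<in> D ` span R'"
      using that R'(4) by blast
    then have "D q \<in> span (D ` R')"
      by (simp add: D.span_image)
    moreover have "D ` R' \<subseteq> insert 0 (D ` (R' - R))"
    proof -
      have "D x = 0" if "x \<in> R" for x
        using that R(1) DD by blast
      then show ?thesis
        by blast
    qed
    ultimately have "D q \<in> span (insert 0 (D ` (R' - R)))"
      using span_mono by blast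
    then show ?thesis
      by simp
  qed
  have "P \<subseteq> span G"
  proof
    fix p assume p: "p \<in> P"
    have "D p \<in> span R"
      using p R(3) by blast
    then have "D p \<in> span (D ` (g ` R))"
      using g(2) by (simp add: image_image)
    then have "D p \<in> D ` span (g ` R)"
      by (simp only: D.span_image)
    then obtain y where y: "y \<in> span (g ` R)" "D p = D y"
      by blast
    have "y \<in> P"
      using y(1) g(1) span_minimal[of "g ` R" P] P by blast
    then have "p - y \<in> P" "D (p - y) = 0"
      using p P y(2) by (auto simp: D.diff intro: subspace_diff)
    then obtain s q where sq: "s \<in> span S" "q \<in> Q" "p - y = s + D q"
      using S(2) by blast
    then have "p = y + s + D q"
      by (simp add: algebra_simps)
    moreover have "y \<in> span G" "s \<in> span G" "D q \<in> span G"
      using y(1) sq(1) DQ[OF sq(2)] span_mono[of _ G] unfolding G_def by blast+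
    ultimately show "p \<in> span G"
      by (simp add: span_add)
  qed
  then have "card EP \<le> card G"
    using independent_span_bound[OF fG EP(1)] EP(2) by blast
  then show ?thesis
    using cG by simp
qed

end

text \<open>
  A surjection of complexes that identifies the two quotients carries cohomology bounds along.
\<close>

lemma hdim_le_transfer:
  assumes L: "Vector_Spaces.linear s1 s2 L"
    and I2: "module.subspace s2 I2"
    and LI: "\<And>x. x \<in> I1 \<Longrightarrow> L x \<in> I2" and inj: "\<And>x. L x \<in> I2 \<Longrightarrow> x \<in> I1"
    and comm: "\<And>x. L (d1 x) - d2 (L x) \<in> I2"
    and d2: "Vector_Spaces.linear s2 s2 d2" and dI: "\<And>x. x \<in> I2 \<Longrightarrow> d2 x \<in> I2"
    and surj: "\<And>y. \<exists>x. y - L x \<in> I2"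
    and q: "vector_space.hdim_le s1 d1 I1 k"
  shows "vector_space.hdim_le s2 d2 I2 k"
proof -
  interpret L: Vector_Spaces.linear s1 s2 L by (rule L)
  note d2_diff = module_hom.diff[OF d2[folded module_hom_iff_linear]]
  obtain S where S: "finite S" "card S \<le> k" "S \<subseteq> {z. d1 z \<in> I1}"
    and Sz: "\<forall>z\<in>{z. d1 z \<in> I1}. \<exists>s\<in>L.vs1.span S. z - s \<in> {d1 b + i | b i. i \<in> I1}"
    using q[unfolded L.vs1.hdim_le_def] by (rule L.vs1.qdim_leE)
  show ?thesis
    unfolding L.vs2.hdim_le_def L.vs2.qdim_le_def
  proof (intro exI[of _ "L ` S"] conjI ballI)
    show "finite (L ` S)"
      using S by simp
    show "card (L ` S) \<le> k"
      using S(2) card_image_le[OF S(1), of L] by linarith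
    show "L ` S \<subseteq> {z. d2 z \<in> I2}"
    proof
      fix y assume "y \<in> L ` S"
      then obtain x where x: "y = L x" "d1 x \<in> I1"
        using S(3) by blast
      have "d2 y = L (d1 x) - (L (d1 x) - d2 (L x))"
        by (simp add: x)
      also have "\<dots> \<in> I2"
        using LI[OF x(2)] comm I2 by (blast intro: L.vs2.subspace_diff)
      finally show "y \<in> {z. d2 z \<in> I2}"
        by simp
    qed
    fix y assume y: "y \<in> {z. d2 z \<in> I2}"
    obtain x where x: "y - L x \<in> I2"
      using surj by blast
    have "L (d1 x) = (L (d1 x) - d2 (L x)) + d2 y - d2 (y - L x)"
      by (simp add: d2_diff)
    also have "\<dots> \<in> I2"
      using comm dI[OF x] y I2 by (blast intro: L.vs2.subspace_diff L.vs2.subspace_add)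
    finally have "x \<in> {z. d1 z \<in> I1}"
      using inj by blast
    from bspec[OF Sz this] obtain s b i where sbi: "s \<in> L.vs1.span S" "x - s = d1 b + i" "i \<in> I1"
      by blast
    have "L x - L s = L (d1 b) + L i"
      using arg_cong[OF sbi(2), of L] by (simp add: L.diff L.add)
    then have "(y - L x) + (L x - L s) = (y - L x) + (L (d1 b) + L i)"
      by simp
    then have "y - L s = d2 (L b) + ((y - L x) + (L (d1 b) - d2 (L b)) + L i)"
      by (simp add: add_ac)
    moreover have "(y - L x) + (L (d1 b) - d2 (L b)) + L i \<in> I2"
      using x comm LI[OF sbi(3)] I2 by (blast intro: L.vs2.subspace_add)
    moreover have "L s \<in> L.vs2.span (L ` S)"
      using sbi(1) by (auto simp: L.span_image)
    ultimately show "\<exists>s\<in>L.vs2.span (L ` S). y - s \<in> {d2 b + i | b i. i \<in> I2}"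
      by blast
  qed
qed

section \<open>Total rank of Koszul complexes of commuting nilpotent operators\<close>

definition fscale :: "rat \<Rightarrow> ('x \<Rightarrow> rat) \<Rightarrow> 'x \<Rightarrow> rat" where
  "fscale c f = (\<lambda>x. c * f x)"

lemma fscale_apply [simp]: "fscale c f x = c * f x"
  by (simp add: fscale_def)

interpretation F: vector_space fscale
  by unfold_locales (auto simp: fun_eq_iff algebra_simps)

lemma linear_fscaleI:
  assumes "\<And>f g x. L (f + g) x = L f x + L g x" "\<And>c f x. L (fscale c f) x = c * L f x"
  shows "Vector_Spaces.linear fscale fscale L"
  by unfold_locales (auto simp: fun_eq_iff assms)

lemma sum_fun_apply: "(\<Sum>i\<in>A. f i) x = (\<Sum>i\<in>A. f i x)" for f :: "'i \<Rightarrow> 'x \<Rightarrow> rat"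
  by (induction A rule: infinite_finite_induct) auto

text \<open>
  The sign of moving \<open>v\<^sub>i\<close> to its place in the exterior monomial on \<open>T\<close>.
\<close>

definition ins_sign :: "nat \<Rightarrow> nat set \<Rightarrow> rat" where
  "ins_sign i T = (- 1) ^ card {j \<in> T. j < i}"

definition kidx :: "nat \<Rightarrow> 'i set \<Rightarrow> (nat set \<times> 'i) set" where
  "kidx n J = Pow {..<n} \<times> J"

text \<open>
  \<open>F (T, a)\<close> is the coefficient of \<open>v\<^sub>T \<otimes> a\<close>, where \<open>T\<close> runs through the sets of exterior generators and \<open>a\<close> through a
  basis \<open>J\<close> of the module.  The differential contracts each \<open>v\<^sub>i\<close> in turn while applying the operator with
  matrix \<open>X i\<close>.
\<close>

definition koszul ::
    "nat \<Rightarrow> 'i set \<Rightarrow> (nat \<Rightarrow> 'i \<Rightarrow> 'i \<Rightarrow> rat) \<Rightarrow> (nat set \<times> 'i \<Rightarrow> rat) \<Rightarrow> nat set \<times> 'i \<Rightarrow> rat" where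
  "koszul n J X F = (\<lambda>(T, a). if (T, a) \<in> kidx n J
     then \<Sum>i\<in>{..<n} - T. ins_sign i T * (\<Sum>b\<in>J. X i a b * F (insert i T, b)) else 0)"

text \<open>
  Functions are total, so values outside the index set are divided out.
\<close>

definition vanishing :: "'x set \<Rightarrow> ('x \<Rightarrow> rat) set" where
  "vanishing A = {F. \<forall>x\<in>A. F x = 0}"

lemma vanishingD: "F \<in> vanishing A \<Longrightarrow> x \<in> A \<Longrightarrow> F x = 0"
  by (simp add: vanishing_def)

lemma subspace_vanishing: "F.subspace (vanishing A)"
  by (rule F.subspaceI) (auto simp: vanishing_def)

lemma linear_koszul: "Vector_Spaces.linear fscale fscale (koszul n J X)"
  by (rule linear_fscaleI)
     (auto simp: koszul_def algebra_simps sum.distrib sum_distrib_left split: prod.splits)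

definition commuting :: "nat \<Rightarrow> 'i set \<Rightarrow> (nat \<Rightarrow> 'i \<Rightarrow> 'i \<Rightarrow> rat) \<Rightarrow> bool" where
  "commuting n J X \<longleftrightarrow> (\<forall>i<n. \<forall>i'<n. \<forall>a\<in>J. \<forall>b\<in>J.
     (\<Sum>c\<in>J. X i a c * X i' c b) = (\<Sum>c\<in>J. X i' a c * X i c b))"

lemma ins_sign_insert:
  assumes "finite T" "i \<notin> T" "i \<noteq> i'"
  shows "ins_sign i' (insert i T) = (if i < i' then - ins_sign i' T else ins_sign i' T)"
proof -
  have "{j \<in> insert i T. j < i'} = (if i < i' then insert i {j \<in> T. j < i'} else {j \<in> T. j < i'})"
    by auto
  then show ?thesis
    using assms by (simp add: ins_sign_def)
qed

lemma sum_antisymmetric: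
  fixes g :: "'a \<Rightarrow> 'a \<Rightarrow> rat"
  assumes "\<And>i j. i \<in> A \<Longrightarrow> j \<in> A \<Longrightarrow> i \<noteq> j \<Longrightarrow> g i j = - g j i" and "finite A"
  shows "(\<Sum>i\<in>A. \<Sum>j\<in>A - {i}. g i j) = 0"
proof -
  have e: "(\<Sum>j\<in>A - {i}. h j) = (\<Sum>j\<in>A. if i = j then 0 else h j)" for h :: "'a \<Rightarrow> rat" and i
    using assms(2) by (intro sum.mono_neutral_cong_left) auto
  let ?s = "\<Sum>i\<in>A. \<Sum>j\<in>A. if i = j then 0 else g i j"
  have "?s = (\<Sum>j\<in>A. \<Sum>i\<in>A. if i = j then 0 else g i j)"
    by (rule sum.swap)
  also have "\<dots> = (\<Sum>j\<in>A. \<Sum>i\<in>A. - (if j = i then 0 else g j i))"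
  proof (intro sum.cong refl)
    fix j i assume "j \<in> A" "i \<in> A"
    then show "(if i = j then 0 else g i j) = - (if j = i then 0 else g j i)"
      using assms(1)[of i j] by (cases "i = j") simp_all
  qed
  also have "\<dots> = - ?s"
    by (simp add: sum_negf)
  finally show ?thesis
    by (simp add: e)
qed

text \<open>
  Contracting \<open>v\<^sub>i\<close> and \<open>v\<^sub>j\<close> in either order gives the same term up to sign, because the operators commute.
\<close>

lemma koszul_koszul:
  assumes X: "commuting n J X"
  shows "koszul n J X (koszul n J X F) = 0"
proof
  fix p :: "nat set \<times> 'a"
  obtain T a where p: "p = (T, a)"
    by (cases p)
  show "koszul n J X (koszul n J X F) p = 0 p"
  proof (cases "(T, a) \<in> kidx n J")
    case True
    then have T: "T \<subseteq> {..<n}" and a: "a \<in> J"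
      by (auto simp: kidx_def)
    have fT: "finite T"
      using T finite_subset by blast
    let ?A = "{..<n} - T"
    define g where "g i i' = ins_sign i T * ins_sign i' (insert i T) *
        (\<Sum>c\<in>J. (\<Sum>b\<in>J. X i a b * X i' b c) * F (insert i' (insert i T), c))" for i i'
    have "koszul n J X (koszul n J X F) p = (\<Sum>i\<in>?A. \<Sum>i'\<in>?A - {i}. g i i')"
      unfolding p koszul_def[of n J X "koszul n J X F"] prod.case if_P[OF True]
    proof (intro sum.cong refl)
      fix i assume i: "i \<in> ?A"
      have eq: "{..<n} - insert i T = ?A - {i}"
        by auto
      have "ins_sign i T * (\<Sum>b\<in>J. X i a b * koszul n J X F (insert i T, b)) =
        (\<Sum>b\<in>J. \<Sum>i'\<in>?A - {i}. \<Sum>c\<in>J. ins_sign i T * (X i a b * (ins_sign i' (insert i T) *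
           (X i' b c * F (insert i' (insert i T), c)))))"
        using T i by (simp add: koszul_def kidx_def eq sum_distrib_left)
      also have "\<dots> = (\<Sum>i'\<in>?A - {i}. \<Sum>b\<in>J. \<Sum>c\<in>J. ins_sign i T * (X i a b * (ins_sign i' (insert i T) *
           (X i' b c * F (insert i' (insert i T), c)))))"
        by (rule sum.swap)
      also have "\<dots> = (\<Sum>i'\<in>?A - {i}. \<Sum>c\<in>J. \<Sum>b\<in>J. ins_sign i T * (X i a b * (ins_sign i' (insert i T) *
           (X i' b c * F (insert i' (insert i T), c)))))"
        by (rule sum.cong[OF refl]) (rule sum.swap)
      also have "\<dots> = (\<Sum>i'\<in>?A - {i}. g i i')"
        by (simp add: g_def sum_distrib_left sum_distrib_right mult_ac)
      finally show "ins_sign i T * (\<Sum>b\<in>J. X i a b * koszul n J X F (insert i T, b)) =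
          (\<Sum>i'\<in>?A - {i}. g i i')" .
    qed
    also have "\<dots> = 0"
    proof (rule sum_antisymmetric)
      fix i i' assume ii: "i \<in> ?A" "i' \<in> ?A" "i \<noteq> i'"
      have s: "ins_sign i T * ins_sign i' (insert i T) = - (ins_sign i' T * ins_sign i (insert i' T))"
        using ii fT by (auto simp: ins_sign_insert)
      have c: "(\<Sum>b\<in>J. X i a b * X i' b c) = (\<Sum>b\<in>J. X i' a b * X i b c)" if "c \<in> J" for c
        using X ii a that by (simp add: commuting_def)
      show "g i i' = - g i' i"
        unfolding g_def s using c by (simp add: insert_commute)
    qed simp
    finally show ?thesis
      by simp
  next
    case False
    then show ?thesis
      by (simp add: p koszul_def)
  qed
qed

lemma koszul_vanishing:
  assumes "F \<in> vanishing (kidx n J)"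
  shows "koszul n J X F = 0"
proof
  fix p :: "nat set \<times> 'a"
  obtain T a where p: "p = (T, a)"
    by (cases p)
  show "koszul n J X F p = 0 p"
    unfolding p using assms
    by (auto simp: koszul_def kidx_def vanishing_def intro!: sum.neutral)
qed

text \<open>
  The operators \<open>X i \<otimes> 1 - 1 \<otimes> X i\<close> on \<open>M \<otimes> M\<close>.  Their Koszul complex computes the derived tensor
  product of \<open>M\<close> with itself over the polynomial ring acting through \<open>X\<close>.
\<close>

definition doubled :: "(nat \<Rightarrow> 'i \<Rightarrow> 'i \<Rightarrow> rat) \<Rightarrow> nat \<Rightarrow> 'i \<times> 'i \<Rightarrow> 'i \<times> 'i \<Rightarrow> rat" where
  "doubled X i p q = (if snd p = snd q then X i (fst p) (fst q) else 0) -
                     (if fst p = fst q then X i (snd p) (snd q) else 0)"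

lemma sum_doubled:
  assumes "finite J" "a \<in> J" "a' \<in> J"
  shows "(\<Sum>c\<in>J \<times> J. doubled X i (a, a') c * G c) =
    (\<Sum>c\<in>J. X i a c * G (c, a')) - (\<Sum>c\<in>J. X i a' c * G (a, c))"
proof -
  have "(\<Sum>c\<in>J \<times> J. doubled X i (a, a') c * G c) =
    (\<Sum>c\<in>J. \<Sum>c'\<in>J. doubled X i (a, a') (c, c') * G (c, c'))"
    by (simp add: sum.cartesian_product)
  also have "\<dots> = (\<Sum>c\<in>J. \<Sum>c'\<in>J. (if a' = c' then X i a c * G (c, c') else 0)) -
      (\<Sum>c\<in>J. \<Sum>c'\<in>J. (if a = c then X i a' c' * G (c, c') else 0))"
    unfolding sum_subtractf[symmetric]
    by (intro sum.cong refl) (simp add: doubled_def left_diff_distrib)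
  also have "(\<Sum>c\<in>J. \<Sum>c'\<in>J. (if a = c then X i a' c' * G (c, c') else 0)) =
      (\<Sum>c'\<in>J. \<Sum>c\<in>J. (if a = c then X i a' c' * G (c, c') else 0))"
    by (rule sum.swap)
  finally show ?thesis
    using assms by simp
qed

lemma commuting_doubled:
  assumes J: "finite J" and X: "commuting n J X"
  shows "commuting n (J \<times> J) (doubled X)"
  unfolding commuting_def
proof (intro allI impI ballI)
  fix i i' p q assume ii: "i < n" "i' < n" and pq: "p \<in> J \<times> J" "q \<in> J \<times> J"
  obtain a a' b b' where e: "p = (a, a')" "q = (b, b')" and abs: "a \<in> J" "a' \<in> J" "b \<in> J" "b' \<in> J"
    using pq by auto
  have *: "(\<Sum>c\<in>J \<times> J. doubled X i p c * doubled X i' c q) =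
    (if a' = b' then \<Sum>c\<in>J. X i a c * X i' c b else 0) + (if a = b then \<Sum>c\<in>J. X i a' c * X i' c b' else 0)
     - X i a b * X i' a' b' - X i' a b * X i a' b'" for i i'
  proof -
    have 1: "(\<Sum>c\<in>J. X i a c * doubled X i' (c, a') q) =
      (if a' = b' then \<Sum>c\<in>J. X i a c * X i' c b else 0) - X i a b * X i' a' b'"
    proof -
      have "(\<Sum>c\<in>J. X i a c * doubled X i' (c, a') q) =
        (\<Sum>c\<in>J. if a' = b' then X i a c * X i' c b else 0) - (\<Sum>c\<in>J. if c = b then X i a c * X i' a' b' else 0)"
        unfolding sum_subtractf[symmetric]
        by (intro sum.cong refl) (simp add: e doubled_def right_diff_distrib)
      then show ?thesis
        using J abs by simp
    qed
    have 2: "(\<Sum>c\<in>J. X i a' c * doubled X i' (a, c) q) =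
      X i' a b * X i a' b' - (if a = b then \<Sum>c\<in>J. X i a' c * X i' c b' else 0)"
    proof -
      have "(\<Sum>c\<in>J. X i a' c * doubled X i' (a, c) q) =
        (\<Sum>c\<in>J. if c = b' then X i a' c * X i' a b else 0) - (\<Sum>c\<in>J. if a = b then X i a' c * X i' c b' else 0)"
        unfolding sum_subtractf[symmetric]
        by (intro sum.cong refl) (simp add: e doubled_def right_diff_distrib)
      then show ?thesis
        using J abs by simp
    qed
    show ?thesis
      unfolding e(1) sum_doubled[OF J abs(1,2)] 1[unfolded e(1)] 2 by simp
  qed
  have c: "(\<Sum>c\<in>J. X i a c * X i' c b) = (\<Sum>c\<in>J. X i' a c * X i c b)" if "a \<in> J" "b \<in> J" for a b
    using X ii that by (simp add: commuting_def)
  show "(\<Sum>c\<in>J \<times> J. doubled X i p c * doubled X i' c q) = (\<Sum>c\<in>J \<times> J. doubled X i' p c * doubled X i c q)"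
    unfolding * using c abs by simp
qed


text \<open>
  Filtering \<open>M \<otimes> M\<close> by the second factor, on which the operators are nilpotent, leaves \<open>card J\<close> copies of
  the Koszul complex of \<open>M\<close>.
\<close>

lemma hdim_le_doubled:
  assumes J: "finite J" and X: "commuting n J X"
    and tri: "\<And>i a b. i < n \<Longrightarrow> a \<in> J \<Longrightarrow> b \<in> J \<Longrightarrow> X i a b \<noteq> 0 \<Longrightarrow> w b < (w a :: nat)"
    and q: "F.hdim_le (koszul n J X) (vanishing (kidx n J)) k"
  shows "F.hdim_le (koszul n (J \<times> J) (doubled X)) (vanishing (kidx n (J \<times> J))) (card J * k)"
proof -
  let ?d = "koszul n J X" and ?D = "koszul n (J \<times> J) (doubled X)"
  define row where "row x G = (\<lambda>(T, a). G (T, (a, x)))" for x :: 'a and G :: "nat set \<times> 'a \<times> 'a \<Rightarrow> rat"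
  define put where "put x G = (\<lambda>(T, (a, a')). if a' = x then G (T, a) else 0)"
    for x :: 'a and G :: "nat set \<times> 'a \<Rightarrow> rat"
  have put_lin: "Vector_Spaces.linear fscale fscale (put x)" for x
    by (rule linear_fscaleI) (auto simp: put_def)
  have row_D: "row x (?D G) (T, a) = ?d (row x G) (T, a)"
    if x: "x \<in> J" and G: "\<And>T a a'. T \<subseteq> {..<n} \<Longrightarrow> a \<in> J \<Longrightarrow> a' \<in> J \<Longrightarrow> w a' < w x \<Longrightarrow> G (T, (a, a')) = 0"
    for x G T a
  proof (cases "(T, a) \<in> kidx n J")
    case True
    then have T: "T \<subseteq> {..<n}" and a: "a \<in> J"
      by (auto simp: kidx_def)
    have "(\<Sum>b\<in>J \<times> J. doubled X i (a, x) b * G (insert i T, b)) = (\<Sum>b\<in>J. X i a b * row x G (insert i T, b))"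
      if i: "i \<in> {..<n} - T" for i
    proof -
      have "X i x c * G (insert i T, (a, c)) = 0" if "c \<in> J" for c
        using tri[of i x c] G[of "insert i T" a c] x i T a that by auto
      then have "(\<Sum>c\<in>J. X i x c * G (insert i T, (a, c))) = 0"
        by (intro sum.neutral) blast
      then show ?thesis
        unfolding sum_doubled[OF J a x] by (simp add: row_def)
    qed
    then show ?thesis
      using True x by (simp add: row_def koszul_def kidx_def)
  next
    case False
    then have "(T, (a, x)) \<notin> kidx n (J \<times> J)"
      by (auto simp: kidx_def)
    then show ?thesis
      using False by (simp add: row_def koszul_def)
  qed
  have sub: "F.subspace (vanishing A)" for A :: "'z set"
    by (rule subspace_vanishing)
  interpret D: Vector_Spaces.linear fscale fscale ?D
    by (rule linear_koszul)
  let ?I = "\<lambda>S. vanishing (kidx n (J \<times> S))"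
  have stable: "?D G \<in> ?I S"
    if S: "S \<subseteq> J" "\<And>a b. a \<in> S \<Longrightarrow> b \<in> J \<Longrightarrow> w b < w a \<Longrightarrow> b \<in> S" and G: "G \<in> ?I S" for S G
  proof -
    have "?D G (T, (a, x)) = 0" if T: "T \<subseteq> {..<n}" and a: "a \<in> J" and x: "x \<in> S" for T a x
    proof -
      have "?D G (T, (a, x)) = row x (?D G) (T, a)"
        by (simp add: row_def)
      also have "\<dots> = ?d (row x G) (T, a)"
      proof (rule row_D)
        show "x \<in> J"
          using x S(1) by blast
        fix T a a' assume "T \<subseteq> {..<n}" "a \<in> J" "a' \<in> J" "w a' < w x"
        then show "G (T, (a, a')) = 0"
          using G S(2)[OF x] by (simp add: vanishing_def kidx_def)
      qed
      also have "row x G \<in> vanishing (kidx n J)"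
        using G x by (simp add: vanishing_def kidx_def row_def)
      then have "?d (row x G) (T, a) = 0"
        using koszul_vanishing[of "row x G" n J X] by simp
      finally show ?thesis .
    qed
    then show ?thesis
      by (auto simp: vanishing_def kidx_def)
  qed
  \<comment> \<open>Induction over sets \<open>S\<close> closed under lower weight: tensors without components in \<open>S\<close> form a subcomplex.\<close>
  have "(\<forall>a\<in>S. \<forall>b\<in>J. w b < w a \<longrightarrow> b \<in> S) \<and> S \<subseteq> J \<longrightarrow> F.hdim_le ?D (?I S) (card S * k)" if "finite S" for S
    using that
  proof (induction S rule: finite_ranking_induct[where f = w])
    case empty
    have "\<exists>b i. z = ?D b + i" for z
      by (rule exI[of _ 0], rule exI[of _ z]) (simp add: D.zero)
    then show ?case
      unfolding F.hdim_le_def F.qdim_le_def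
      by (intro impI exI[of _ "{}"]) (auto simp: vanishing_def kidx_def)
  next
    case (insert x S)
    show ?case
    proof (cases "x \<in> S")
      case True
      then show ?thesis
        using insert by (simp add: insert_absorb)
    next
      case False
      show ?thesis
      proof
        assume low: "(\<forall>a\<in>insert x S. \<forall>b\<in>J. w b < w a \<longrightarrow> b \<in> insert x S) \<and> insert x S \<subseteq> J"
        then have x: "x \<in> J" and SJ: "S \<subseteq> J"
          by auto
        have lowS: "b \<in> S" if "a \<in> S" "b \<in> J" "w b < w a" for a b
          using low insert(2)[OF that(1)] that by force
        have lowx: "b \<in> S" if "b \<in> J" "w b < w x" for b
          using low that by auto
        have IH: "F.hdim_le ?D (?I S) (card S * k)"
          using insert(3) lowS SJ by blast
        have rowS: "row x (?D G) (T, a) = ?d (row x G) (T, a)" if G: "G \<in> ?I S" for G T a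
        proof (rule row_D[OF x])
          fix T a a' assume "T \<subseteq> {..<n}" "a \<in> J" "a' \<in> J" "w a' < w x"
          then show "G (T, (a, a')) = 0"
            using G lowx by (simp add: vanishing_def kidx_def)
        qed
        have Iins: "G \<in> ?I (insert x S) \<longleftrightarrow> G \<in> ?I S \<and> row x G \<in> vanishing (kidx n J)" for G
          by (auto simp: vanishing_def kidx_def row_def)
        have putI: "put x G \<in> ?I S" for G
          using False by (auto simp: vanishing_def kidx_def put_def)
        have row_put: "row x (put x G) = G" for G
          by (auto simp: row_def put_def)
        have row_diff: "row x (G - H) = row x G - row x H" for G H
          by (auto simp: row_def)
        obtain B where B: "finite B" "card B \<le> k" "B \<subseteq> {z. ?d z \<in> vanishing (kidx n J)}"
          and Bz: "\<forall>z\<in>{z. ?d z \<in> vanishing (kidx n J)}. \<exists>s\<in>F.span B.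
             z - s \<in> {?d b + i | b i. i \<in> vanishing (kidx n J)}"
          using q[unfolded F.hdim_le_def] by (rule F.qdim_leE)
        have gr: "F.qdim_le {z \<in> ?I S. ?D z \<in> ?I (insert x S)}
           {?D b + i | b i. b \<in> ?I S \<and> i \<in> ?I (insert x S)} k"
          unfolding F.qdim_le_def
        proof (intro exI[of _ "put x ` B"] conjI ballI)
          show "finite (put x ` B)"
            using B by simp
          show "card (put x ` B) \<le> k"
            using card_image_le[OF B(1), of "put x"] B(2) by linarith
          show "put x ` B \<subseteq> {z \<in> ?I S. ?D z \<in> ?I (insert x S)}"
          proof
            fix z assume "z \<in> put x ` B"
            then obtain b where b: "z = put x b" "b \<in> B"
              by blast
            have "row x (?D z) = ?d b"
              using rowS[OF putI[of b]] by (auto simp: b(1) row_put)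
            then show "z \<in> {z \<in> ?I S. ?D z \<in> ?I (insert x S)}"
              using B(3) b stable[OF SJ lowS] putI by (auto simp: Iins)
          qed
          fix z assume z: "z \<in> {z \<in> ?I S. ?D z \<in> ?I (insert x S)}"
          then have "row x (?D z) \<in> vanishing (kidx n J)"
            by (simp add: Iins)
          moreover have "row x (?D z) = ?d (row x z)"
            using rowS[of z] z by auto
          ultimately have "row x z \<in> {z. ?d z \<in> vanishing (kidx n J)}"
            by simp
          from bspec[OF Bz this] obtain s b i where s: "s \<in> F.span B" "row x z - s = ?d b + i"
              "i \<in> vanishing (kidx n J)"
            by blast
          define r where "r = z - put x s - ?D (put x b)"
          have "r \<in> ?I S"
            unfolding r_def using z putI stable[OF SJ lowS putI] by (intro F.subspace_diff sub) auto
          moreover have "row x r = i"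
          proof -
            have "row x (?D (put x b)) = ?d b"
              using rowS[OF putI[of b]] by (auto simp: row_put)
            then have "row x r = row x z - s - ?d b"
              unfolding r_def row_diff row_put by simp
            then show ?thesis
              unfolding s(2) by simp
          qed
          ultimately have "r \<in> ?I (insert x S)"
            using s(3) by (simp add: Iins)
          moreover have "z - put x s = ?D (put x b) + r"
            by (simp add: r_def)
          ultimately have "z - put x s \<in> {?D b + i | b i. b \<in> ?I S \<and> i \<in> ?I (insert x S)}"
            using putI by blast
          moreover have "put x s \<in> F.span (put x ` B)"
          proof -
            have "F.span (put x ` B) = put x ` F.span B"
              by (rule module_hom.span_image) (rule put_lin[folded module_hom_iff_linear])
            then show ?thesis
              using s(1) by blast
          qed
          ultimately show "\<exists>s\<in>F.span (put x ` B).
              z - s \<in> {?D b + i | b i. b \<in> ?I S \<and> i \<in> ?I (insert x S)}"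
            by blast
        qed
        have "F.hdim_le ?D (?I (insert x S)) (card S * k + k)"
        proof (rule F.hdim_le_extension[OF linear_koszul sub sub _ _ IH gr])
          show "?I (insert x S) \<subseteq> ?I S"
            using Iins by blast
          show "?D (?D G) \<in> ?I (insert x S)" for G
            by (simp add: koszul_koszul[OF commuting_doubled[OF J X]] F.subspace_0[OF sub])
        qed
        then show "F.hdim_le ?D (?I (insert x S)) (card (insert x S) * k)"
          using False insert(1) by (simp add: add.commute)
      qed
    qed
  qed
  from this[OF J] show ?thesis
    by auto
qed


text \<open>
  The swap of the two factors anticommutes with the differential of the Koszul complex of \<open>M \<otimes> M\<close>, so this
  differential exchanges symmetric and antisymmetric tensors.  The Euler characteristic of the resulting
  two-periodic complex is the trace of the swap, namely \<open>2 ^ n * dim M\<close>, and the cohomology has at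
  most \<open>dim M\<close> times the dimension of that of the Koszul complex of \<open>M\<close>.
\<close>

theorem koszul_total_rank:
  assumes J: "finite J" "J \<noteq> {}" and X: "commuting n J X"
    and tri: "\<And>i a b. i < n \<Longrightarrow> a \<in> J \<Longrightarrow> b \<in> J \<Longrightarrow> X i a b \<noteq> 0 \<Longrightarrow> w b < (w a :: nat)"
    and q: "F.hdim_le (koszul n J X) (vanishing (kidx n J)) k"
  shows "2 ^ n \<le> k"
proof -
  let ?K = "kidx n (J \<times> J)" and ?D = "koszul n (J \<times> J) (doubled X)"
  have fK: "finite ?K"
    using J(1) by (simp add: kidx_def)
  define swap where "swap F = (\<lambda>(T, (a, b)). F (T, (b, a)))" for F :: "nat set \<times> 'a \<times> 'a \<Rightarrow> rat"
  define res where "res F = (\<lambda>x. if x \<in> ?K then F x else 0)" for F :: "nat set \<times> 'a \<times> 'a \<Rightarrow> rat"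
  interpret D: Vector_Spaces.linear fscale fscale ?D
    by (rule linear_koszul)
  have swap_swap: "swap (swap F) = F" for F
    by (auto simp: swap_def)
  have swap_scale: "swap (fscale c F) = fscale c (swap F)" for c F
    by (auto simp: swap_def)
  have swap_add: "swap (F + G) = swap F + swap G" and swap_minus: "swap (- F) = - swap F"
    and swap_diff: "swap (F - G) = swap F - swap G" for F G
    by (auto simp: swap_def)
  have swap_D: "?D (swap F) = - swap (?D F)" for F
  proof
    fix p :: "nat set \<times> 'a \<times> 'a"
    obtain T a b where p: "p = (T, (a, b))"
      by (cases p)
    show "?D (swap F) p = (- swap (?D F)) p"
    proof (cases "p \<in> ?K")
      case True
      then have ab: "a \<in> J" "b \<in> J" and ba: "(T, (b, a)) \<in> ?K"
        by (auto simp: kidx_def p)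
      have "(\<Sum>c\<in>J \<times> J. doubled X i (a, b) c * swap F (S, c)) =
          - (\<Sum>c\<in>J \<times> J. doubled X i (b, a) c * F (S, c))" for i S
        unfolding sum_doubled[OF J(1) ab] sum_doubled[OF J(1) ab(2,1)] by (simp add: swap_def)
      then show ?thesis
        using True ba by (simp add: p koszul_def swap_def sum_negf)
    next
      case False
      then have "(T, (b, a)) \<notin> ?K"
        by (auto simp: kidx_def p)
      then show ?thesis
        using False by (simp add: p koszul_def swap_def)
    qed
  qed
  have res_D: "res (?D F) = ?D F" for F
    by (auto simp: res_def koszul_def fun_eq_iff)
  have D_res: "?D (res F) = ?D F" for F
  proof -
    have "res F - F \<in> vanishing ?K"
      by (simp add: vanishing_def res_def)
    then have "?D (res F - F) = 0"
      by (rule koszul_vanishing)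
    then show ?thesis
      by (simp add: D.diff)
  qed
  have res_swap: "swap (res F) = res (swap F)" for F
    by (auto simp: res_def swap_def kidx_def)
  have res_add: "res (F + G) = res F + res G" and res_scale: "res (fscale c F) = fscale c (res F)"
    and res_minus: "res (- F) = - res F" and res_diff: "res (F - G) = res F - res G" for F G c
    by (auto simp: res_def)
  have res_res: "res (res F) = res F" for F
    by (simp add: res_def fun_eq_iff)
  define P where "P = {F. res F = F \<and> swap F = F}"
  define Q where "Q = {F. res F = F \<and> swap F = - F}"
  have res0: "res 0 = 0" and swap0: "swap 0 = 0"
    by (auto simp: res_def swap_def)
  have P: "F.subspace P"
    by (rule F.subspaceI) (auto simp: P_def res_add swap_add swap_scale res_scale res0 swap0)
  have DP: "?D F \<in> Q" if "F \<in> P" for F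
  proof -
    have "swap (?D F) = - ?D (swap F)"
      by (simp add: swap_D)
    then show ?thesis
      using that by (simp add: P_def Q_def res_D)
  qed
  \<comment> \<open>An ordering of \<open>J\<close> selects one representative of each unordered pair.\<close>
  obtain g :: "'a \<Rightarrow> nat" where g: "inj_on g J"
    using finite_imp_inj_to_nat_seg[OF J(1)] by blast
  define IP where "IP = {(T, (a, b)). (T, (a, b)) \<in> ?K \<and> g a \<le> g b}"
  define IQ where "IQ = {(T, (a, b)). (T, (a, b)) \<in> ?K \<and> g a < g b}"
  define sy where "sy = (\<lambda>(T :: nat set, (a :: 'a, b :: 'a)) x. if x = (T, (a, b)) \<or> x = (T, (b, a)) then 1 else (0 :: rat))"
  define alt where "alt = (\<lambda>(T :: nat set, (a :: 'a, b :: 'a)) x. if x = (T, (a, b)) then 1 else if x = (T, (b, a)) then - 1 else (0 :: rat))"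
  have fIP: "finite IP" and fIQ: "finite IQ"
    using fK by (auto simp: IP_def IQ_def intro: finite_subset)
  have cIP: "card IP = card IQ + 2 ^ n * card J"
  proof -
    have key: "g a \<le> g b \<longleftrightarrow> g a < g b \<or> a = b" if "a \<in> J" "b \<in> J" for a b
      using inj_onD[OF g _ that] by (auto simp: le_less)
    have "(T, (a, b)) \<in> IP \<longleftrightarrow>
        (T, (a, b)) \<in> IQ \<union> (\<lambda>(T, a). (T, (a, a))) ` (Pow {..<n} \<times> J)" for T a b
      using key[of a b] by (auto simp: IP_def IQ_def kidx_def image_iff)
    then have "IP = IQ \<union> (\<lambda>(T, a). (T, (a, a))) ` (Pow {..<n} \<times> J)"
      by (simp add: set_eq_iff split_paired_all)
    moreover have "IQ \<inter> (\<lambda>(T, a). (T, (a, a))) ` (Pow {..<n} \<times> J) = {}"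
      by (auto simp: IQ_def)
    moreover have "card ((\<lambda>(T, a). (T, (a, a))) ` (Pow {..<n} \<times> J)) = card (Pow {..<n} \<times> J)"
      by (intro card_image) (auto simp: inj_on_def)
    ultimately show ?thesis
      using fIQ J(1) by (simp add: card_Un_disjoint card_Pow)
  qed
  have sy_IP: "sy x y = (if x = y then 1 else 0)" if "x \<in> IP" "y \<in> IP" for x y
  proof -
    obtain T a b T' a' b' where e: "x = (T, (a, b))" "y = (T', (a', b'))"
      by (cases x, cases y) auto
    have "a = b" if "y = (T, (b, a))"
      using that \<open>x \<in> IP\<close> \<open>y \<in> IP\<close> inj_onD[OF g, of a b] by (auto simp: e IP_def kidx_def)
    then show ?thesis
      by (auto simp: sy_def e)
  qed
  have inj_sy: "inj_on sy IP"
  proof (rule inj_onI)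
    fix x y assume xy: "x \<in> IP" "y \<in> IP" and e: "sy x = sy y"
    have "sy y x = 1"
      unfolding e[symmetric] using sy_IP[OF xy(1,1)] by simp
    then show "x = y"
      using sy_IP[OF xy(2,1)] by (auto split: if_splits)
  qed
  have EP: "F.independent (sy ` IP)"
  proof (rule F.independent_if_scalars_zero)
    show "finite (sy ` IP)"
      using fIP by simp
    fix c y assume s: "(\<Sum>x\<in>sy ` IP. fscale (c x) x) = 0" and "y \<in> sy ` IP"
    then obtain x where x: "x \<in> IP" "y = sy x"
      by blast
    have "0 = (\<Sum>z\<in>IP. fscale (c (sy z)) (sy z)) x"
      using s inj_sy by (simp add: sum.reindex)
    also have "\<dots> = (\<Sum>z\<in>IP. if z = x then c (sy x) else 0)"
      unfolding sum_fun_apply by (intro sum.cong refl) (simp add: sy_IP x(1))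
    also have "\<dots> = c y"
      using x fIP by simp
    finally show "c y = 0"
      by simp
  qed
  have EPP: "sy ` IP \<subseteq> P"
    by (auto simp: P_def sy_def IP_def res_def swap_def kidx_def fun_eq_iff split: if_splits)
  have EQ: "Q \<subseteq> F.span (alt ` IQ)"
  proof
    fix G assume "G \<in> Q"
    then have G: "res G = G" "swap G = - G"
      by (auto simp: Q_def)
    have G1: "G (T, (b, a)) = - G (T, (a, b))" for T a b
      using fun_cong[OF G(2), of "(T, (a, b))"] by (simp add: swap_def)
    have G2: "G p = 0" if "p \<notin> ?K" for p
      using fun_cong[OF G(1), of p] that by (simp add: res_def)
    have "G p = (\<Sum>x\<in>IQ. fscale (G x) (alt x)) p" for p
    proof -
      obtain T a b where p: "p = (T, (a, b))"
        by (cases p)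
      have pos: "(\<Sum>x\<in>IQ. fscale (G x) (alt x)) (T, (a, b)) = G (T, (a, b))" if "(T, (a, b)) \<in> IQ" for T a b
      proof -
        have "(\<Sum>x\<in>IQ. fscale (G x) (alt x)) (T, (a, b)) = (\<Sum>x\<in>IQ. if x = (T, (a, b)) then G (T, (a, b)) else 0)"
          unfolding sum_fun_apply
          using that by (intro sum.cong refl) (auto simp: alt_def IQ_def split: if_splits)
        then show ?thesis
          using that fIQ by simp
      qed
      have neg: "(\<Sum>x\<in>IQ. fscale (G x) (alt x)) (T, (b, a)) = - (\<Sum>x\<in>IQ. fscale (G x) (alt x)) (T, (a, b))" for T a b
      proof -
        have "alt x (T, (b, a)) = - alt x (T, (a, b))" if x: "x \<in> IQ" for x
        proof -
          obtain T' a' b' where e: "x = (T', (a', b'))"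
            by (cases x)
          have "a' \<noteq> b'"
            using x by (auto simp: e IQ_def)
          then show ?thesis
            unfolding e alt_def prod.case by (simp split: if_split)
        qed
        then show ?thesis
          by (simp add: sum_fun_apply sum_negf)
      qed
      show ?thesis
      proof (cases "(T, (a, b)) \<in> IQ \<or> (T, (b, a)) \<in> IQ")
        case True
        then show ?thesis
          using pos[of T a b] pos[of T b a] neg[of T a b] G1[of T a b] by (auto simp: p)
      next
        case False
        have "(\<Sum>x\<in>IQ. fscale (G x) (alt x)) p = 0"
          unfolding sum_fun_apply using False by (intro sum.neutral) (auto simp: alt_def p split: if_splits)
        moreover have "G p = 0"
        proof (cases "p \<in> ?K")
          case True
          then have "a = b"
            using False g by (auto simp: IQ_def p kidx_def inj_on_def)
          then show ?thesis
            using G1[of T a a] by (simp add: p)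
        qed (rule G2)
        ultimately show ?thesis
          by simp
      qed
    qed
    then have "G = (\<Sum>x\<in>IQ. fscale (G x) (alt x))"
      by (rule ext)
    also have "\<dots> \<in> F.span (alt ` IQ)"
      by (intro F.span_sum F.span_scale F.span_base) auto
    finally show "G \<in> F.span (alt ` IQ)" .
  qed
  have "F.hdim_le ?D (vanishing ?K) (card J * k)"
    using hdim_le_doubled[OF J(1) X tri q] .
  then obtain S where S: "finite S" "card S \<le> card J * k" "S \<subseteq> {z. ?D z \<in> vanishing ?K}"
    and Sz: "\<forall>z\<in>{z. ?D z \<in> vanishing ?K}. \<exists>s\<in>F.span S. z - s \<in> {?D b + i | b i. i \<in> vanishing ?K}"
    unfolding F.hdim_le_def by (rule F.qdim_leE)
  define sym where "sym F = fscale (1 / 2) (res F + res (swap F))" for F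
  have sym_lin: "Vector_Spaces.linear fscale fscale sym"
    by (rule linear_fscaleI) (auto simp: sym_def res_add swap_add res_scale swap_scale algebra_simps add_divide_distrib)
  interpret sym: Vector_Spaces.linear fscale fscale sym
    by (rule sym_lin)
  have "card (sy ` IP) \<le> card (sym ` S) + card (alt ` IQ)"
  proof (rule F.card_le_two_periodic[OF linear_koszul P DP _ EP EPP _ EQ])
    show "?D (?D F) = 0" for F
      by (rule koszul_koszul[OF commuting_doubled[OF J(1) X]])
    show "finite (alt ` IQ)" "finite (sym ` S)"
      using fIQ S(1) by auto
    fix z assume z: "z \<in> P" and "?D z = 0"
    then have "z \<in> {z. ?D z \<in> vanishing ?K}"
      by (simp add: F.subspace_0[OF subspace_vanishing])
    from bspec[OF Sz this] obtain s b i where s: "s \<in> F.span S" "z - s = ?D b + i" "i \<in> vanishing ?K"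
      by blast
    define q where "q = fscale (1 / 2) (res b - res (swap b))"
    have "q \<in> Q"
      by (auto simp: q_def Q_def res_scale swap_scale res_diff res_res res_swap swap_swap swap_diff fun_eq_iff field_simps)
    moreover have "sym z = z"
      using z by (auto simp: sym_def P_def)
    moreover have "sym i = 0"
    proof -
      have "swap i \<in> vanishing ?K"
        using s(3) by (auto simp: vanishing_def swap_def kidx_def)
      then have "res i = 0" "res (swap i) = 0"
        using s(3) by (auto simp: res_def vanishing_def)
      then show ?thesis
        by (simp add: sym_def fun_eq_iff)
    qed
    moreover have "sym (?D b) = ?D q"
    proof -
      have "swap (?D b) = - ?D (swap b)"
        by (simp add: swap_D)
      then show ?thesis
        by (simp add: sym_def q_def D.scale D.diff D_res res_D res_minus)
    qed
    moreover have "sym z = sym s + (sym (?D b) + sym i)"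
    proof -
      have "z = s + (?D b + i)"
        using s(2) by (simp add: algebra_simps)
      then show ?thesis
        by (simp add: sym.add)
    qed
    ultimately have "z = sym s + ?D q"
      by simp
    moreover have "sym s \<in> F.span (sym ` S)"
      using s(1) by (simp add: sym.span_image)
    ultimately show "\<exists>s\<in>F.span (sym ` S). \<exists>q\<in>Q. z = s + ?D q"
      using \<open>q \<in> Q\<close> by blast
  qed
  moreover have "card (sy ` IP) = card IP"
    using inj_sy by (rule card_image)
  moreover have "card (sym ` S) \<le> card S" "card (alt ` IQ) \<le> card IQ"
    using S(1) fIQ by (auto intro: card_image_le)
  ultimately have "card J * 2 ^ n \<le> card J * k"
    using cIP S(2) unfolding mult.commute[of "2 ^ n"] by linarith
  moreover have "card J > 0"
    using J by (simp add: card_gt_0_iff)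
  ultimately show ?thesis
    by simp
qed

section \<open>The free graded commutative algebra\<close>

abbreviation supp :: "('a \<Rightarrow>\<^sub>0 'b::zero) \<Rightarrow> 'a set" where
  "supp \<equiv> Poly_Mapping.keys"

abbreviation lkp :: "('a \<Rightarrow>\<^sub>0 'b::zero) \<Rightarrow> 'a \<Rightarrow> 'b" where
  "lkp \<equiv> Poly_Mapping.lookup"

definition sg :: "'g \<Rightarrow> 'g monom" where
  "sg x = Poly_Mapping.single x 1"

lemma keys_sg [simp]: "supp (sg x) = {x}"
  by (simp add: sg_def)

lemma lookup_sg: "lkp (sg x) y = (if x = y then 1 else 0)"
  by (simp add: sg_def lookup_single when_def)

definition xpow :: "'g monom \<Rightarrow> 'g gca" where
  "xpow m = Poly_Mapping.single m 1"

lemma lookup_xpow: "lkp (xpow m) n = (if m = n then 1 else 0)"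
  by (simp add: xpow_def lookup_single when_def)

lemma keys_xpow [simp]: "supp (xpow m) = {m}"
  by (simp add: xpow_def)

lemma gen_xpow: "gen x = xpow (sg x)"
  by (simp add: gen_def xpow_def sg_def)

lemma gone_xpow: "gone = xpow 0"
  by (simp add: gone_def xpow_def)

lemma keys_scaleQ: "supp (scaleQ c p) \<subseteq> supp p"
  by (auto simp: in_keys_iff lookup_scaleQ)

lemma single_conv_xpow: "Poly_Mapping.single m c = scaleQ c (xpow m)"
  by (rule poly_mapping_eqI) (simp add: lookup_scaleQ lookup_single xpow_def when_def)

lemma expand_xpow:
  assumes "finite A" "supp p \<subseteq> A"
  shows "p = (\<Sum>m\<in>A. scaleQ (lkp p m) (xpow m))"
proof (rule poly_mapping_eqI)
  fix n
  have "(\<Sum>m\<in>A. lkp p m * (if m = n then 1 else 0)) = (\<Sum>m\<in>A. if m = n then lkp p m else 0)"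
    by (intro sum.cong) auto
  also have "\<dots> = lkp p n"
    using assms by (auto simp: in_keys_iff)
  finally show "lkp p n = lkp (\<Sum>m\<in>A. scaleQ (lkp p m) (xpow m)) n"
    by (simp add: lookup_sum lookup_scaleQ lookup_xpow)
qed

lemma gca_induct [consumes 1, case_names zero add]:
  assumes "supp p \<subseteq> M"
    and "P 0" and "\<And>c m p. m \<in> M \<Longrightarrow> supp p \<subseteq> M \<Longrightarrow> P p \<Longrightarrow> P (scaleQ c (xpow m) + p)"
  shows "P p"
proof -
  have "P (\<Sum>m\<in>A. scaleQ (lkp p m) (xpow m)) \<and> supp (\<Sum>m\<in>A. scaleQ (lkp p m) (xpow m)) \<subseteq> M"
    if "finite A" "A \<subseteq> M" for A
    using that
  proof (induction A rule: finite_induct)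
    case empty
    then show ?case using assms by simp
  next
    case (insert m A)
    have k: "supp (scaleQ (lkp p m) (xpow m)) \<subseteq> M"
      using keys_scaleQ[of "lkp p m" "xpow m"] insert by auto
    have IH: "P (\<Sum>m\<in>A. scaleQ (lkp p m) (xpow m))"
        "supp (\<Sum>m\<in>A. scaleQ (lkp p m) (xpow m)) \<subseteq> M" and "m \<in> M"
      using insert by auto
    have "supp (scaleQ (lkp p m) (xpow m) + (\<Sum>m\<in>A. scaleQ (lkp p m) (xpow m))) \<subseteq> M"
      using order_trans[OF keys_add Un_least[OF k IH(2)]] .
    then show ?case
      using insert(1,2) assms(3)[OF \<open>m \<in> M\<close> IH(2,1)] by simp
  qed
  from this[of "supp p"] show ?thesis
    using assms(1) expand_xpow[of "supp p" p] by simp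
qed

definition linext :: "('g monom \<Rightarrow> 'h gca) \<Rightarrow> 'g gca \<Rightarrow> 'h gca" where
  "linext f p = (\<Sum>m\<in>supp p. scaleQ (lkp p m) (f m))"

lemma linext_superset:
  assumes "finite A" "supp p \<subseteq> A"
  shows "linext f p = (\<Sum>m\<in>A. scaleQ (lkp p m) (f m))"
  unfolding linext_def using assms by (intro sum.mono_neutral_left) (auto simp: in_keys_iff)

lemma linear_scaleQI:
  assumes "\<And>p q. f (p + q) = f p + f q" "\<And>c p. f (scaleQ c p) = scaleQ c (f p)"
  shows "Vector_Spaces.linear scaleQ scaleQ f"
  by unfold_locales (auto simp: assms)

lemma linear_linext:
  fixes f :: "'g monom \<Rightarrow> 'h gca"
  shows "Vector_Spaces.linear scaleQ scaleQ (linext f)"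
proof (rule linear_scaleQI)
  fix p q :: "'g gca" and c
  let ?A = "supp p \<union> supp q"
  have "supp (p + q) \<subseteq> ?A"
    by (rule keys_add)
  then show "linext f (p + q) = linext f p + linext f q"
    by (simp add: linext_superset[of ?A] lookup_add Q.scale_left_distrib sum.distrib)
  show "linext f (scaleQ c p) = scaleQ c (linext f p)"
    unfolding linext_superset[OF finite_keys keys_scaleQ]
    by (simp add: linext_def lookup_scaleQ Q.scale_sum_right)
qed

lemma linext_xpow [simp]: "linext f (xpow m) = f m"
  by (simp add: linext_def lookup_xpow)

lemma linear_eqI:
  assumes f: "Vector_Spaces.linear scaleQ s f" and g: "Vector_Spaces.linear scaleQ s g"
    and "supp p \<subseteq> M" "\<And>m. m \<in> M \<Longrightarrow> f (xpow m) = g (xpow m)"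
  shows "f p = g p"
proof -
  note [simp] = module_hom.zero[OF f[folded module_hom_iff_linear]] module_hom.zero[OF g[folded module_hom_iff_linear]]
    module_hom.add[OF f[folded module_hom_iff_linear]] module_hom.add[OF g[folded module_hom_iff_linear]]
    module_hom.scale[OF f[folded module_hom_iff_linear]] module_hom.scale[OF g[folded module_hom_iff_linear]]
  show ?thesis
    using assms(3) by (induction rule: gca_induct) (simp_all add: assms(4))
qed

subsection \<open>Multiplication\<close>

lemma gmul_superset:
  assumes "finite A" "supp p \<subseteq> A" "finite B" "supp q \<subseteq> B"
  shows "gmul deg p q = (\<Sum>m\<in>A. \<Sum>n\<in>B. Poly_Mapping.single (m + n) (monom_sign deg m n * lkp p m * lkp q n))"
proof -
  have "gmul deg p q = (\<Sum>m\<in>supp p. \<Sum>n\<in>B. Poly_Mapping.single (m + n) (monom_sign deg m n * lkp p m * lkp q n))"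
    unfolding gmul_def using assms
    by (intro sum.cong refl sum.mono_neutral_left) (auto simp: in_keys_iff)
  also have "\<dots> = (\<Sum>m\<in>A. \<Sum>n\<in>B. Poly_Mapping.single (m + n) (monom_sign deg m n * lkp p m * lkp q n))"
    using assms by (intro sum.mono_neutral_left) (auto simp: in_keys_iff)
  finally show ?thesis .
qed

lemma gmul_add_left: "gmul deg (p + p') q = gmul deg p q + gmul deg p' q"
proof -
  let ?A = "supp p \<union> supp p'"
  have "supp (p + p') \<subseteq> ?A"
    by (rule keys_add)
  then show ?thesis
    by (simp add: gmul_superset[of ?A _ "supp q"] lookup_add distrib_left distrib_right single_add sum.distrib)
qed

lemma gmul_add_right: "gmul deg p (q + q') = gmul deg p q + gmul deg p q'"
proof -
  let ?B = "supp q \<union> supp q'"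
  have "supp (q + q') \<subseteq> ?B"
    by (rule keys_add)
  then show ?thesis
    by (simp add: gmul_superset[of "supp p" _ ?B] lookup_add distrib_left single_add sum.distrib)
qed

lemma scaleQ_single: "scaleQ c (Poly_Mapping.single m a) = Poly_Mapping.single m (c * a)"
  by (rule poly_mapping_eqI) (simp add: lookup_scaleQ lookup_single when_def)

lemma gmul_scale_left: "gmul deg (scaleQ c p) q = scaleQ c (gmul deg p q)"
  unfolding gmul_superset[OF finite_keys keys_scaleQ finite_keys order_refl]
  by (simp add: gmul_def lookup_scaleQ Q.scale_sum_right scaleQ_single mult_ac)

lemma gmul_scale_right: "gmul deg p (scaleQ c q) = scaleQ c (gmul deg p q)"
  unfolding gmul_superset[OF finite_keys order_refl finite_keys keys_scaleQ]
  by (simp add: gmul_def lookup_scaleQ Q.scale_sum_right scaleQ_single mult_ac)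

lemma gmul_zero_left [simp]: "gmul deg 0 q = 0" and gmul_zero_right [simp]: "gmul deg p 0 = 0"
  by (simp_all add: gmul_def)

lemma linear_gmul: "Vector_Spaces.linear scaleQ scaleQ (gmul deg p)"
  by (intro linear_scaleQI gmul_add_right gmul_scale_right)

lemma gmul_minus_right: "gmul deg p (- q) = - gmul deg p q"
  using gmul_scale_right[of deg p "- 1" q] by simp

lemma gmul_diff_right: "gmul deg p (q - q') = gmul deg p q - gmul deg p q'"
  using gmul_add_right[of deg p q "- q'"] by (simp add: gmul_minus_right)

lemma gmul_sum_left: "gmul deg (\<Sum>i\<in>A. f i) q = (\<Sum>i\<in>A. gmul deg (f i) q)"
  by (induction A rule: infinite_finite_induct) (auto simp: gmul_add_left)

lemma gmul_sum_right: "gmul deg p (\<Sum>i\<in>A. f i) = (\<Sum>i\<in>A. gmul deg p (f i))"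
  by (induction A rule: infinite_finite_induct) (auto simp: gmul_add_right)

lemma gmul_xpow: "gmul deg (xpow m) (xpow n) = scaleQ (monom_sign deg m n) (xpow (m + n))"
  by (simp add: gmul_def lookup_xpow single_conv_xpow)

lemma keys_gmul:
  assumes "k \<in> supp (gmul deg p q)"
  obtains m n where "k = m + n" "m \<in> supp p" "n \<in> supp q" "monom_sign deg m n \<noteq> 0"
proof -
  have "\<exists>m\<in>supp p. \<exists>n\<in>supp q. k = m + n \<and> monom_sign deg m n \<noteq> 0"
  proof (rule ccontr)
    assume "\<not> ?thesis"
    then have "lkp (Poly_Mapping.single (m + n) (monom_sign deg m n * lkp p m * lkp q n)) k = 0"
      if "m \<in> supp p" "n \<in> supp q" for m n
      using that by (auto simp: lookup_single when_def)
    then have "lkp (gmul deg p q) k = 0"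
      unfolding gmul_def lookup_sum by (intro sum.neutral ballI) auto
    then show False
      using assms by (simp add: in_keys_iff)
  qed
  then show ?thesis
    using that by blast
qed

lemma keys_plus_nat: "supp (m + n) = supp m \<union> supp n"
  for m n :: "'g monom"
  by (auto simp: in_keys_iff lookup_add)

lemma odd_keys_plus: "odd_keys deg (m + n) = odd_keys deg m \<union> odd_keys deg n"
  by (auto simp: odd_keys_def keys_plus_nat)

lemma odd_keys_sg: "odd_keys deg (sg x) = (if odd (deg x) then {x} else {})"
  by (auto simp: odd_keys_def)

lemma finite_odd_keys [simp]: "finite (odd_keys deg m)"
  by (simp add: odd_keys_def)

lemma odd_keys_zero [simp]: "odd_keys deg 0 = {}"
  by (simp add: odd_keys_def)

lemma monom_sign_zero [simp]: "monom_sign deg 0 m = 1" "monom_sign deg m 0 = 1"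
  by (simp_all add: monom_sign_def)

definition inversions :: "'g::linorder set \<Rightarrow> 'g set \<Rightarrow> ('g \<times> 'g) set" where
  "inversions A B = {(x, y). x \<in> A \<and> y \<in> B \<and> y < x}"

lemma finite_inversions: "finite A \<Longrightarrow> finite B \<Longrightarrow> finite (inversions A B)"
  by (rule finite_subset[of _ "A \<times> B"]) (auto simp: inversions_def)

lemma monom_sign_inversions:
  "monom_sign deg m n = (if odd_keys deg m \<inter> odd_keys deg n \<noteq> {} then 0
     else (- 1) ^ card (inversions (odd_keys deg m) (odd_keys deg n)))"
  by (simp add: monom_sign_def inversions_def)

lemma card_inversions_Un_left:
  assumes "finite A" "finite B" "finite C" "A \<inter> B = {}"
  shows "card (inversions (A \<union> B) C) = card (inversions A C) + card (inversions B C)"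
proof -
  have "inversions (A \<union> B) C = inversions A C \<union> inversions B C" "inversions A C \<inter> inversions B C = {}"
    using assms(4) by (auto simp: inversions_def)
  then show ?thesis
    using assms by (simp add: card_Un_disjoint finite_inversions)
qed

lemma card_inversions_Un_right:
  assumes "finite A" "finite B" "finite C" "A \<inter> B = {}"
  shows "card (inversions C (A \<union> B)) = card (inversions C A) + card (inversions C B)"
proof -
  have "inversions C (A \<union> B) = inversions C A \<union> inversions C B" "inversions C A \<inter> inversions C B = {}"
    using assms(4) by (auto simp: inversions_def)
  then show ?thesis
    using assms by (simp add: card_Un_disjoint finite_inversions)
qed

text \<open>
  Inversions are additive over disjoint unions; this is what makes the product associative.
\<close>

lemma monom_sign_cocycle:
  "monom_sign deg m n * monom_sign deg (m + n) k = monom_sign deg n k * monom_sign deg m (n + k)"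
proof -
  let ?A = "odd_keys deg m" and ?B = "odd_keys deg n" and ?C = "odd_keys deg k"
  show ?thesis
  proof (cases "?A \<inter> ?B = {} \<and> ?A \<inter> ?C = {} \<and> ?B \<inter> ?C = {}")
    case True
    then show ?thesis
      by (simp add: monom_sign_inversions odd_keys_plus Int_Un_distrib Int_Un_distrib2
          card_inversions_Un_left card_inversions_Un_right power_add)
  next
    case False
    then show ?thesis
      by (auto simp: monom_sign_inversions odd_keys_plus Int_Un_distrib Int_Un_distrib2)
  qed
qed

lemma gmul_assoc: "gmul deg (gmul deg p q) r = gmul deg p (gmul deg q r)"
proof -
  have 1: "gmul deg (gmul deg (xpow m) (xpow n)) (xpow k) = gmul deg (xpow m) (gmul deg (xpow n) (xpow k))" for m n k
    using monom_sign_cocycle[of deg m n k]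
    by (simp add: gmul_xpow gmul_scale_left gmul_scale_right add.assoc mult.commute)
  have 2: "gmul deg (gmul deg (xpow m) (xpow n)) r = gmul deg (xpow m) (gmul deg (xpow n) r)" for m n r
    using subset_UNIV[of "supp r"]
    by (induction rule: gca_induct) (simp_all add: gmul_add_right gmul_scale_right 1)
  have 3: "gmul deg (gmul deg (xpow m) q) r = gmul deg (xpow m) (gmul deg q r)" for m q r
    using subset_UNIV[of "supp q"]
    by (induction rule: gca_induct) (simp_all add: gmul_add_right gmul_add_left gmul_scale_left gmul_scale_right 2)
  show ?thesis
    using subset_UNIV[of "supp p"]
    by (induction rule: gca_induct) (simp_all add: gmul_add_left gmul_scale_left 3)
qed

lemma gmul_gone_left [simp]: "gmul deg gone p = p"
  using subset_UNIV[of "supp p"]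
  by (induction rule: gca_induct) (simp_all add: gmul_add_right gmul_scale_right gmul_xpow gone_xpow)

lemma gmul_gone_right [simp]: "gmul deg p gone = p"
  using subset_UNIV[of "supp p"]
  by (induction rule: gca_induct) (simp_all add: gmul_add_left gmul_scale_left gmul_xpow gone_xpow)

subsection \<open>Admissible monomials, degrees and graded commutativity\<close>

definition good :: "'g set \<Rightarrow> ('g \<Rightarrow> nat) \<Rightarrow> 'g monom set" where
  "good X deg = {m. supp m \<subseteq> X \<and> (\<forall>x\<in>odd_keys deg m. lkp m x = 1)}"

lemma free_gca_good: "free_gca X deg = {p. supp p \<subseteq> good X deg}"
  by (auto simp: free_gca_def good_def)

lemma subspace_keys:
  fixes M :: "'g monom set"
  shows "Q.subspace {p. supp p \<subseteq> M}"
proof (rule Q.subspaceI)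
  fix p q :: "'g gca" assume "p \<in> {p. supp p \<subseteq> M}" "q \<in> {p. supp p \<subseteq> M}"
  then show "p + q \<in> {p. supp p \<subseteq> M}"
    using keys_add[of p q] by blast
next
  fix c and p :: "'g gca" assume "p \<in> {p. supp p \<subseteq> M}"
  then show "scaleQ c p \<in> {p. supp p \<subseteq> M}"
    using keys_scaleQ[of c p] by blast
qed simp

lemma subspace_free_gca: "Q.subspace (free_gca X deg)"
  unfolding free_gca_good by (rule subspace_keys)

lemma good_plus:
  assumes "m \<in> good X deg" "n \<in> good X deg" "monom_sign deg m n \<noteq> 0"
  shows "m + n \<in> good X deg"
proof -
  have "lkp (m + n) x = 1" if x: "x \<in> odd_keys deg (m + n)" for x
  proof -
    have disj: "odd_keys deg m \<inter> odd_keys deg n = {}"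
      using assms(3) by (simp add: monom_sign_def split: if_splits)
    have "odd (deg x)"
      using x by (simp add: odd_keys_def)
    then have 0: "lkp k x = 0" if "x \<notin> odd_keys deg k" for k
      using that by (simp add: odd_keys_def in_keys_iff)
    have 1: "lkp k x = 1" if "x \<in> odd_keys deg k" "k \<in> good X deg" for k
      using that by (simp add: good_def)
    show ?thesis
    proof (cases "x \<in> odd_keys deg m")
      case True
      then have "x \<notin> odd_keys deg n"
        using disj by blast
      then show ?thesis
        using True 0[of n] 1[of m] assms(1) by (simp add: lookup_add)
    next
      case False
      then have "x \<in> odd_keys deg n"
        using x by (simp add: odd_keys_plus)
      then show ?thesis
        using False 0[of m] 1[of n] assms(2) by (simp add: lookup_add)
    qed
  qed
  then show ?thesis
    using assms by (auto simp: good_def keys_plus_nat)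
qed

lemma good_plusD:
  assumes "m + n \<in> good X deg"
  shows "n \<in> good X deg" "m \<in> good X deg" "odd_keys deg m \<inter> odd_keys deg n = {}"
proof -
  have *: "lkp m x + lkp n x = 1" if "x \<in> odd_keys deg m \<union> odd_keys deg n" for x
    using assms that by (auto simp: good_def odd_keys_plus lookup_add)
  have pos: "lkp m x > 0" if "x \<in> odd_keys deg m" for m x
    using that by (simp add: odd_keys_def in_keys_iff)
  show "n \<in> good X deg" "m \<in> good X deg"
    using assms * pos by (fastforce simp: good_def keys_plus_nat)+
  show "odd_keys deg m \<inter> odd_keys deg n = {}"
  proof (rule ccontr)
    assume "odd_keys deg m \<inter> odd_keys deg n \<noteq> {}"
    then obtain x where x: "x \<in> odd_keys deg m" "x \<in> odd_keys deg n"
      by blast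
    show False
      using *[of x] pos[OF x(1)] pos[OF x(2)] x by simp
  qed
qed

lemma gmul_free: "p \<in> free_gca X deg \<Longrightarrow> q \<in> free_gca X deg \<Longrightarrow> gmul deg p q \<in> free_gca X deg"
  by (auto simp: free_gca_good elim!: keys_gmul intro!: good_plus)

lemma zero_good [simp]: "0 \<in> good X deg"
  by (simp add: good_def)

lemma gone_free [simp]: "gone \<in> free_gca X deg"
  by (simp add: free_gca_good gone_xpow)

lemma sg_good: "x \<in> X \<Longrightarrow> sg x \<in> good X deg"
  by (auto simp: good_def odd_keys_def lookup_sg)

lemma gen_free: "x \<in> X \<Longrightarrow> gen x \<in> free_gca X deg"
  by (simp add: free_gca_good gen_xpow sg_good)

lemma xpow_free: "m \<in> good X deg \<Longrightarrow> xpow m \<in> free_gca X deg"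
  by (simp add: free_gca_good)

lemma monom_deg_superset:
  assumes "finite A" "supp m \<subseteq> A"
  shows "monom_deg deg m = (\<Sum>x\<in>A. lkp m x * deg x)"
  unfolding monom_deg_def using assms by (intro sum.mono_neutral_left) (auto simp: in_keys_iff)

lemma monom_deg_plus: "monom_deg deg (m + n) = monom_deg deg m + monom_deg deg n"
  by (simp add: monom_deg_superset[of "supp m \<union> supp n"] keys_plus_nat
      lookup_add distrib_right sum.distrib)

lemma monom_deg_sg [simp]: "monom_deg deg (sg x) = deg x"
  by (simp add: monom_deg_def lookup_sg)

lemma monom_deg_zero [simp]: "monom_deg deg 0 = 0"
  by (simp add: monom_deg_def)

lemma even_monom_deg:
  assumes "m \<in> good X deg"
  shows "even (monom_deg deg m) \<longleftrightarrow> even (card (odd_keys deg m))"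
proof -
  have "even (monom_deg deg m) \<longleftrightarrow> even (\<Sum>x\<in>supp m. if odd (deg x) then 1 else (0::nat))"
      unfolding monom_deg_def
  proof -
    have "{x \<in> supp m. odd (lkp m x * deg x)} =
        {x \<in> supp m. odd (if odd (deg x) then 1 else (0::nat))}"
      using assms by (auto simp: good_def odd_keys_def)
    then show "even (\<Sum>x\<in>supp m. lkp m x * deg x) \<longleftrightarrow>
        even (\<Sum>x\<in>supp m. if odd (deg x) then 1 else (0::nat))"
      by (simp only: even_sum_iff[OF finite_keys])
  qed
  also have "(\<Sum>x\<in>supp m. if odd (deg x) then 1 else (0::nat)) = card (odd_keys deg m)"
    by (simp add: sum.If_cases odd_keys_def Int_def)
  finally show ?thesis .
qed

lemma homogeneous_xpow: "homogeneous deg (monom_deg deg m) (xpow m)"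
  by (simp add: homogeneous_def)

lemma homogeneous_gen: "homogeneous deg (deg x) (gen x)"
  by (simp add: homogeneous_def gen_xpow)

lemma homogeneous_gone: "homogeneous deg 0 gone"
  by (simp add: homogeneous_def gone_xpow)

lemma homogeneous_scale: "homogeneous deg k p \<Longrightarrow> homogeneous deg k (scaleQ c p)"
  using keys_scaleQ[of c p] by (auto simp: homogeneous_def)

lemma homogeneous_add: "homogeneous deg k p \<Longrightarrow> homogeneous deg k q \<Longrightarrow> homogeneous deg k (p + q)"
  using keys_add[of p q] by (auto simp: homogeneous_def)

lemma homogeneous_zero [simp]: "homogeneous deg k 0"
  by (simp add: homogeneous_def)

lemma homogeneous_sum: "(\<And>i. i \<in> A \<Longrightarrow> homogeneous deg k (f i)) \<Longrightarrow> homogeneous deg k (\<Sum>i\<in>A. f i)"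
  by (induction A rule: infinite_finite_induct) (auto intro: homogeneous_add)

lemma homogeneous_gmul: "homogeneous w k p \<Longrightarrow> homogeneous w l q \<Longrightarrow> homogeneous w (k + l) (gmul deg p q)"
  by (auto simp: homogeneous_def monom_deg_plus elim!: keys_gmul)

text \<open>
  Each pair of an odd generator of \<open>m\<close> and one of \<open>n\<close> is an inversion in exactly one of the two products.
\<close>

lemma monom_sign_commute:
  assumes "m \<in> good X deg" "n \<in> good X deg"
  shows "monom_sign deg m n = (- 1) ^ (monom_deg deg m * monom_deg deg n) * monom_sign deg n m"
proof (cases "odd_keys deg m \<inter> odd_keys deg n = {}")
  case True
  let ?A = "odd_keys deg m" and ?B = "odd_keys deg n"
  have "?A \<times> ?B = inversions ?A ?B \<union> prod.swap ` inversions ?B ?A"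
    using True by (auto simp: inversions_def image_iff)
  moreover have "inversions ?A ?B \<inter> prod.swap ` inversions ?B ?A = {}"
    by (auto simp: inversions_def)
  ultimately have "card ?A * card ?B = card (inversions ?A ?B) + card (inversions ?B ?A)"
    by (metis card_Un_disjoint card_cartesian_product card_image finite_imageI finite_inversions finite_odd_keys inj_swap)
  then have c: "(- 1 :: rat) ^ (card ?A * card ?B) = (- 1) ^ card (inversions ?A ?B) * (- 1) ^ card (inversions ?B ?A)"
    by (simp add: power_add)
  have "(- 1 :: rat) ^ (monom_deg deg m * monom_deg deg n) = (- 1) ^ (card ?A * card ?B)"
    using even_monom_deg[OF assms(1)] even_monom_deg[OF assms(2)] by (simp add: minus_one_power_iff)
  moreover have "?B \<inter> ?A = {}"
    using True by blast
  ultimately show ?thesis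
    using True unfolding monom_sign_inversions c
    by (simp add: c mult.assoc flip: power_mult_distrib)
next
  case False
  then show ?thesis
    by (auto simp: monom_sign_def)
qed

lemma gmul_commute:
  assumes p: "p \<in> free_gca X deg" "homogeneous deg k p" and q: "q \<in> free_gca X deg" "homogeneous deg l q"
  shows "gmul deg p q = scaleQ ((- 1) ^ (k * l)) (gmul deg q p)"
proof -
  have 1: "gmul deg (xpow m) (xpow n) = scaleQ ((- 1) ^ (k * l)) (gmul deg (xpow n) (xpow m))"
    if "m \<in> good X deg" "n \<in> good X deg" "monom_deg deg m = k" "monom_deg deg n = l" for m n
    using monom_sign_commute[OF that(1,2)] that by (simp add: gmul_xpow add.commute)
  have "supp q \<subseteq> good X deg \<inter> {n. monom_deg deg n = l}"
    using q by (auto simp: homogeneous_def free_gca_good)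
  then have 2: "gmul deg (xpow m) q = scaleQ ((- 1) ^ (k * l)) (gmul deg q (xpow m))"
    if "m \<in> good X deg" "monom_deg deg m = k" for m
    by (induction rule: gca_induct)
       (simp_all add: gmul_add_left gmul_add_right gmul_scale_left gmul_scale_right 1 that Q.scale_right_distrib mult.commute)
  have "supp p \<subseteq> good X deg \<inter> {m. monom_deg deg m = k}"
    using p by (auto simp: homogeneous_def free_gca_good)
  then show ?thesis
    by (induction rule: gca_induct)
       (simp_all add: gmul_add_left gmul_add_right gmul_scale_left gmul_scale_right 2 Q.scale_right_distrib mult.commute)
qed

subsection \<open>Algebra homomorphisms\<close>

definition msize :: "'g monom \<Rightarrow> nat" where
  "msize m = (\<Sum>x\<in>supp m. lkp m x)"

lemma msize_monom_deg: "msize m = monom_deg (\<lambda>_. 1) m"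
  by (simp add: msize_def monom_deg_def)

lemma msize_plus: "msize (m + n) = msize m + msize n"
  by (simp add: msize_monom_deg monom_deg_plus)

lemma msize_sg [simp]: "msize (sg x) = 1"
  by (simp add: msize_monom_deg)

lemma msize_zero [simp]: "msize 0 = 0"
  by (simp add: msize_def)

text \<open>
  Splitting off the least generator of a monomial introduces no sign, which makes it the convenient
  induction on monomials.
\<close>

lemma min_split:
  assumes "m \<noteq> (0 :: 'g::linorder monom)"
  obtains x m' where "m = sg x + m'" "\<forall>y\<in>supp m. x \<le> y"
proof -
  have ne: "supp m \<noteq> {}"
    using assms by (simp add: keys_eq_empty)
  define x where "x = Min (supp m)"
  have x: "x \<in> supp m" "\<forall>y\<in>supp m. x \<le> y"
    using ne by (auto simp: x_def)
  have "m = sg x + (m - sg x)"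
    using x(1) by (intro poly_mapping_eqI) (auto simp: lookup_add lookup_minus lookup_sg in_keys_iff)
  then show ?thesis
    using that x(2) by blast
qed

lemma min_induct [case_names zero step]:
  fixes m :: "'g::linorder monom"
  assumes "P 0" and step: "\<And>x m. \<forall>y\<in>supp m. x \<le> y \<Longrightarrow> P m \<Longrightarrow> P (sg x + m)"
  shows "P m"
proof (induction "msize m" arbitrary: m rule: less_induct)
  case less
  show ?case
  proof (cases "m = 0")
    case True
    then show ?thesis using assms(1) by simp
  next
    case False
    then obtain x m' where x: "m = sg x + m'" "\<forall>y\<in>supp m. x \<le> y"
      by (rule min_split)
    then have "P m'"
      using less by (simp add: msize_plus)
    moreover have "\<forall>y\<in>supp m'. x \<le> y"
      using x by (simp add: keys_plus_nat)
    ultimately show ?thesis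
      using step x(1) by simp
  qed
qed

lemma monom_sign_sg:
  "monom_sign deg (sg x) m = (if even (deg x) then 1 else if x \<in> odd_keys deg m then 0
     else (- 1) ^ card {y \<in> odd_keys deg m. y < x})"
proof -
  have "{(x', y). x' = x \<and> y \<in> odd_keys deg m \<and> y < x'} = Pair x ` {y \<in> odd_keys deg m. y < x}"
    by auto
  then have "card {(x', y). x' = x \<and> y \<in> odd_keys deg m \<and> y < x'} = card {y \<in> odd_keys deg m. y < x}"
    by (simp add: card_image inj_on_def)
  then show ?thesis
    by (simp add: monom_sign_def odd_keys_sg)
qed

lemma monom_sign_min:
  assumes "\<forall>y\<in>supp m. x \<le> y"
  shows "monom_sign deg (sg x) m = (if x \<in> odd_keys deg m then 0 else 1)"
proof -
  have "{y \<in> odd_keys deg m. y < x} = {}"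
    using assms by (auto simp: odd_keys_def)
  then have c: "card {y \<in> odd_keys deg m. y < x} = 0"
    by (simp only: card.empty)
  show ?thesis
    unfolding monom_sign_sg c by (auto simp: odd_keys_def)
qed

lemma gen_gmul_xpow_min:
  assumes "\<forall>y\<in>supp m. x \<le> y" "sg x + m \<in> good X deg"
  shows "gmul deg (gen x) (xpow m) = xpow (sg x + m)"
proof -
  have "x \<notin> odd_keys deg m"
    using good_plusD(3)[OF assms(2)] by (auto simp: odd_keys_sg odd_keys_def)
  then show ?thesis
    using assms(1) by (simp add: gen_xpow gmul_xpow monom_sign_min)
qed

definition mset_of_monom :: "'g monom \<Rightarrow> 'g multiset" where
  "mset_of_monom m = Abs_multiset (lkp m)"

lemma count_mset_of_monom: "count (mset_of_monom m) x = lkp m x"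
proof -
  have "finite {x. lkp m x > 0}"
    using finite_keys[of m] by (simp add: Poly_Mapping.keys.rep_eq)
  then show ?thesis
    by (simp add: mset_of_monom_def count_Abs_multiset)
qed

lemma mset_of_monom_zero [simp]: "mset_of_monom 0 = {#}"
  by (rule multiset_eqI) (simp add: count_mset_of_monom)

lemma mset_of_monom_sg: "mset_of_monom (sg x + m) = add_mset x (mset_of_monom m)"
  by (rule multiset_eqI) (auto simp: count_mset_of_monom lookup_add lookup_sg)

lemma set_mset_of_monom: "set_mset (mset_of_monom m) = supp m"
  by (auto simp: count_mset_of_monom in_keys_iff simp flip: count_greater_zero_iff)

definition ordered_product :: "('h::linorder \<Rightarrow> nat) \<Rightarrow> ('g::linorder \<Rightarrow> 'h gca) \<Rightarrow> 'g monom \<Rightarrow> 'h gca" where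
  "ordered_product deg' e m = foldr (\<lambda>x. gmul deg' (e x)) (sorted_list_of_multiset (mset_of_monom m)) gone"

lemma ordered_product_zero [simp]: "ordered_product deg' e 0 = gone"
  by (simp add: ordered_product_def)

lemma ordered_product_min:
  assumes "\<forall>y\<in>supp m. x \<le> y"
  shows "ordered_product deg' e (sg x + m) = gmul deg' (e x) (ordered_product deg' e m)"
proof -
  have "insort x (sorted_list_of_multiset (mset_of_monom m)) = x # sorted_list_of_multiset (mset_of_monom m)"
    using assms by (intro insort_is_Cons) (simp add: set_mset_of_monom)
  then show ?thesis
    by (simp add: ordered_product_def mset_of_monom_sg)
qed

text \<open>
  A substitution of generators, defined by sorted products of their images.  It is multiplicative when \<open>e\<close>
  preserves degrees, which is the universal property of the free graded commutative algebra.
\<close>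

definition gca_hom :: "('h::linorder \<Rightarrow> nat) \<Rightarrow> ('g::linorder \<Rightarrow> 'h gca) \<Rightarrow> 'g gca \<Rightarrow> 'h gca" where
  "gca_hom deg' e = linext (ordered_product deg' e)"

locale gca_map =
  fixes X :: "'g::linorder set" and deg :: "'g \<Rightarrow> nat" and Y :: "'h::linorder set" and deg' :: "'h \<Rightarrow> nat"
    and e :: "'g \<Rightarrow> 'h gca"
  assumes e_free: "x \<in> X \<Longrightarrow> e x \<in> free_gca Y deg'"
    and e_hom: "x \<in> X \<Longrightarrow> homogeneous deg' (deg x) (e x)"
begin

abbreviation h :: "'g gca \<Rightarrow> 'h gca" where
  "h \<equiv> gca_hom deg' e"

abbreviation op :: "'g monom \<Rightarrow> 'h gca" where
  "op \<equiv> ordered_product deg' e"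

lemma linear_h: "Vector_Spaces.linear scaleQ scaleQ h"
  unfolding gca_hom_def by (rule linear_linext)

lemmas h_module = linear_h[folded module_hom_iff_linear]
lemmas h_add = module_hom.add[OF h_module] and h_scale = module_hom.scale[OF h_module]
  and h_zero = module_hom.zero[OF h_module] and h_diff = module_hom.diff[OF h_module]
  and h_sum = module_hom.sum[OF h_module]

lemma h_xpow: "h (xpow m) = op m"
  by (simp add: gca_hom_def)

lemma h_gone: "h gone = gone"
  using h_xpow[of 0] by (simp add: gone_xpow)

lemma h_gen: "h (gen x) = e x"
  using ordered_product_min[of 0 x deg' e] by (simp add: gen_xpow h_xpow)

lemma op_free: "supp m \<subseteq> X \<Longrightarrow> op m \<in> free_gca Y deg'"
proof (induction m rule: min_induct)
  case (step x m)
  then show ?case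
    by (auto simp: ordered_product_min keys_plus_nat intro!: gmul_free e_free)
qed simp

lemma op_homogeneous: "supp m \<subseteq> X \<Longrightarrow> homogeneous deg' (monom_deg deg m) (op m)"
proof (induction m rule: min_induct)
  case (step x m)
  then show ?case
    by (auto simp: ordered_product_min keys_plus_nat monom_deg_plus intro!: homogeneous_gmul e_hom)
qed (simp add: homogeneous_gone)

lemma e_square:
  assumes "x \<in> X" "odd (deg x)"
  shows "gmul deg' (e x) (e x) = 0"
proof -
  have "gmul deg' (e x) (e x) = - gmul deg' (e x) (e x)"
    using gmul_commute[OF e_free e_hom e_free e_hom, OF assms(1) assms(1) assms(1) assms(1)] assms(2)
    by simp
  then have "scaleQ 2 (gmul deg' (e x) (e x)) = 0"
    using Q.scale_left_distrib[of 1 1 "gmul deg' (e x) (e x)"] by (simp add: eq_neg_iff_add_eq_0)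
  then show ?thesis
    by simp
qed

text \<open>
  Insertion sort: moving \<open>e x\<close> past the smaller factors \<open>e y\<close> of a sorted product produces the sign of the
  corresponding product of monomials, and the square of an odd element vanishes.
\<close>

lemma op_insert:
  assumes "x \<in> X" "m \<in> good X deg"
  shows "gmul deg' (e x) (op m) = scaleQ (monom_sign deg (sg x) m) (op (sg x + m))"
  using assms(2)
proof (induction m rule: min_induct)
  case zero
  show ?case
    using ordered_product_min[of 0 x deg' e] by simp
next
  case (step y m)
  let ?m = "sg y + m"
  have ym: "\<forall>z\<in>supp ?m. y \<le> z"
    using step(1) by (simp add: keys_plus_nat)
  have gm: "m \<in> good X deg" and disj: "odd_keys deg (sg y) \<inter> odd_keys deg m = {}"
    using good_plusD[OF step(3)] by auto
  have y: "y \<in> X"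
    using step(3) by (auto simp: good_def keys_plus_nat)
  show ?case
  proof (cases "x \<le> y")
    case True
    then have xm: "\<forall>z\<in>supp ?m. x \<le> z"
      using ym by auto
    show ?thesis
    proof (cases "x \<in> odd_keys deg ?m")
      case x: True
      then have "x = y" "odd (deg x)"
        using True ym by (auto simp: odd_keys_def intro: antisym)
      then have "gmul deg' (e x) (op ?m) = 0"
        using step(1) assms(1) by (simp add: ordered_product_min e_square flip: gmul_assoc)
      then show ?thesis
        using xm x by (simp add: monom_sign_min)
    next
      case False
      then show ?thesis
        using xm by (simp add: monom_sign_min ordered_product_min)
    qed
  next
    case False
    then have yx: "y < x"
      by simp
    have "gmul deg' (e x) (op ?m) = gmul deg' (gmul deg' (e x) (e y)) (op m)"
      using step(1) by (simp add: ordered_product_min gmul_assoc)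
    also have "\<dots> = scaleQ ((- 1) ^ (deg x * deg y)) (gmul deg' (e y) (gmul deg' (e x) (op m)))"
      by (simp add: gmul_commute[OF e_free e_hom e_free e_hom, OF assms(1) assms(1) y y] gmul_scale_left gmul_assoc)
    also have "\<dots> = scaleQ ((- 1) ^ (deg x * deg y) * monom_sign deg (sg x) m) (gmul deg' (e y) (op (sg x + m)))"
      by (simp add: step(2)[OF gm] gmul_scale_right)
    also have "gmul deg' (e y) (op (sg x + m)) = op (sg x + ?m)"
      using ordered_product_min[of "sg x + m" y deg' e] yx step(1)
      by (auto simp: keys_plus_nat add.left_commute)
    also have "(- 1) ^ (deg x * deg y) * monom_sign deg (sg x) m = monom_sign deg (sg x) ?m"
    proof (cases "even (deg x) \<or> even (deg y)")
      case True
      then show ?thesis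
        by (auto simp: monom_sign_sg odd_keys_plus odd_keys_sg)
    next
      case False
      then have "y \<notin> odd_keys deg m"
        using disj by (simp add: odd_keys_sg)
      moreover have "{z \<in> insert y (odd_keys deg m). z < x} = insert y {z \<in> odd_keys deg m. z < x}"
        using yx by auto
      ultimately show ?thesis
        using False yx by (auto simp: monom_sign_sg odd_keys_plus odd_keys_sg minus_one_power_iff)
    qed
    finally show ?thesis .
  qed
qed

lemma h_gen_gmul:
  assumes "x \<in> X" "p \<in> free_gca X deg"
  shows "h (gmul deg (gen x) p) = gmul deg' (e x) (h p)"
proof -
  have "supp p \<subseteq> good X deg"
    using assms(2) by (simp add: free_gca_good)
  then show ?thesis
    by (induction rule: gca_induct)
       (simp_all add: h_zero h_add h_scale gmul_add_right gmul_scale_right gen_xpow gmul_xpow h_xpow op_insert[OF assms(1)])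
qed

lemma h_gmul:
  assumes "p \<in> free_gca X deg" "q \<in> free_gca X deg"
  shows "h (gmul deg p q) = gmul deg' (h p) (h q)"
proof -
  have *: "h (gmul deg (xpow m) q) = gmul deg' (op m) (h q)" if "m \<in> good X deg" for m
    using that
  proof (induction m rule: min_induct)
    case zero
    show ?case
      using gmul_gone_left[of deg q] by (simp add: gone_xpow) (simp flip: gone_xpow)
  next
    case (step x m)
    have gm: "m \<in> good X deg" and x: "x \<in> X"
      using good_plusD[OF step(3)] step(3) by (auto simp: good_def keys_plus_nat)
    have "h (gmul deg (xpow (sg x + m)) q) = h (gmul deg (gen x) (gmul deg (xpow m) q))"
      using gen_gmul_xpow_min[OF step(1,3)] by (simp flip: gmul_assoc)
    also have "\<dots> = gmul deg' (e x) (gmul deg' (op m) (h q))"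
      using h_gen_gmul[OF x gmul_free[OF xpow_free[OF gm] assms(2)]] step(2)[OF gm] by simp
    also have "\<dots> = gmul deg' (op (sg x + m)) (h q)"
      using step(1) by (simp add: ordered_product_min gmul_assoc)
    finally show ?case .
  qed
  have "supp p \<subseteq> good X deg"
    using assms(1) by (simp add: free_gca_good)
  then show ?thesis
    by (induction rule: gca_induct)
       (simp_all add: h_zero h_add h_scale gmul_add_left gmul_scale_left * h_xpow)
qed

lemma h_free: "p \<in> free_gca X deg \<Longrightarrow> h p \<in> free_gca Y deg'"
proof -
  assume "p \<in> free_gca X deg"
  then have "supp p \<subseteq> good X deg"
    by (simp add: free_gca_good)
  then show ?thesis
    by (induction rule: gca_induct)
       (auto simp: h_zero h_add h_scale h_xpow good_def intro!: Q.subspace_add[OF subspace_free_gca]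
          Q.subspace_scale[OF subspace_free_gca] Q.subspace_0[OF subspace_free_gca] op_free)
qed

lemma h_homogeneous:
  assumes "p \<in> free_gca X deg" "homogeneous deg k p"
  shows "homogeneous deg' k (h p)"
proof -
  have "supp p \<subseteq> good X deg \<inter> {m. monom_deg deg m = k}"
    using assms by (auto simp: free_gca_good homogeneous_def)
  then show ?thesis
  proof (induction rule: gca_induct)
    case (add c m p)
    then show ?case
      using op_homogeneous[of m] by (auto simp: h_add h_scale h_xpow good_def intro!: homogeneous_add homogeneous_scale)
  qed (simp add: h_zero)
qed

end

text \<open>This is applied to the two compositions of a change of generators with its inverse.\<close>

lemma hom_eq_id:
  assumes lin: "Vector_Spaces.linear scaleQ scaleQ f" and one: "f gone = gone"
    and mult: "\<And>p q. p \<in> free_gca X deg \<Longrightarrow> q \<in> free_gca X deg \<Longrightarrow> f (gmul deg p q) = gmul deg (f p) (f q)"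
    and gen: "\<And>x. x \<in> X \<Longrightarrow> f (gen x) = gen x"
    and p: "p \<in> free_gca X deg"
  shows "f p = p"
proof -
  have *: "f (xpow m) = xpow m" if "m \<in> good X deg" for m
    using that
  proof (induction m rule: min_induct)
    case zero
    then show ?case using one by (simp add: gone_xpow)
  next
    case (step x m)
    have gm: "m \<in> good X deg" and x: "x \<in> X"
      using good_plusD[OF step(3)] step(3) by (auto simp: good_def keys_plus_nat)
    then show ?case
      using gen_gmul_xpow_min[OF step(1,3)] mult[OF gen_free[OF x] xpow_free[OF gm]] gen[OF x] step(2)
      by simp
  qed
  show ?thesis
    by (rule linear_eqI[OF lin Q.linear_ident, of p "good X deg"]) (use p * in \<open>auto simp: free_gca_good\<close>)
qed

section \<open>Two-stage models in adapted coordinates\<close>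

text \<open>
  The generators below \<open>n\<close> span \<open>V\<close>, those from \<open>n\<close> to \<open>m\<close> the odd part of \<open>U\<close>, and those from \<open>m\<close> to \<open>N\<close> its even
  part.  With \<open>V\<close> in front, the product of a monomial in \<open>V\<close> with one in \<open>U\<close> carries no sign.  The bound on \<open>msize\<close> is
  minimality.
\<close>

locale coord_model =
  fixes n m N :: nat and deg :: "nat \<Rightarrow> nat" and d :: "nat gca \<Rightarrow> nat gca"
  assumes nm: "n \<le> m" "m \<le> N"
    and deg_pos: "i < N \<Longrightarrow> 0 < deg i"
    and deg_odd_U: "n \<le> i \<Longrightarrow> i < m \<Longrightarrow> odd (deg i)"
    and deg_even_U: "m \<le> i \<Longrightarrow> i < N \<Longrightarrow> even (deg i)"
    and d_linear: "Vector_Spaces.linear scaleQ scaleQ d"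
    and d_junk: "k \<notin> good {..<N} deg \<Longrightarrow> d (xpow k) = 0"
    and d_free: "d p \<in> free_gca {..<N} deg"
    and d_homogeneous: "p \<in> free_gca {..<N} deg \<Longrightarrow> homogeneous deg j p \<Longrightarrow> homogeneous deg (Suc j) (d p)"
    and d_Leibniz: "p \<in> free_gca {..<N} deg \<Longrightarrow> q \<in> free_gca {..<N} deg \<Longrightarrow> homogeneous deg j p \<Longrightarrow>
      d (gmul deg p q) = gmul deg (d p) q + scaleQ ((- 1) ^ j) (gmul deg p (d q))"
    and d_U: "n \<le> i \<Longrightarrow> i < N \<Longrightarrow> d (gen i) = 0"
    and d_V: "i < n \<Longrightarrow> k \<in> supp (d (gen i)) \<Longrightarrow> supp k \<subseteq> {n..<N} \<and> 2 \<le> msize k"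
    and d_d: "d (d p) = 0"
begin

abbreviation G :: "nat monom set" where
  "G \<equiv> good {..<N} deg"

lemmas d_module = d_linear[folded module_hom_iff_linear]
lemmas d_add = module_hom.add[OF d_module] and d_scale = module_hom.scale[OF d_module]
  and d_zero = module_hom.zero[OF d_module] and d_diff = module_hom.diff[OF d_module]
  and d_sum = module_hom.sum[OF d_module] and d_neg = module_hom.neg[OF d_module]

lemma d_gone: "d gone = 0"
proof -
  have "d (gmul deg gone gone) = gmul deg (d gone) gone + scaleQ 1 (gmul deg gone (d gone))"
    using d_Leibniz[OF gone_free gone_free homogeneous_gone] by simp
  then show ?thesis
    by simp
qed

definition ulen :: "nat monom \<Rightarrow> nat" where
  "ulen k = (\<Sum>i\<in>{n..<N}. lkp k i)"

lemma ulen_plus: "ulen (k + l) = ulen k + ulen l"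
  by (simp add: ulen_def lookup_add sum.distrib)

lemma ulen_sg: "ulen (sg i) = (if i \<in> {n..<N} then 1 else 0)"
  by (auto simp: ulen_def lookup_sg)

lemma ulen_eq_msize:
  assumes "supp k \<subseteq> {n..<N}"
  shows "ulen k = msize k"
  unfolding ulen_def msize_def using assms
  by (intro sum.mono_neutral_right) (auto simp: in_keys_iff)

lemma ulen_pos_iff: "0 < ulen k \<longleftrightarrow> supp k \<inter> {n..<N} \<noteq> {}"
proof -
  have "ulen k = 0 \<longleftrightarrow> (\<forall>i\<in>{n..<N}. lkp k i = 0)"
    by (simp add: ulen_def)
  then show ?thesis
    by (auto simp: in_keys_iff disjoint_iff)
qed

text \<open>
  Minimality and the two-stage condition together: each application of \<open>d\<close> trades one generator of \<open>V\<close>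
  for at least two generators of \<open>U\<close> and keeps those already present.
\<close>

lemma keys_d_xpow:
  assumes "k \<in> supp (d (xpow l))" "l \<in> G"
  shows "(\<forall>i\<in>{n..<N}. lkp l i \<le> lkp k i) \<and> ulen l + 2 \<le> ulen k"
  using assms
proof (induction l arbitrary: k rule: min_induct)
  case zero
  then show ?case
    using d_gone by (simp add: gone_xpow)
next
  case (step x l)
  have gl: "l \<in> G" and x: "x < N"
    using good_plusD[OF step(4)] step(4) by (auto simp: good_def keys_plus_nat)
  have "d (xpow (sg x + l)) = d (gmul deg (gen x) (xpow l))"
    by (simp add: gen_gmul_xpow_min[OF step(1,4)])
  also have "\<dots> = gmul deg (d (gen x)) (xpow l) + scaleQ ((- 1) ^ deg x) (gmul deg (gen x) (d (xpow l)))"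
    by (rule d_Leibniz[OF gen_free xpow_free[OF gl] homogeneous_gen]) (simp add: x)
  finally have "k \<in> supp (gmul deg (d (gen x)) (xpow l)) \<or>
      k \<in> supp (gmul deg (gen x) (d (xpow l)))"
    using step(3) keys_add keys_scaleQ by (metis (no_types, lifting) Un_iff subsetD)
  then show ?case
  proof
    assume "k \<in> supp (gmul deg (d (gen x)) (xpow l))"
    then obtain a where a: "k = a + l" "a \<in> supp (d (gen x))"
      by (auto elim: keys_gmul)
    have xn: "x < n"
      using a(2) d_U[of x] x by (cases "x < n") auto
    then have "supp a \<subseteq> {n..<N}" "2 \<le> msize a"
      using d_V a(2) by blast+
    then have "2 \<le> ulen a"
      by (simp add: ulen_eq_msize)
    then show ?thesis
      using xn by (auto simp: a ulen_plus ulen_sg lookup_add lookup_sg)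
  next
    assume "k \<in> supp (gmul deg (gen x) (d (xpow l)))"
    then obtain a where a: "k = sg x + a" "a \<in> supp (d (xpow l))"
      by (auto elim: keys_gmul simp: gen_xpow)
    then show ?thesis
      using step(2)[OF a(2) gl] by (auto simp: ulen_plus lookup_add)
  qed
qed

lemma keys_d:
  assumes "k \<in> supp (d p)"
  obtains l where "l \<in> supp p" "l \<in> G" "k \<in> supp (d (xpow l))"
proof -
  have "d p = (\<Sum>l\<in>supp p. scaleQ (lkp p l) (d (xpow l)))"
    by (subst expand_xpow[OF finite_keys order_refl]) (simp add: d_sum d_scale)
  then have "k \<in> supp (\<Sum>l\<in>supp p. scaleQ (lkp p l) (d (xpow l)))"
    using assms by simp
  then have "k \<in> (\<Union>l\<in>supp p. supp (scaleQ (lkp p l) (d (xpow l))))"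
    by (rule subsetD[OF keys_sum])
  then obtain l where "l \<in> supp p" "k \<in> supp (d (xpow l))"
    using keys_scaleQ by blast
  then show ?thesis
    using that d_junk[of l] by (cases "l \<in> G") auto
qed

subsection \<open>Quotients by generators of U\<close>

text \<open>
  \<open>ideal S\<close> is spanned by the monomials involving a generator in \<open>S\<close> together with all monomials outside the
  algebra, which are thereby treated as zero.
\<close>

definition bad :: "nat set \<Rightarrow> nat monom set" where
  "bad S = {k. k \<in> G \<longrightarrow> supp k \<inter> S \<noteq> {}}"

definition ideal :: "nat set \<Rightarrow> nat gca set" where
  "ideal S = {p. supp p \<subseteq> bad S}"

lemma subspace_ideal: "Q.subspace (ideal S)"
  unfolding ideal_def by (rule subspace_keys)

lemma ideal_mono: "S \<subseteq> S' \<Longrightarrow> ideal S \<subseteq> ideal S'"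
  by (auto simp: ideal_def bad_def)

lemma d_ideal:
  assumes "S \<subseteq> {n..<N}" "p \<in> ideal S"
  shows "d p \<in> ideal S"
proof -
  have "k \<in> bad S" if k: "k \<in> supp (d p)" for k
  proof -
    obtain l where l: "l \<in> supp p" "l \<in> G" "k \<in> supp (d (xpow l))"
      using k by (rule keys_d)
    then obtain i where i: "i \<in> supp l" "i \<in> S"
      using assms(2) by (auto simp: ideal_def bad_def)
    then have "lkp l i \<le> lkp k i"
      using keys_d_xpow[OF l(3,2)] assms(1) by blast
    then have "i \<in> supp k"
      using i(1) by (auto simp: in_keys_iff)
    then show ?thesis
      using i(2) by (auto simp: bad_def)
  qed
  then show ?thesis
    by (auto simp: ideal_def)
qed

lemma d_in_ideal_U: "d p \<in> ideal {n..<N}"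
proof -
  have "k \<in> bad {n..<N}" if k: "k \<in> supp (d p)" for k
  proof -
    obtain l where l: "l \<in> supp p" "l \<in> G" "k \<in> supp (d (xpow l))"
      using k by (rule keys_d)
    then have "0 < ulen k"
      using keys_d_xpow[OF l(3,2)] by simp
    then show ?thesis
      by (simp add: ulen_pos_iff bad_def)
  qed
  then show ?thesis
    by (auto simp: ideal_def)
qed

lemma lookup_gen_gmul: "lkp (gmul deg (gen i) p) (sg i + k) = monom_sign deg (sg i) k * lkp p k"
proof -
  have "gmul deg (gen i) p = (\<Sum>l\<in>supp p. scaleQ (lkp p l * monom_sign deg (sg i) l) (xpow (sg i + l)))"
    by (subst expand_xpow[OF finite_keys order_refl])
       (simp add: gmul_sum_right gmul_scale_right gen_xpow gmul_xpow)
  then have "lkp (gmul deg (gen i) p) (sg i + k) =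
      (\<Sum>l\<in>supp p. lkp p l * monom_sign deg (sg i) l * (if l = k then 1 else 0))"
    by (simp add: lookup_sum lookup_scaleQ lookup_xpow)
  also have "\<dots> = (\<Sum>l\<in>supp p. if l = k then lkp p k * monom_sign deg (sg i) k else 0)"
    by (intro sum.cong) auto
  finally show ?thesis
    by (auto simp: in_keys_iff)
qed

lemma gen_gmul_bad:
  assumes "i < N" "k \<notin> G"
  shows "sg i + k \<notin> G"
  using assms good_plusD(1) by blast

lemma d_gen_gmul:
  assumes i: "n \<le> i" "i < N"
  shows "d (gmul deg (gen i) p) = scaleQ ((- 1) ^ deg i) (gmul deg (gen i) (d p))"
proof (rule linear_eqI[where M = UNIV and f = "\<lambda>p. d (gmul deg (gen i) p)"
      and g = "\<lambda>p. scaleQ ((- 1) ^ deg i) (gmul deg (gen i) (d p))"])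
  show "Vector_Spaces.linear scaleQ scaleQ (\<lambda>p. d (gmul deg (gen i) p))"
    by (intro linear_scaleQI) (simp_all add: gmul_add_right gmul_scale_right d_add d_scale)
  show "Vector_Spaces.linear scaleQ scaleQ (\<lambda>p. scaleQ ((- 1) ^ deg i) (gmul deg (gen i) (d p)))"
    by (intro linear_scaleQI)
       (simp_all add: gmul_add_right gmul_scale_right d_add d_scale Q.scale_right_distrib mult.commute)
  fix k
  show "d (gmul deg (gen i) (xpow k)) = scaleQ ((- 1) ^ deg i) (gmul deg (gen i) (d (xpow k)))"
  proof (cases "k \<in> G")
    case True
    have "gen i \<in> free_gca {..<N} deg"
      using i by (simp add: gen_free)
    from d_Leibniz[OF this xpow_free[OF True] homogeneous_gen] show ?thesis
      by (simp add: d_U[OF i])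
  next
    case False
    then show ?thesis
      using d_junk gen_gmul_bad[OF i(2) False] by (simp add: gen_xpow gmul_xpow d_scale)
  qed
qed simp

lemma gen_gmul_ideal:
  assumes "i < N" "p \<in> ideal S"
  shows "gmul deg (gen i) p \<in> ideal S"
proof -
  have "k \<in> bad S" if k: "k \<in> supp (gmul deg (gen i) p)" for k
  proof -
    obtain l where l: "k = sg i + l" "l \<in> supp p"
      using k by (auto elim: keys_gmul simp: gen_xpow)
    then have "l \<in> bad S"
      using assms(2) by (auto simp: ideal_def)
    then show ?thesis
      using gen_gmul_bad[OF assms(1), of l] by (auto simp: l bad_def keys_plus_nat)
  qed
  then show ?thesis
    by (auto simp: ideal_def)
qed

lemma gen_gmul_in_ideal: "i \<in> S \<Longrightarrow> gmul deg (gen i) p \<in> ideal S"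
  by (auto simp: ideal_def bad_def gen_xpow keys_plus_nat elim!: keys_gmul)

lemma ideal_insert:
  assumes i: "i < N"
  shows "ideal (insert i S) = {gmul deg (gen i) x + p | x p. p \<in> ideal S}" (is "_ = ?R")
proof
  have R: "Q.subspace ?R"
    using Q.subspace_coboundaries_mod[OF linear_gmul[of deg "gen i"] Q.subspace_UNIV subspace_ideal[of S]] by simp
  show "ideal (insert i S) \<subseteq> ?R"
  proof
    fix p assume "p \<in> ideal (insert i S)"
    then have "supp p \<subseteq> bad (insert i S)"
      by (simp add: ideal_def)
    then show "p \<in> ?R"
    proof (induction rule: gca_induct)
      case zero
      show ?case by (rule Q.subspace_0[OF R])
    next
      case (add c k p)
      have "xpow k \<in> ?R"
      proof (cases "k \<in> bad S")
        case True
        then show ?thesis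
          by (intro CollectI exI[of _ 0] exI[of _ "xpow k"]) (simp add: ideal_def)
      next
        case False
        then have k: "i \<in> supp k" "k \<in> G"
          using add(1) by (auto simp: bad_def)
        define l where "l = k - sg i"
        have kl: "k = sg i + l"
          using k(1) by (intro poly_mapping_eqI) (auto simp: l_def lookup_add lookup_minus lookup_sg in_keys_iff)
        let ?s = "monom_sign deg (sg i) l"
        have "?s \<noteq> 0"
          using good_plusD(3)[of "sg i" l "{..<N}" deg] k(2) by (simp add: kl monom_sign_def)
        then have "?s * ?s = 1"
          by (auto simp: monom_sign_sg simp flip: power_add mult_2 split: if_splits)
        then have "xpow k = gmul deg (gen i) (scaleQ ?s (xpow l)) + 0"
          by (simp add: kl gmul_scale_right gen_xpow gmul_xpow)
        then show ?thesis
          using Q.subspace_0[OF subspace_ideal] by blast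
      qed
      then have "scaleQ c (xpow k) \<in> ?R"
        by (rule Q.subspace_scale[OF R])
      then show ?case
        using add(3) by (rule Q.subspace_add[OF R])
    qed
  qed
  show "?R \<subseteq> ideal (insert i S)"
  proof
    fix y assume "y \<in> ?R"
    then obtain x p where y: "y = gmul deg (gen i) x + p" "p \<in> ideal S"
      by blast
    then have "p \<in> ideal (insert i S)"
      using ideal_mono[of S "insert i S"] by blast
    then show "y \<in> ideal (insert i S)"
      unfolding y(1) by (intro Q.subspace_add[OF subspace_ideal] gen_gmul_in_ideal) simp_all
  qed
qed

lemma even_gen_regular:
  assumes "i < N" "even (deg i)" "i \<notin> S" "gmul deg (gen i) p \<in> ideal S"
  shows "p \<in> ideal S"
proof -
  have "k \<in> bad S" if k: "k \<in> supp p" for k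
  proof -
    have s: "monom_sign deg (sg i) k = 1"
      using assms(2) by (simp add: monom_sign_sg)
    have "sg i + k \<in> supp (gmul deg (gen i) p)"
      using k by (simp add: in_keys_iff lookup_gen_gmul s)
    then have b: "sg i + k \<in> bad S"
      using assms(4) by (auto simp: ideal_def)
    show ?thesis
    proof (cases "k \<in> G")
      case True
      then have "sg i + k \<in> G"
        using s assms(1) by (intro good_plus sg_good) auto
      then show ?thesis
        using b assms(3) by (auto simp: bad_def keys_plus_nat)
    qed (simp add: bad_def)
  qed
  then show ?thesis
    by (auto simp: ideal_def)
qed

text \<open>
  Each even generator of \<open>U\<close> is a cocycle and a nonzerodivisor modulo the others, so killing it at most
  doubles the cohomology.
\<close>

lemma hdim_le_kill_even_U:
  assumes "Q.hdim_le d (ideal {}) k"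
  shows "Q.hdim_le d (ideal {m..<N}) (2 ^ (N - m) * k)"
proof -
  have "S \<subseteq> {m..<N} \<longrightarrow> Q.hdim_le d (ideal S) (2 ^ card S * k)" if "finite S" for S
    using that
  proof (induction S rule: finite_induct)
    case empty
    then show ?case using assms by simp
  next
    case (insert i S)
    show ?case
    proof
      assume sub: "insert i S \<subseteq> {m..<N}"
      then have i: "n \<le> i" "i < N" "even (deg i)" and S: "S \<subseteq> {n..<N}"
        using nm deg_even_U by auto
      have "Q.hdim_le d (ideal S) (2 ^ card S * k)"
        using insert(3) sub by blast
      then have "Q.hdim_le d {gmul deg (gen i) x + p | x p. p \<in> ideal S} (2 * (2 ^ card S * k))"
      proof (rule Q.hdim_le_cokernel[OF d_linear subspace_ideal _ _ linear_gmul, rotated -1])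
        show "d x \<in> ideal S" if "x \<in> ideal S" for x
          using d_ideal[OF S that] .
        show "d (d x) \<in> ideal S" for x
          by (simp add: d_d Q.subspace_0[OF subspace_ideal])
        show "gmul deg (gen i) x \<in> ideal S" if "x \<in> ideal S" for x
          using gen_gmul_ideal[OF i(2) that] .
        show "gmul deg (gen i) (d x) - d (gmul deg (gen i) x) \<in> ideal S" for x
          using i(3) by (simp add: d_gen_gmul[OF i(1,2)] Q.subspace_0[OF subspace_ideal])
        show "x \<in> ideal S" if "gmul deg (gen i) x \<in> ideal S" for x
          using even_gen_regular[OF i(2,3) insert(2) that] .
      qed
      then show "Q.hdim_le d (ideal (insert i S)) (2 ^ card (insert i S) * k)"
        using insert(1,2) by (simp add: ideal_insert[OF i(2)] mult.assoc)
    qed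
  qed
  from this[of "{m..<N}"] show ?thesis
    by simp
qed

end

context coord_model
begin

subsection \<open>The generators of V have odd degree\<close>

definition high :: "nat \<Rightarrow> nat gca \<Rightarrow> nat gca" where
  "high P = linext (\<lambda>k. if P \<le> monom_deg deg k then xpow k else 0)"

lemma linear_high: "Vector_Spaces.linear scaleQ scaleQ (high P)"
  unfolding high_def by (rule linear_linext)

lemmas high_module = linear_high[folded module_hom_iff_linear]
lemmas high_add = module_hom.add[OF high_module] and high_scale = module_hom.scale[OF high_module]
  and high_zero = module_hom.zero[OF high_module] and high_diff = module_hom.diff[OF high_module]

lemma high_xpow: "high P (xpow k) = (if P \<le> monom_deg deg k then xpow k else 0)"
  by (simp add: high_def)

lemma lookup_high: "lkp (high P p) k = (if P \<le> monom_deg deg k then lkp p k else 0)"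
  using subset_UNIV[of "supp p"]
  by (induction rule: gca_induct)
     (auto simp: high_zero high_add high_scale high_xpow lookup_add lookup_scaleQ lookup_xpow)

lemma keys_high: "k \<in> supp (high P p) \<longleftrightarrow> k \<in> supp p \<and> P \<le> monom_deg deg k"
  by (simp add: in_keys_iff lookup_high)

lemma high_eq_iff: "high P p = p \<longleftrightarrow> (\<forall>k\<in>supp p. P \<le> monom_deg deg k)"
  by (auto simp: poly_mapping_eq_iff fun_eq_iff lookup_high in_keys_iff)

lemma high_eq_0_iff: "high P p = 0 \<longleftrightarrow> (\<forall>k\<in>supp p. monom_deg deg k < P)"
  by (auto simp: poly_mapping_eq_iff fun_eq_iff lookup_high in_keys_iff Ball_def simp flip: not_le)

lemma high_high: "high P (high P p) = high P p"
  by (simp add: high_eq_iff keys_high)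

lemma high_weaken: "high P p = p \<Longrightarrow> P' \<le> P \<Longrightarrow> high P' p = p"
  unfolding high_eq_iff using le_trans by blast

lemma high_ideal: "p \<in> ideal S \<Longrightarrow> high P p \<in> ideal S"
  by (auto simp: ideal_def keys_high)

lemma d_high: "d (high P p) = high (Suc P) (d p)"
proof (rule linear_eqI[where M = UNIV and f = "\<lambda>p. d (high P p)" and g = "\<lambda>p. high (Suc P) (d p)"])
  show "Vector_Spaces.linear scaleQ scaleQ (\<lambda>p. d (high P p))"
    "Vector_Spaces.linear scaleQ scaleQ (\<lambda>p. high (Suc P) (d p))"
    by (auto intro!: linear_scaleQI simp: high_add high_scale d_add d_scale)
  fix k
  show "d (high P (xpow k)) = high (Suc P) (d (xpow k))"
  proof (cases "k \<in> G")
    case True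
    have "homogeneous deg (Suc (monom_deg deg k)) (d (xpow k))"
      by (rule d_homogeneous[OF xpow_free[OF True] homogeneous_xpow])
    then have l: "monom_deg deg l = Suc (monom_deg deg k)" if "l \<in> supp (d (xpow k))" for l
      using that by (simp add: homogeneous_def)
    show ?thesis
    proof (cases "P \<le> monom_deg deg k")
      case P: True
      then have "high (Suc P) (d (xpow k)) = d (xpow k)"
        by (simp add: high_eq_iff l)
      then show ?thesis
        using P by (simp add: high_xpow)
    next
      case P: False
      then have "high (Suc P) (d (xpow k)) = 0"
        by (simp add: high_eq_0_iff l)
      then show ?thesis
        using P by (simp add: high_xpow d_zero)
    qed
  next
    case False
    then show ?thesis
      by (simp add: high_xpow d_junk d_zero high_zero)
  qed
qed simp

lemma gen_gmul_high: "gmul deg (gen i) (high P p) = high (deg i + P) (gmul deg (gen i) p)"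
proof (rule linear_eqI[where M = UNIV and f = "\<lambda>p. gmul deg (gen i) (high P p)"
      and g = "\<lambda>p. high (deg i + P) (gmul deg (gen i) p)"])
  show "Vector_Spaces.linear scaleQ scaleQ (\<lambda>p. gmul deg (gen i) (high P p))"
    "Vector_Spaces.linear scaleQ scaleQ (\<lambda>p. high (deg i + P) (gmul deg (gen i) p))"
    by (auto intro!: linear_scaleQI simp: high_add high_scale gmul_add_right gmul_scale_right)
  show "gmul deg (gen i) (high P (xpow k)) = high (deg i + P) (gmul deg (gen i) (xpow k))" for k
    by (simp add: high_xpow gen_xpow gmul_xpow high_scale monom_deg_plus)
qed simp

text \<open>The cohomology of the quotient by \<open>ideal S\<close> vanishes in degrees \<open>\<ge> P\<close>.\<close>

definition acyclic_above :: "nat \<Rightarrow> nat set \<Rightarrow> bool" where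
  "acyclic_above P S \<longleftrightarrow> (\<forall>z. high P z = z \<longrightarrow> d z \<in> ideal S \<longrightarrow> (\<exists>b. z - d b \<in> ideal S))"

lemma acyclic_aboveD:
  assumes "acyclic_above P S" "Q \<ge> P" "high (Suc Q) z = z" "d z \<in> ideal S"
  obtains b where "high Q b = b" "z - d b \<in> ideal S"
proof -
  have "high P z = z"
    using assms(2,3) by (auto intro: high_weaken)
  then obtain b where b: "z - d b \<in> ideal S"
    using assms(1,4) by (auto simp: acyclic_above_def)
  have "high (Suc Q) (z - d b) = z - d (high Q b)"
    by (simp add: high_diff assms(3) d_high)
  then have "z - d (high Q b) \<in> ideal S"
    using high_ideal[OF b, of "Suc Q"] by simp
  then show ?thesis
    using that[of "high Q b"] high_high by blast
qed

text \<open>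
  The degrees of finitely many representatives are bounded, so a cocycle of higher degree has no
  component along them.
\<close>

lemma acyclic_above_if_hdim_le:
  assumes "Q.hdim_le d (ideal {}) k"
  shows "\<exists>P. acyclic_above P {}"
proof -
  obtain S where S: "finite S" and Sz: "\<forall>z\<in>{z. d z \<in> ideal {}}. \<exists>s\<in>Q.span S. z - s \<in> {d b + i | b i. i \<in> ideal {}}"
    using assms unfolding Q.hdim_le_def by (rule Q.qdim_leE)
  have "finite (\<Union>s\<in>S. monom_deg deg ` supp s)"
    using S by simp
  then obtain P where P: "\<And>s k. s \<in> S \<Longrightarrow> k \<in> supp s \<Longrightarrow> monom_deg deg k < P"
    by (auto simp: finite_nat_set_iff_bounded)
  have "\<exists>b. z - d b \<in> ideal {}" if z: "high (Suc P) z = z" "d z \<in> ideal {}" for z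
  proof -
    obtain s b i where s: "s \<in> Q.span S" "z - s = d b + i" "i \<in> ideal {}"
      using bspec[OF Sz, of z] z(2) by blast
    have "high (Suc P) s = 0"
      using s(1)
    proof (induction rule: Q.span_induct_alt)
      case (step c x y)
      have "high (Suc P) x = 0"
        using P[OF step(1)] by (auto simp: high_eq_0_iff less_Suc_eq)
      then show ?case
        using step by (simp add: high_add high_scale)
    qed (simp add: high_zero)
    moreover have "high (Suc P) (z - s) = d (high P b) + high (Suc P) i"
      by (simp add: s(2) high_add d_high)
    ultimately have "z - d (high P b) = high (Suc P) i"
      using z(1) by (simp add: high_diff)
    then show ?thesis
      using high_ideal[OF s(3)] by (intro exI[of _ "high P b"]) simp
  qed
  then show ?thesis
    unfolding acyclic_above_def by blast
qed

text \<open>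
  If \<open>d z = u y\<close> modulo \<open>ideal S\<close>, then \<open>y\<close> is a cocycle because \<open>u\<close> is regular, hence a coboundary \<open>d b\<close>; now \<open>z - u b\<close> is a
  cocycle modulo \<open>ideal S\<close>.  The degree bound moves up because the degree of \<open>y\<close> is lower than that of \<open>z\<close>.
\<close>

lemma acyclic_above_kill_even:
  assumes i: "n \<le> i" "i < N" "even (deg i)" "i \<notin> S" and S: "S \<subseteq> {n..<N}" and ac: "acyclic_above P S"
  shows "acyclic_above (Suc P + deg i) (insert i S)"
  unfolding acyclic_above_def
proof (intro allI impI)
  let ?u = "gmul deg (gen i)"
  have sub: "Q.subspace (ideal S)"
    by (rule subspace_ideal)
  fix z assume z: "high (Suc P + deg i) z = z" and dz: "d z \<in> ideal (insert i S)"
  obtain y0 p0 where y0: "d z = ?u y0 + p0" "p0 \<in> ideal S"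
    using dz unfolding ideal_insert[OF i(2)] by blast
  define y where "y = high (Suc (Suc P)) y0"
  define p where "p = high (deg i + Suc (Suc P)) p0"
  have p: "p \<in> ideal S"
    unfolding p_def by (rule high_ideal[OF y0(2)])
  have "d z = high (deg i + Suc (Suc P)) (d z)"
    using d_high[of "Suc P + deg i" z] z by (simp add: add.commute)
  also have "\<dots> = ?u y + p"
    by (simp add: y0(1) high_add y_def p_def gen_gmul_high)
  finally have dz': "d z = ?u y + p" .
  have u_d: "?u (d x) = d (?u x)" for x
    using d_gen_gmul[OF i(1,2), of x] i(3) by simp
  have "?u (d y) = d (d z) - d p"
    by (simp add: u_d dz' d_add)
  then have "?u (d y) \<in> ideal S"
    using d_ideal[OF S p] by (simp add: d_d Q.subspace_neg[OF sub])
  then have "d y \<in> ideal S"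
    by (rule even_gen_regular[OF i(2,3,4)])
  moreover have "high (Suc (Suc P)) y = y"
    by (simp add: y_def high_high)
  ultimately obtain b where b: "high (Suc P) b = b" "y - d b \<in> ideal S"
    using acyclic_aboveD[OF ac, of "Suc P" y] by auto
  have "d (z - ?u b) = ?u (y - d b) + p"
    by (simp add: d_diff dz' gmul_diff_right u_d)
  also have "\<dots> \<in> ideal S"
    by (rule Q.subspace_add[OF sub gen_gmul_ideal[OF i(2) b(2)] p])
  finally have "d (z - ?u b) \<in> ideal S" .
  moreover have "high P (z - ?u b) = z - ?u b"
  proof -
    have "high (deg i + Suc P) (?u b) = ?u b"
      using gen_gmul_high[of i "Suc P" b] b(1) by simp
    then have "high P (?u b) = ?u b"
      by (rule high_weaken) simp
    moreover have "high P z = z"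
      using z by (rule high_weaken) simp
    ultimately show ?thesis
      by (simp add: high_diff)
  qed
  ultimately obtain c where "z - ?u b - d c \<in> ideal S"
    using ac by (auto simp: acyclic_above_def)
  then have "?u b + (z - ?u b - d c) \<in> ideal (insert i S)"
    unfolding ideal_insert[OF i(2)] by blast
  then show "\<exists>b. z - d b \<in> ideal (insert i S)"
    by (intro exI[of _ c]) simp
qed

text \<open>
  For an odd generator \<open>u\<close> of \<open>U\<close>, a cocycle \<open>z\<close> modulo \<open>u\<close> gives \<open>u z = d a\<close>, where \<open>a\<close> is again a cocycle modulo
  \<open>u\<close>, and \<open>z\<close> is cohomologous to the image of \<open>a\<close> under the derivation \<open>\<theta>\<close> with \<open>d = d' + u \<theta>\<close>.  By minimality
  \<open>\<theta>\<close> raises the number of factors from \<open>U\<close>, so it is nilpotent once the even generators of \<open>U\<close> have been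
  killed, and \<open>z\<close> is a coboundary.
\<close>

lemma acyclic_above_kill_odd:
  assumes i: "n \<le> i" "i < m" "i \<notin> S" and S: "S \<subseteq> {n..<N}" "{m..<N} \<subseteq> S" and ac: "acyclic_above P S"
  shows "acyclic_above P (insert i S)"
proof -
  let ?u = "gmul deg (gen i)"
  have iN: "i < N"
    using i nm by simp
  have odd: "odd (deg i)"
    using deg_odd_U i by simp
  have sub: "Q.subspace (ideal S')" for S'
    by (rule subspace_ideal)
  have mono: "p \<in> ideal (insert i S)" if "p \<in> ideal S" for p
    using that ideal_mono[of S "insert i S"] by blast
  have u_d: "?u (d x) = - d (?u x)" for x
    using d_gen_gmul[OF i(1) iN, of x] odd by simp
  have uu: "?u (?u x) = 0" for x
  proof -
    have "gmul deg (gen i) (gen i) = 0"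
      using odd by (simp add: gen_xpow gmul_xpow monom_sign_def odd_keys_sg)
    then show ?thesis
      by (simp flip: gmul_assoc)
  qed
  \<comment> \<open>Modulo \<open>ideal S\<close>, \<open>F t\<close> consists of the multiples of \<open>u\<close> and the elements with at least \<open>t\<close> factors\<close>
  \<comment> \<open>from \<open>U\<close>; the claim pushes a cocycle into every \<open>F t\<close> by subtracting coboundaries.\<close>
  define F where "F t = {p :: nat gca. supp p \<subseteq> bad (insert i S) \<union> {k. t \<le> ulen k}}" for t
  have claim: "\<exists>b. z - d b \<in> F t" if "high P z = z" "d z \<in> ideal (insert i S)" for z t
    using that
  proof (induction t arbitrary: z)
    case 0
    show ?case
      by (auto simp: F_def)
  next
    case (Suc t)
    obtain y p where y: "d z = ?u y + p" "p \<in> ideal S"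
      using Suc(3) unfolding ideal_insert[OF iN] by blast
    have "?u (d z) \<in> ideal S"
      by (simp add: y(1) gmul_add_right uu gen_gmul_ideal[OF iN y(2)])
    then have duz: "d (?u z) \<in> ideal S"
      using Q.subspace_neg[OF sub] by (fastforce simp: u_d)
    have "high (deg i + P) (?u z) = ?u z"
      using gen_gmul_high[of i P z] Suc(2) by simp
    then have "high (Suc P) (?u z) = ?u z"
      using deg_pos[OF iN] by (auto intro: high_weaken)
    from acyclic_aboveD[OF ac le_refl this duz]
    obtain a where a: "high P a = a" "?u z - d a \<in> ideal S" .
    have "d a \<in> ideal (insert i S)"
    proof -
      have "d a = ?u z - (?u z - d a)"
        by simp
      then show ?thesis
        using Q.subspace_diff[OF sub gen_gmul_in_ideal[of i "insert i S"] mono[OF a(2)], of z] by simp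
    qed
    from Suc(1)[OF a(1) this] obtain b where b: "a - d b \<in> F t"
      by blast
    define f where "f = a - d b"
    define g where "g = linext (\<lambda>k. if k \<in> bad (insert i S) then 0 else xpow k) f"
    have lg: "lkp g k = (if k \<in> bad (insert i S) then 0 else lkp f k)" for k
      unfolding g_def using subset_UNIV[of "supp f"]
    proof (induction rule: gca_induct)
      case zero
      then show ?case
        by (simp add: linext_def)
    next
      case (add c k' p)
      interpret l: Vector_Spaces.linear scaleQ scaleQ "linext (\<lambda>k. if k \<in> bad (insert i S) then 0 else xpow k)"
        by (rule linear_linext)
      show ?case
        using add by (auto simp: l.add l.scale lookup_add lookup_scaleQ lookup_xpow)
    qed
    have "f - g \<in> ideal (insert i S)"
      by (auto simp: ideal_def in_keys_iff lookup_minus lg split: if_splits)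
    then obtain c q where c: "f - g = ?u c + q" "q \<in> ideal S"
      unfolding ideal_insert[OF iN] by blast
    have "d f = d a"
      by (simp add: f_def d_diff d_d)
    moreover have "f = ?u c + q + g"
      using c(1) by (simp add: algebra_simps)
    ultimately have "d a = - ?u (d c) + d q + d g"
      by (simp add: d_add u_d)
    then have eq: "?u (z + d c) = (?u z - d a) + d q + d g"
      by (simp add: gmul_add_right)
    have "k \<in> bad (insert i S) \<union> {k. Suc t \<le> ulen k}" if k: "k \<in> supp (z + d c)" for k
    proof (cases "k \<in> bad (insert i S)")
      case False
      then have kG: "k \<in> G" "i \<notin> supp k" "supp k \<inter> S = {}"
        by (auto simp: bad_def)
      have s: "monom_sign deg (sg i) k \<noteq> 0"
        using kG(2) by (auto simp: monom_sign_sg odd_keys_def)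
      have ik: "sg i + k \<in> G"
        using kG(1) iN s by (intro good_plus sg_good) auto
      have nb: "sg i + k \<notin> bad S"
        using ik kG(3) i(3) by (auto simp: bad_def keys_plus_nat)
      have "sg i + k \<in> supp (?u (z + d c))"
        using k s by (simp add: in_keys_iff lookup_gen_gmul)
      then have "lkp ((?u z - d a) + d q + d g) (sg i + k) \<noteq> 0"
        unfolding eq in_keys_iff .
      moreover have "lkp (?u z - d a) (sg i + k) = 0"
        using a(2) nb by (auto simp: ideal_def in_keys_iff)
      moreover have "lkp (d q) (sg i + k) = 0"
        using d_ideal[OF S(1) c(2)] nb by (auto simp: ideal_def in_keys_iff)
      ultimately have "sg i + k \<in> supp (d g)"
        by (simp add: lookup_add in_keys_iff)
      then obtain l where l: "l \<in> supp g" "l \<in> G" "sg i + k \<in> supp (d (xpow l))"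
        by (rule keys_d)
      have "l \<in> supp f" "l \<notin> bad (insert i S)"
        using l(1) by (auto simp: in_keys_iff lg split: if_splits)
      then have "t \<le> ulen l"
        using b by (auto simp: F_def f_def)
      then have "t + 2 \<le> ulen (sg i + k)"
        using keys_d_xpow[OF l(3,2)] by simp
      then show ?thesis
        using i(1) iN by (simp add: ulen_plus ulen_sg)
    qed simp
    then have "z - d (- c) \<in> F (Suc t)"
      by (auto simp: F_def d_neg)
    then show ?case
      by blast
  qed
  \<comment> \<open>Modulo the even generators of \<open>U\<close> a monomial has fewer than \<open>Suc N\<close> factors from \<open>U\<close>.\<close>
  have "F (Suc N) \<subseteq> ideal (insert i S)"
  proof
    fix p assume p: "p \<in> F (Suc N)"
    have "k \<in> bad (insert i S)" if k: "k \<in> supp p" for k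
    proof (rule ccontr)
      assume nb: "k \<notin> bad (insert i S)"
      then have kG: "k \<in> G" and kS: "supp k \<inter> S = {}"
        by (auto simp: bad_def)
      have "lkp k j \<le> 1" if "j \<in> {n..<N}" for j
      proof (cases "j \<in> supp k")
        case True
        then have "j < m"
          using kS S(2) that by (auto simp: disjoint_iff not_le)
        then have "j \<in> odd_keys deg k"
          using True deg_odd_U that by (simp add: odd_keys_def)
        then show ?thesis
          using kG by (simp add: good_def)
      qed (simp add: in_keys_iff)
      then have "ulen k \<le> (\<Sum>j\<in>{n..<N}. 1)"
        unfolding ulen_def by (intro sum_mono)
      then show False
        using p k nb by (auto simp: F_def)
    qed
    then show "p \<in> ideal (insert i S)"
      by (auto simp: ideal_def)
  qed
  then show ?thesis
    unfolding acyclic_above_def using claim by blast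
qed

text \<open>
  Once all of \<open>U\<close> is killed the differential is zero, so acyclicity in high degrees leaves no monomials of
  high degree in \<open>V\<close>.
\<close>

lemma deg_odd_V:
  assumes "Q.hdim_le d (ideal {}) k" and v: "v < n"
  shows "odd (deg v)"
proof
  assume ev: "even (deg v)"
  have vN: "v < N"
    using v nm by simp
  have "S \<subseteq> {m..<N} \<longrightarrow> (\<exists>P. acyclic_above P S)" if "finite S" for S
    using that
  proof (induction S rule: finite_induct)
    case empty
    show ?case using acyclic_above_if_hdim_le[OF assms(1)] by simp
  next
    case (insert i S)
    show ?case
    proof
      assume sub: "insert i S \<subseteq> {m..<N}"
      then obtain P where "acyclic_above P S"
        using insert by blast
      moreover have "n \<le> i" "i < N" "even (deg i)" "S \<subseteq> {n..<N}"
        using sub nm deg_even_U by auto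
      ultimately show "\<exists>P. acyclic_above P (insert i S)"
        using acyclic_above_kill_even insert(2) by blast
    qed
  qed
  then obtain P where P: "acyclic_above P {m..<N}"
    by blast
  have "S \<subseteq> {n..<m} \<longrightarrow> acyclic_above P ({m..<N} \<union> S)" if "finite S" for S
    using that
  proof (induction S rule: finite_induct)
    case empty
    show ?case using P by simp
  next
    case (insert i S)
    show ?case
    proof
      assume sub: "insert i S \<subseteq> {n..<m}"
      have "acyclic_above P (insert i ({m..<N} \<union> S))"
        using sub insert nm by (intro acyclic_above_kill_odd) auto
      then show "acyclic_above P ({m..<N} \<union> insert i S)"
        by simp
    qed
  qed
  from this[of "{n..<m}"] have "acyclic_above P ({m..<N} \<union> {n..<m})"
    by simp
  moreover have "{m..<N} \<union> {n..<m} = {n..<N}"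
    using nm by auto
  ultimately have ac: "acyclic_above P {n..<N}"
    by simp
  \<comment> \<open>A high power of an even generator of \<open>V\<close> would be a nonzero class.\<close>
  define k where "k = Poly_Mapping.single v (Suc P)"
  have kk: "supp k = {v}"
    by (simp add: k_def)
  have kG: "k \<in> G"
    using ev vN by (auto simp: good_def kk odd_keys_def)
  have "monom_deg deg k = Suc P * deg v"
    by (simp add: monom_deg_def k_def)
  then have "P \<le> monom_deg deg k"
    using deg_pos[OF vN] by (cases "deg v") auto
  then have "high P (xpow k) = xpow k"
    by (simp add: high_xpow)
  then obtain b where "xpow k - d b \<in> ideal {n..<N}"
    using ac d_in_ideal_U by (auto simp: acyclic_above_def)
  then have "(xpow k - d b) + d b \<in> ideal {n..<N}"
    by (intro Q.subspace_add[OF subspace_ideal] d_in_ideal_U)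
  then have "k \<in> bad {n..<N}"
    by (simp add: ideal_def)
  then show False
    using kG v by (auto simp: bad_def kk)
qed

end

subsection \<open>The quotient as a Koszul complex\<close>

definition mon :: "'g set \<Rightarrow> 'g monom" where
  "mon S = (\<Sum>i\<in>S. sg i)"

lemma lookup_mon: "finite S \<Longrightarrow> lkp (mon S) x = (if x \<in> S then 1 else 0)"
  by (simp add: mon_def lookup_sum lookup_sg)

lemma keys_mon [simp]: "finite S \<Longrightarrow> supp (mon S) = S"
  by (auto simp: in_keys_iff lookup_mon split: if_splits)

lemma mon_empty [simp]: "mon {} = 0"
  by (simp add: mon_def)

lemma mon_insert: "finite S \<Longrightarrow> i \<notin> S \<Longrightarrow> mon (insert i S) = sg i + mon S"
  by (simp add: mon_def)

lemma msize_mon: "finite S \<Longrightarrow> msize (mon S) = card S"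
  by (simp add: msize_def lookup_mon)

context coord_model
begin

lemma mon_good:
  assumes "finite S" "S \<subseteq> {..<N}"
  shows "mon S \<in> G"
  using assms by (auto simp: good_def odd_keys_def lookup_mon)

lemma eq_mon_keys:
  assumes "k \<in> G" "\<And>x. x \<in> supp k \<Longrightarrow> odd (deg x)"
  shows "k = mon (supp k)"
proof (rule poly_mapping_eqI)
  fix x
  show "lkp k x = lkp (mon (supp k)) x"
    using assms by (cases "x \<in> supp k") (auto simp: lookup_mon good_def odd_keys_def in_keys_iff)
qed

text \<open>The matrix of multiplication by \<open>d (gen i)\<close> on the exterior algebra of the odd part of \<open>U\<close>.\<close>

definition opmat :: "nat \<Rightarrow> nat set \<Rightarrow> nat set \<Rightarrow> rat" where
  "opmat i A B = lkp (gmul deg (d (gen i)) (xpow (mon B))) (mon A)"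

abbreviation J :: "nat set set" where
  "J \<equiv> Pow {n..<m}"

lemma finite_J: "A \<in> J \<Longrightarrow> finite A"
  by (auto intro: finite_subset)

text \<open>
  Modulo the even generators of \<open>U\<close>, only the squarefree monomials indexed by \<open>J\<close> matter, so composition of
  multiplications is the product of the matrices.
\<close>

lemma lookup_d_gen_gmul:
  assumes "A \<in> J" and "supp p \<subseteq> {k \<in> G. supp k \<subseteq> {n..<N}}"
  shows "lkp (gmul deg (d (gen i)) p) (mon A) = (\<Sum>B\<in>J. opmat i A B * lkp p (mon B))"
  using assms(2)
proof (induction rule: gca_induct)
  case zero
  show ?case by simp
next
  case (add c k p)
  have "lkp (gmul deg (d (gen i)) (xpow k)) (mon A) = (\<Sum>B\<in>J. opmat i A B * lkp (xpow k) (mon B))"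
  proof (cases "supp k \<subseteq> {n..<m}")
    case True
    then have kJ: "supp k \<in> J"
      by simp
    have k: "k = mon (supp k)"
      using add(1) True deg_odd_U by (intro eq_mon_keys) auto
    have "k = mon B \<longleftrightarrow> B = supp k" if "B \<in> J" for B
      using k keys_mon[OF finite_J[OF that]] by metis
    then have "(\<Sum>B\<in>J. opmat i A B * lkp (xpow k) (mon B)) =
        (\<Sum>B\<in>J. if B = supp k then opmat i A (supp k) else 0)"
      by (intro sum.cong refl) (simp add: lookup_xpow)
    also have "\<dots> = opmat i A (supp k)"
      using kJ by simp
    also have "\<dots> = lkp (gmul deg (d (gen i)) (xpow k)) (mon A)"
      using k by (simp add: opmat_def)
    finally show ?thesis
      by simp
  next
    case False
    have "mon B \<noteq> k" if "B \<in> J" for B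
      using False that keys_mon[OF finite_J[OF that]] by auto
    then have "(\<Sum>B\<in>J. opmat i A B * lkp (xpow k) (mon B)) = 0"
      by (intro sum.neutral) (auto simp: lookup_xpow)
    moreover have "mon A \<notin> supp (gmul deg (d (gen i)) (xpow k))"
    proof
      assume "mon A \<in> supp (gmul deg (d (gen i)) (xpow k))"
      then obtain a where "mon A = a + k"
        by (auto elim: keys_gmul)
      then have "supp k \<subseteq> A"
        using keys_mon[OF finite_J[OF assms(1)]] keys_plus_nat[of a k] by auto
      then show False
        using False assms(1) by auto
    qed
    ultimately show ?thesis
      by (simp add: in_keys_iff)
  qed
  then show ?case
    using add(3)
    by (simp add: gmul_add_right gmul_scale_right lookup_add lookup_scaleQ distrib_left sum.distrib
        sum_distrib_left mult.left_commute)
qed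

lemma keys_d_gen_gmul:
  assumes "i < n" "S \<subseteq> {n..<m}"
  shows "supp (gmul deg (d (gen i)) (xpow (mon S))) \<subseteq> {k \<in> G. supp k \<subseteq> {n..<N}}"
proof
  fix k assume k: "k \<in> supp (gmul deg (d (gen i)) (xpow (mon S)))"
  have fS: "finite S"
    using assms(2) finite_subset by blast
  have S: "S \<subseteq> {..<N}" "S \<subseteq> {n..<N}"
    using assms(2) nm by auto
  have "gmul deg (d (gen i)) (xpow (mon S)) \<in> free_gca {..<N} deg"
    by (intro gmul_free d_free xpow_free mon_good fS S)
  then have "k \<in> G"
    using k by (auto simp: free_gca_good)
  moreover have "supp k \<subseteq> {n..<N}"
  proof -
    obtain a where "k = a + mon S" "a \<in> supp (d (gen i))"
      using k by (auto elim: keys_gmul)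
    then show ?thesis
      using d_V[OF assms(1)] S(2) fS by (auto simp: keys_plus_nat)
  qed
  ultimately show "k \<in> {k \<in> G. supp k \<subseteq> {n..<N}}"
    by simp
qed

text \<open>
  By minimality multiplication by \<open>d (gen i)\<close> lengthens monomials, hence is nilpotent.
\<close>

lemma opmat_triangular:
  assumes "i < n" "A \<in> J" "B \<in> J" "opmat i A B \<noteq> 0"
  shows "card B < card A"
proof -
  have "mon A \<in> supp (gmul deg (d (gen i)) (xpow (mon B)))"
    using assms(4) by (simp add: opmat_def in_keys_iff)
  then obtain a where a: "mon A = a + mon B" "a \<in> supp (d (gen i))"
    by (auto elim: keys_gmul)
  then have "msize (mon A) = msize a + msize (mon B)"
    by (simp add: msize_plus)
  moreover have "2 \<le> msize a"
    using d_V[OF assms(1) a(2)] by simp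
  ultimately show ?thesis
    using assms by (simp add: msize_mon finite_J)
qed

lemma d_xpow_U: "k \<in> G \<Longrightarrow> supp k \<subseteq> {n..<N} \<Longrightarrow> d (xpow k) = 0"
proof (induction k rule: min_induct)
  case zero
  show ?case
    using d_gone by (simp add: gone_xpow)
next
  case (step x k)
  have gk: "k \<in> G"
    using good_plusD[OF step(3)] by simp
  have x: "n \<le> x" "x < N" "supp k \<subseteq> {n..<N}"
    using step(4) by (auto simp: keys_plus_nat)
  have "d (xpow (sg x + k)) = d (gmul deg (gen x) (xpow k))"
    by (simp add: gen_gmul_xpow_min[OF step(1,3)])
  also have "\<dots> = 0"
    using step(2)[OF gk x(3)] by (simp add: d_gen_gmul[OF x(1,2)])
  finally show ?case .
qed

context
  assumes odd_V: "\<And>v. v < n \<Longrightarrow> odd (deg v)"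
begin

lemma d_gen_even:
  assumes "i < n"
  shows "homogeneous deg (Suc (deg i)) (d (gen i))" "even (Suc (deg i))"
  using assms odd_V nm by (auto intro!: d_homogeneous gen_free homogeneous_gen)

lemma commuting_opmat: "commuting n J opmat"
  unfolding commuting_def
proof (intro allI impI ballI)
  fix i i' A B assume i: "i < n" "i' < n" and AB: "A \<in> J" "B \<in> J"
  have *: "(\<Sum>C\<in>J. opmat i A C * opmat i' C B) = lkp (gmul deg (gmul deg (d (gen i)) (d (gen i'))) (xpow (mon B))) (mon A)"
    if "i' < n" for i i'
    using lookup_d_gen_gmul[OF AB(1) keys_d_gen_gmul[OF that], of B i] AB(2)
    by (simp add: opmat_def gmul_assoc)
  have "gmul deg (d (gen i)) (d (gen i')) = gmul deg (d (gen i')) (d (gen i))"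
    using gmul_commute[OF d_free d_gen_even(1)[OF i(1)] d_free d_gen_even(1)[OF i(2)]] d_gen_even(2)[OF i(1)]
    by simp
  then show "(\<Sum>C\<in>J. opmat i A C * opmat i' C B) = (\<Sum>C\<in>J. opmat i' A C * opmat i C B)"
    using i by (simp add: *)
qed

text \<open>
  The factors \<open>d (gen i)\<close> have even degree and can be moved to the right without a sign, so that only the
  Koszul signs remain.
\<close>

lemma d_xpow_V:
  assumes "finite T" "T \<subseteq> {..<n}"
  shows "d (xpow (mon T)) = (\<Sum>i\<in>T. scaleQ (ins_sign i T) (gmul deg (xpow (mon (T - {i}))) (d (gen i))))"
  using assms
proof (induction T rule: finite_linorder_min_induct)
  case empty
  then show ?case
    by (simp add: d_xpow_U)
next
  case (insert b A)
  have b: "b < n" "b < N" and A: "A \<subseteq> {..<n}" "A \<subseteq> {..<N}" and bA: "b \<notin> A"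
    using insert nm by auto
  have gb: "gmul deg (gen b) (xpow (mon S)) = xpow (mon (insert b S))" if "S \<subseteq> A" for S
  proof -
    have fS: "finite S"
      using that insert(1) finite_subset by blast
    have bS: "b \<notin> S"
      using that bA by blast
    have "insert b S \<subseteq> {..<N}"
      using that A(2) b(2) by auto
    then have "sg b + mon S \<in> G"
      using mon_good[of "insert b S"] fS by (simp add: mon_insert[OF fS bS])
    then show ?thesis
      using insert(2) that by (subst gen_gmul_xpow_min) (auto simp: fS mon_insert[OF fS bS] intro: less_imp_le)
  qed
  have "d (xpow (mon (insert b A))) = d (gmul deg (gen b) (xpow (mon A)))"
    by (simp add: gb)
  also have "\<dots> = gmul deg (d (gen b)) (xpow (mon A)) + scaleQ ((- 1) ^ deg b) (gmul deg (gen b) (d (xpow (mon A))))"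
    using b A insert(1) by (intro d_Leibniz gen_free xpow_free mon_good homogeneous_gen) auto
  also have "gmul deg (d (gen b)) (xpow (mon A)) = gmul deg (xpow (mon A)) (d (gen b))"
    using gmul_commute[OF d_free d_gen_even(1)[OF b(1)] xpow_free[OF mon_good] homogeneous_xpow, OF insert(1) A(2)]
      d_gen_even(2)[OF b(1)] by simp
  also have "scaleQ ((- 1) ^ deg b) (gmul deg (gen b) (d (xpow (mon A)))) =
     (\<Sum>i\<in>A. scaleQ (- ins_sign i A) (gmul deg (xpow (mon (insert b (A - {i})))) (d (gen i))))"
    using odd_V[OF b(1)] insert(3)[OF A(1)]
    by (simp add: gmul_sum_right gmul_scale_right gb sum_negf flip: gmul_assoc)
  also have "\<dots> = (\<Sum>i\<in>A. scaleQ (ins_sign i (insert b A)) (gmul deg (xpow (mon (insert b A - {i}))) (d (gen i))))"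
  proof (intro sum.cong refl)
    fix i assume i: "i \<in> A"
    have "ins_sign i (insert b A) = - ins_sign i A"
      using insert(1,2) i bA ins_sign_insert[of A b i] by auto
    moreover have "insert b A - {i} = insert b (A - {i})"
      using i bA by auto
    ultimately show "scaleQ (- ins_sign i A) (gmul deg (xpow (mon (insert b (A - {i})))) (d (gen i))) =
        scaleQ (ins_sign i (insert b A)) (gmul deg (xpow (mon (insert b A - {i}))) (d (gen i)))"
      by simp
  qed
  also have "gmul deg (xpow (mon A)) (d (gen b)) =
      scaleQ (ins_sign b (insert b A)) (gmul deg (xpow (mon (insert b A - {b}))) (d (gen b)))"
  proof -
    have "{j \<in> insert b A. j < b} = {}"
      using insert(2) by auto
    then show ?thesis
      using bA unfolding ins_sign_def by (simp only: card.empty) simp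
  qed
  finally show ?case
    using insert(1) bA by simp
qed

lemma VU_sign:
  assumes "finite T" "T \<subseteq> {..<n}" "supp k \<subseteq> {n..<N}"
  shows "monom_sign deg (mon T) k = 1"
proof -
  have "odd_keys deg (mon T) \<subseteq> {..<n}" "odd_keys deg k \<subseteq> {n..<N}"
    using assms by (auto simp: odd_keys_def)
  then have "odd_keys deg (mon T) \<inter> odd_keys deg k = {}"
    "inversions (odd_keys deg (mon T)) (odd_keys deg k) = {}"
    by (force simp: inversions_def)+
  then show ?thesis
    by (simp add: monom_sign_inversions)
qed

lemma VU_unique:
  assumes "finite T" "T \<subseteq> {..<n}" "finite T'" "T' \<subseteq> {..<n}"
    "supp k \<subseteq> {n..<N}" "supp k' \<subseteq> {n..<N}"
  shows "mon T + k = mon T' + k' \<longleftrightarrow> T = T' \<and> k = k'"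
proof
  assume e: "mon T + k = mon T' + k'"
  have "supp (mon T + k) \<inter> {..<n} = T" "supp (mon T' + k') \<inter> {..<n} = T'"
    using assms by (auto simp: keys_plus_nat)
  then have "T = T'"
    using e by simp
  then show "T = T' \<and> k = k'"
    using e by simp
qed simp

lemma lookup_V_gmul:
  assumes T: "finite T" "T \<subseteq> {..<n}" "finite T'" "T' \<subseteq> {..<n}" and A: "A \<in> J"
    and y: "supp y \<subseteq> {k \<in> G. supp k \<subseteq> {n..<N}}"
  shows "lkp (gmul deg (xpow (mon T)) y) (mon T' + mon A) = (if T = T' then lkp y (mon A) else 0)"
  using y
proof (induction rule: gca_induct)
  case (add c k p)
  then have k: "supp k \<subseteq> {n..<N}"
    by simp
  have "supp (mon A) \<subseteq> {n..<N}"
    using A finite_J[OF A] nm by auto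
  from VU_unique[OF T k this] add show ?case
    by (simp add: gmul_add_right gmul_scale_right gmul_xpow VU_sign[OF T(1,2) k] lookup_add lookup_scaleQ lookup_xpow)
qed simp

text \<open>
  The coordinates of the quotient by the even generators of \<open>U\<close> with respect to the products of squarefree
  monomials in \<open>V\<close> and in the odd part of \<open>U\<close>.
\<close>

definition coords :: "nat gca \<Rightarrow> nat set \<times> nat set \<Rightarrow> rat" where
  "coords p = (\<lambda>(T, A). if (T, A) \<in> kidx n J then lkp p (mon T + mon A) else 0)"

lemma linear_coords: "Vector_Spaces.linear scaleQ fscale coords"
  by unfold_locales (auto simp: coords_def lookup_add lookup_scaleQ fun_eq_iff)

lemma coords_vanishing_iff: "coords p \<in> vanishing (kidx n J) \<longleftrightarrow> p \<in> ideal {m..<N}"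
proof
  assume p: "coords p \<in> vanishing (kidx n J)"
  have "k \<in> bad {m..<N}" if k: "k \<in> supp p" for k
  proof (rule ccontr)
    assume "k \<notin> bad {m..<N}"
    then have kG: "k \<in> G" and kS: "supp k \<inter> {m..<N} = {}"
      by (auto simp: bad_def)
    have km: "supp k \<subseteq> {..<m}"
      using kG kS by (force simp: good_def)
    let ?T = "supp k \<inter> {..<n}" and ?A = "supp k \<inter> {n..<m}"
    have "odd (deg x)" if "x \<in> supp k" for x
      using that km odd_V deg_odd_U by (cases "x < n") auto
    then have "k = mon (supp k)"
      by (rule eq_mon_keys[OF kG])
    also have "supp k = ?T \<union> ?A"
      using km by auto
    also have "mon (?T \<union> ?A) = mon ?T + mon ?A"
      unfolding mon_def by (intro sum.union_disjoint) auto
    finally have "coords p (?T, ?A) = lkp p k"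
      by (simp add: coords_def kidx_def)
    moreover have "(?T, ?A) \<in> kidx n J"
      by (auto simp: kidx_def)
    ultimately have "lkp p k = 0"
      using vanishingD[OF p] by metis
    then show False
      using k by (simp add: in_keys_iff)
  qed
  then show "p \<in> ideal {m..<N}"
    by (auto simp: ideal_def)
next
  assume p: "p \<in> ideal {m..<N}"
  have "lkp p (mon T + mon A) = 0" if "T \<subseteq> {..<n}" "A \<subseteq> {n..<m}" for T A
  proof -
    have f: "finite T" "finite A"
      using that finite_subset by blast+
    have k: "supp (mon T + mon A) = T \<union> A"
      using f by (simp add: keys_plus_nat)
    have "T \<inter> A = {}"
      using that by force
    then have "mon T + mon A = mon (T \<union> A)"
      unfolding mon_def using f by (simp add: sum.union_disjoint)
    then have "mon T + mon A \<in> G"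
      using that f nm by (auto intro!: mon_good dest: subsetD)
    then have "mon T + mon A \<notin> bad {m..<N}"
      using that nm by (force simp: bad_def k)
    then show ?thesis
      using p by (auto simp: ideal_def in_keys_iff)
  qed
  then show "coords p \<in> vanishing (kidx n J)"
    by (auto simp: vanishing_def coords_def kidx_def)
qed

lemma coords_d: "coords (d p) - koszul n J opmat (coords p) \<in> vanishing (kidx n J)"
proof -
  interpret c: Vector_Spaces.linear scaleQ fscale coords
    by (rule linear_coords)
  interpret k: Vector_Spaces.linear fscale fscale "koszul n J opmat"
    by (rule linear_koszul)
  have sub: "F.subspace (vanishing (kidx n J))"
    by (rule subspace_vanishing)
  have base: "coords (d (xpow l)) - koszul n J opmat (coords (xpow l)) \<in> vanishing (kidx n J)" for l
  proof (cases "l \<in> bad {m..<N}")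
    case True
    then have l: "xpow l \<in> ideal {m..<N}"
      by (simp add: ideal_def)
    then have "d (xpow l) \<in> ideal {m..<N}"
      using nm by (intro d_ideal) auto
    then have "coords (d (xpow l)) \<in> vanishing (kidx n J)"
      by (simp add: coords_vanishing_iff)
    moreover have "koszul n J opmat (coords (xpow l)) = 0"
      using l by (intro koszul_vanishing) (simp add: coords_vanishing_iff)
    ultimately show ?thesis
      by simp
  next
    case False
    then have "coords (xpow l) \<notin> vanishing (kidx n J)"
      by (simp add: coords_vanishing_iff ideal_def)
    then obtain T A where TA: "T \<subseteq> {..<n}" "A \<in> J" "l = mon T + mon A"
      by (auto simp: vanishing_def coords_def kidx_def lookup_xpow split: if_splits)
    have fT: "finite T" and fA: "finite A"
      using TA finite_J finite_subset by blast+
    have A: "supp (mon A) \<subseteq> {n..<N}" "mon A \<in> G"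
      using TA(2) fA nm by (auto intro!: mon_good)
    have GT: "mon T \<in> G"
      using TA(1) fT nm by (auto intro!: mon_good)
    let ?y = "\<lambda>i. gmul deg (d (gen i)) (xpow (mon A))"
    have "xpow l = gmul deg (xpow (mon T)) (xpow (mon A))"
      by (simp add: TA(3) gmul_xpow VU_sign[OF fT TA(1) A(1)])
    then have "d (xpow l) = gmul deg (d (xpow (mon T))) (xpow (mon A))"
      using d_Leibniz[OF xpow_free[OF GT] xpow_free[OF A(2)] homogeneous_xpow] d_xpow_U[OF A(2,1)]
      by simp
    also have "\<dots> = (\<Sum>i\<in>T. scaleQ (ins_sign i T) (gmul deg (xpow (mon (T - {i}))) (?y i)))"
      by (simp add: d_xpow_V[OF fT TA(1)] gmul_sum_left gmul_scale_left gmul_assoc)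
    finally have dl: "d (xpow l) = (\<Sum>i\<in>T. scaleQ (ins_sign i T) (gmul deg (xpow (mon (T - {i}))) (?y i)))" .
    have "coords (d (xpow l)) (T', A') = koszul n J opmat (coords (xpow l)) (T', A')"
      if T'A': "T' \<subseteq> {..<n}" "A' \<in> J" for T' A'
    proof -
      have fT': "finite T'"
        using T'A' finite_subset by blast
      have "coords (d (xpow l)) (T', A') =
          (\<Sum>i\<in>T. ins_sign i T * lkp (gmul deg (xpow (mon (T - {i}))) (?y i)) (mon T' + mon A'))"
        using T'A' by (simp add: coords_def kidx_def dl lookup_sum lookup_scaleQ)
      also have "\<dots> = (\<Sum>i\<in>T. ins_sign i T * (if T - {i} = T' then opmat i A' A else 0))"
      proof (intro sum.cong refl arg_cong2[where f = "(*)"])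
        fix i assume i: "i \<in> T"
        show "lkp (gmul deg (xpow (mon (T - {i}))) (?y i)) (mon T' + mon A') = (if T - {i} = T' then opmat i A' A else 0)"
        proof -
          have "i < n" "A \<subseteq> {n..<m}" "finite (T - {i})" "T - {i} \<subseteq> {..<n}"
            using i TA fT by auto
          then show ?thesis
            using lookup_V_gmul[OF _ _ fT' T'A' keys_d_gen_gmul] by (simp add: opmat_def)
        qed
      qed
      also have "\<dots> = (\<Sum>i\<in>{..<n} - T'. ins_sign i T' * (if insert i T' = T then opmat i A' A else 0))"
      proof -
        have "(\<Sum>i\<in>T. ins_sign i T * (if T - {i} = T' then opmat i A' A else 0)) =
          (\<Sum>i\<in>{..<n}. if i \<in> T \<and> T - {i} = T' then ins_sign i T' * opmat i A' A else 0)"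
        proof (intro sum.mono_neutral_cong_left)
          fix i assume "i \<in> T"
          have "{j \<in> T. j < i} = {j \<in> T - {i}. j < i}"
            by auto
          then have e: "ins_sign i T = ins_sign i (T - {i})"
            unfolding ins_sign_def by (rule arg_cong)
          show "ins_sign i T * (if T - {i} = T' then opmat i A' A else 0) =
             (if i \<in> T \<and> T - {i} = T' then ins_sign i T' * opmat i A' A else 0)"
          proof (cases "T - {i} = T'")
            case True
            then show ?thesis
              unfolding e True using \<open>i \<in> T\<close> by simp
          next
            case False
            then show ?thesis
              by simp
          qed
        qed (use TA in auto)
        also have "\<dots> = (\<Sum>i\<in>{..<n} - T'. ins_sign i T' * (if insert i T' = T then opmat i A' A else 0))"
          by (intro sum.mono_neutral_cong_right) auto
        finally show ?thesis .
      qed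
      also have "\<dots> = koszul n J opmat (coords (xpow l)) (T', A')"
      proof -
        have "(\<Sum>B\<in>J. opmat i A' B * coords (xpow l) (insert i T', B)) = (if insert i T' = T then opmat i A' A else 0)"
          if i: "i \<in> {..<n} - T'" for i
        proof -
          have "coords (xpow l) (insert i T', B) = (if B = A then (if insert i T' = T then 1 else 0) else 0)"
            if B: "B \<in> J" for B
          proof -
            have iT: "insert i T' \<subseteq> {..<n}" "finite (insert i T')"
              using i T'A'(1) fT' by auto
            have kB: "supp (mon B) \<subseteq> {n..<N}"
              using B finite_J[OF B] nm by auto
            have "mon A = mon B \<longleftrightarrow> B = A"
              using keys_mon[OF fA] keys_mon[OF finite_J[OF B]] by metis
            then show ?thesis
              using VU_unique[OF fT TA(1) iT(2,1) A(1) kB] iT B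
              by (auto simp: coords_def kidx_def lookup_xpow TA(3))
          qed
          then have "(\<Sum>B\<in>J. opmat i A' B * coords (xpow l) (insert i T', B)) =
            (\<Sum>B\<in>J. if B = A then (if insert i T' = T then opmat i A' A else 0) else 0)"
            by (intro sum.cong refl) simp
          then show ?thesis
            using TA(2) by simp
        qed
        then show ?thesis
          using T'A' by (simp add: koszul_def kidx_def)
      qed
      finally show ?thesis .
    qed
    then show ?thesis
      by (auto simp: vanishing_def kidx_def)
  qed
  show ?thesis
    using subset_UNIV[of "supp p"]
  proof (induction rule: gca_induct)
    case zero
    show ?case
      unfolding d_zero c.zero k.zero diff_0_right by (rule F.subspace_0[OF sub])
  next
    case (add a l p)
    have "coords (d (scaleQ a (xpow l) + p)) - koszul n J opmat (coords (scaleQ a (xpow l) + p)) =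
      fscale a (coords (d (xpow l)) - koszul n J opmat (coords (xpow l))) + (coords (d p) - koszul n J opmat (coords p))"
      by (simp add: d_add d_scale c.add c.scale k.add k.scale F.scale_right_diff_distrib)
    then show ?case
      by (simp only: F.subspace_add[OF sub F.subspace_scale[OF sub base] add(3)])
  qed
qed

lemma coords_surj: "\<exists>p. f - coords p \<in> vanishing (kidx n J)"
proof -
  have fin: "finite (kidx n J)"
    by (simp add: kidx_def)
  define p where "p = (\<Sum>(T, A)\<in>kidx n J. scaleQ (f (T, A)) (xpow (mon T + mon A)))"
  have "lkp p (mon T + mon A) = f (T, A)" if TA: "(T, A) \<in> kidx n J" for T A
  proof -
    have *: "mon T' + mon A' = mon T + mon A \<longleftrightarrow> T' = T \<and> A' = A" if "(T', A') \<in> kidx n J" for T' A'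
    proof -
      have s: "T \<subseteq> {..<n}" "A \<in> J" "T' \<subseteq> {..<n}" "A' \<in> J"
        using that TA by (auto simp: kidx_def)
      then have f: "finite T" "finite T'" "finite A" "finite A'"
        using finite_J finite_subset by blast+
      have "supp (mon A) \<subseteq> {n..<N}" "supp (mon A') \<subseteq> {n..<N}"
        using s f nm by auto
      moreover have "mon A' = mon A \<longleftrightarrow> A' = A"
        using keys_mon[OF f(3)] keys_mon[OF f(4)] by metis
      ultimately show ?thesis
        using VU_unique[OF f(2) s(3) f(1) s(1)] by simp
    qed
    have "lkp p (mon T + mon A) = (\<Sum>x\<in>kidx n J. if x = (T, A) then f (T, A) else 0)"
      unfolding p_def lookup_sum using *
      by (intro sum.cong refl) (auto simp: lookup_scaleQ lookup_xpow split: prod.splits)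
    then show ?thesis
      using TA fin by simp
  qed
  then show ?thesis
    by (intro exI[of _ p]) (auto simp: vanishing_def coords_def)
qed

lemma hdim_le_bound_odd_V:
  assumes "Q.hdim_le d (ideal {}) k"
  shows "2 ^ n \<le> 2 ^ (N - m) * k"
proof (rule koszul_total_rank[where J = J and X = opmat and w = card])
  show "finite J" "J \<noteq> {}"
    by auto
  show "commuting n J opmat"
    by (rule commuting_opmat)
  show "card B < card A" if "i < n" "A \<in> J" "B \<in> J" "opmat i A B \<noteq> 0" for i A B
    using opmat_triangular that .
  show "F.hdim_le (koszul n J opmat) (vanishing (kidx n J)) (2 ^ (N - m) * k)"
  proof (rule hdim_le_transfer[OF linear_coords subspace_vanishing _ _ coords_d linear_koszul _ coords_surj])
    show "Q.hdim_le d (ideal {m..<N}) (2 ^ (N - m) * k)"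
      by (rule hdim_le_kill_even_U[OF assms])
    show "koszul n J opmat x \<in> vanishing (kidx n J)" if "x \<in> vanishing (kidx n J)" for x
      using koszul_vanishing[OF that] F.subspace_0[OF subspace_vanishing] by simp
  qed (simp_all add: coords_vanishing_iff)
qed

end

theorem hdim_le_bound:
  assumes "Q.hdim_le d (ideal {}) k"
  shows "2 ^ n \<le> 2 ^ (N - m) * k"
  using hdim_le_bound_odd_V[OF deg_odd_V[OF assms] assms] .

end

section \<open>Change of coordinates\<close>

lemma span_image_lessThan:
  assumes "p \<in> Q.span (f ` A)" "finite A"
  shows "\<exists>a. p = (\<Sum>j\<in>A. scaleQ (a j) (f j))"
  using assms(1)
proof (induction rule: Q.span_induct_alt)
  case base
  show ?case
    by (rule exI[of _ "\<lambda>_. 0"]) simp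
next
  case (step c x y)
  then obtain a i where a: "y = (\<Sum>j\<in>A. scaleQ (a j) (f j))" and i: "i \<in> A" "x = f i"
    by blast
  have "scaleQ c x = (\<Sum>j\<in>A. if j = i then scaleQ c (f i) else 0)"
    using i assms(2) by simp
  then have "scaleQ c x + y = (\<Sum>j\<in>A. scaleQ ((if j = i then c else 0) + a j) (f j))"
    by (auto simp: a Q.scale_left_distrib sum.distrib intro!: sum.cong)
  then show ?case
    by (intro exI[of _ "\<lambda>j. (if j = i then c else 0) + a j"])
qed

lemma keys_gen_space:
  assumes "p \<in> gen_space X" "k \<in> supp p"
  shows "k \<in> sg ` X"
proof -
  have "gen_space X \<subseteq> {p. supp p \<subseteq> sg ` X}"
    unfolding gen_space_def by (rule Q.span_minimal[OF _ subspace_keys]) (auto simp: gen_xpow)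
  then show ?thesis
    using assms by blast
qed

lemma gen_space_free: "gen_space X \<subseteq> free_gca X deg"
  unfolding gen_space_def by (rule Q.span_minimal[OF _ subspace_free_gca]) (auto intro: gen_free)

lemma homogeneous_gen_space:
  assumes "p \<in> gen_space X" "homogeneous deg k p" "p \<noteq> 0"
  shows "\<exists>x\<in>X. k = deg x"
proof -
  obtain l where l: "l \<in> supp p"
    using assms(3) by (metis all_not_in_conv keys_eq_empty)
  then have "monom_deg deg l = k"
    using assms(2) by (simp add: homogeneous_def)
  moreover obtain x where "x \<in> X" "l = sg x"
    using keys_gen_space[OF assms(1) l] by blast
  ultimately show ?thesis
    by auto
qed

text \<open>
  A linear substitution preserves word length, so that minimality survives a change of coordinates.
\<close>

lemma (in gca_map) h_word_length:
  assumes lin: "\<And>x. x \<in> X \<Longrightarrow> homogeneous (\<lambda>_. 1) 1 (e x)" and p: "p \<in> free_gca X deg"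
    and k: "k \<in> supp (h p)"
  shows "\<exists>l\<in>supp p. msize k = msize l"
proof -
  have op: "supp l \<subseteq> X \<Longrightarrow> homogeneous (\<lambda>_. 1) (msize l) (op l)" for l
  proof (induction l rule: min_induct)
    case zero
    show ?case by (simp add: homogeneous_gone)
  next
    case (step x l)
    then show ?case
      using homogeneous_gmul[OF lin] by (auto simp: ordered_product_min keys_plus_nat msize_plus)
  qed
  have "h p = (\<Sum>l\<in>supp p. scaleQ (lkp p l) (op l))"
    by (simp add: gca_hom_def linext_def)
  then have "k \<in> supp (\<Sum>l\<in>supp p. scaleQ (lkp p l) (op l))"
    using k by simp
  then have "k \<in> (\<Union>l\<in>supp p. supp (scaleQ (lkp p l) (op l)))"
    by (rule subsetD[OF keys_sum])
  then obtain l where l: "l \<in> supp p" "k \<in> supp (op l)"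
    using keys_scaleQ by blast
  then have "supp l \<subseteq> X"
    using p by (auto simp: free_gca_good good_def)
  from op[OF this] l show ?thesis
    by (auto simp: homogeneous_def msize_monom_deg)
qed

text \<open>
  A homogeneous basis \<open>e\<close> of the space of generators, listing a basis of \<open>V\<close>, then one of the odd part of
  \<open>U\<close>, then one of its even part.
\<close>

locale adapted_basis =
  fixes X :: "'g::linorder set" and deg :: "'g \<Rightarrow> nat" and d :: "'g gca \<Rightarrow> 'g gca"
    and n m N :: nat and e :: "nat \<Rightarrow> 'g gca" and dg :: "nat \<Rightarrow> nat"
  assumes diff: "differential X deg d"
    and nm: "n \<le> m" "m \<le> N"
    and e_gen: "i < N \<Longrightarrow> e i \<in> gen_space X"
    and e_homogeneous: "i < N \<Longrightarrow> homogeneous deg (dg i) (e i)"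
    and dg_pos: "i < N \<Longrightarrow> 0 < dg i"
    and dg_odd: "n \<le> i \<Longrightarrow> i < m \<Longrightarrow> odd (dg i)"
    and dg_even: "m \<le> i \<Longrightarrow> i < N \<Longrightarrow> even (dg i)"
    and e_span: "gen_space X \<subseteq> Q.span (e ` {..<N})"
    and e_indep: "(\<Sum>i<N. scaleQ (a i) (e i)) = 0 \<Longrightarrow> i < N \<Longrightarrow> a i = 0"
    and d_U: "n \<le> i \<Longrightarrow> i < N \<Longrightarrow> d (e i) = 0"
    and d_V: "i < n \<Longrightarrow> d (e i) \<in> gen_subalgebra deg (Q.span (e ` {n..<N}))"
    and minimal: "i < N \<Longrightarrow> x \<in> X \<Longrightarrow> lkp (d (e i)) (sg x) = 0"
begin

abbreviation AX :: "'g gca set" where "AX \<equiv> free_gca X deg"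
abbreviation AY :: "nat gca set" where "AY \<equiv> free_gca {..<N} dg"

lemma d_AX: "p \<in> AX \<Longrightarrow> d p \<in> AX"
  and d_add: "p \<in> AX \<Longrightarrow> q \<in> AX \<Longrightarrow> d (p + q) = d p + d q"
  and d_scale: "p \<in> AX \<Longrightarrow> d (scaleQ c p) = scaleQ c (d p)"
  and d_homogeneous: "p \<in> AX \<Longrightarrow> homogeneous deg k p \<Longrightarrow> homogeneous deg (k + 1) (d p)"
  and d_Leibniz: "p \<in> AX \<Longrightarrow> q \<in> AX \<Longrightarrow> homogeneous deg k p \<Longrightarrow>
     d (gmul deg p q) = gmul deg (d p) q + scaleQ ((- 1) ^ k) (gmul deg p (d q))"
  and d_d: "p \<in> AX \<Longrightarrow> d (d p) = 0"
  using diff unfolding differential_def by blast+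

lemma d_0: "d 0 = 0"
  using d_scale[OF Q.subspace_0[OF subspace_free_gca], of 0] by simp

lemma e_AX: "i < N \<Longrightarrow> e i \<in> AX"
  using e_gen gen_space_free by blast

sublocale psi: gca_map "{..<N}" dg X deg e
  by unfold_locales (auto intro: e_AX e_homogeneous)

text \<open>
  Discarding the terms of the wrong degree makes the expansion of a generator homogeneous, as needed
  for the inverse substitution to be a morphism of graded algebras.
\<close>

lemma gen_coordinates:
  assumes x: "x \<in> X"
  shows "\<exists>c. gen x = (\<Sum>i<N. scaleQ (c i) (e i)) \<and> (\<forall>i. c i \<noteq> 0 \<longrightarrow> dg i = deg x)"
proof -
  have "gen x \<in> Q.span (e ` {..<N})"
    using x e_span unfolding gen_space_def by (auto intro: Q.span_base)
  then obtain a where a: "gen x = (\<Sum>i<N. scaleQ (a i) (e i))"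
    using span_image_lessThan by blast
  define c where "c i = (if dg i = deg x then a i else 0)" for i
  have le: "lkp (e i) k = 0" if "i < N" "monom_deg deg k \<noteq> dg i" for i k
    using e_homogeneous[OF that(1)] that(2) by (auto simp: homogeneous_def in_keys_iff)
  have "gen x = (\<Sum>i<N. scaleQ (c i) (e i))"
  proof (rule poly_mapping_eqI)
    fix k
    show "lkp (gen x) k = lkp (\<Sum>i<N. scaleQ (c i) (e i)) k"
    proof (cases "monom_deg deg k = deg x")
      case True
      have "lkp (gen x) k = (\<Sum>i<N. a i * lkp (e i) k)"
        by (simp add: a lookup_sum lookup_scaleQ)
      also have "\<dots> = (\<Sum>i<N. c i * lkp (e i) k)"
        using le True by (intro sum.cong) (auto simp: c_def)
      finally show ?thesis
        by (simp add: lookup_sum lookup_scaleQ)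
    next
      case False
      then have "lkp (gen x) k = 0"
        by (auto simp: gen_xpow lookup_xpow)
      moreover have "(\<Sum>i<N. c i * lkp (e i) k) = 0"
        using le False by (intro sum.neutral) (auto simp: c_def)
      ultimately show ?thesis
        by (simp add: lookup_sum lookup_scaleQ)
    qed
  qed
  moreover have "\<forall>i. c i \<noteq> 0 \<longrightarrow> dg i = deg x"
    by (simp add: c_def)
  ultimately show ?thesis
    by blast
qed

definition coord :: "'g \<Rightarrow> nat \<Rightarrow> rat" where
  "coord x = (SOME c. gen x = (\<Sum>i<N. scaleQ (c i) (e i)) \<and> (\<forall>i. c i \<noteq> 0 \<longrightarrow> dg i = deg x))"

lemma coord: "x \<in> X \<Longrightarrow> gen x = (\<Sum>i<N. scaleQ (coord x i) (e i))"
  and coord_deg: "x \<in> X \<Longrightarrow> coord x i \<noteq> 0 \<Longrightarrow> dg i = deg x"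
  using someI_ex[OF gen_coordinates, of x] unfolding coord_def by blast+

definition e' :: "'g \<Rightarrow> nat gca" where
  "e' x = (\<Sum>i<N. scaleQ (coord x i) (gen i))"

lemma e'_homogeneous: "x \<in> X \<Longrightarrow> homogeneous dg (deg x) (e' x)"
  unfolding e'_def
proof (rule homogeneous_sum)
  fix i assume x: "x \<in> X"
  show "homogeneous dg (deg x) (scaleQ (coord x i) (gen i))"
    using coord_deg[OF x, of i] homogeneous_gen[of dg i] by (cases "coord x i = 0") (auto intro: homogeneous_scale)
qed

sublocale phi: gca_map X deg "{..<N}" dg e'
proof
  show "e' x \<in> AY" for x
    unfolding e'_def
    by (intro Q.subspace_sum[OF subspace_free_gca] Q.subspace_scale[OF subspace_free_gca] gen_free) simp
qed (rule e'_homogeneous)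

abbreviation psi :: "nat gca \<Rightarrow> 'g gca" where "psi \<equiv> psi.h"
abbreviation phi :: "'g gca \<Rightarrow> nat gca" where "phi \<equiv> phi.h"

lemma psi_phi: "p \<in> AX \<Longrightarrow> psi (phi p) = p"
proof (rule hom_eq_id[where f = "\<lambda>p. psi (phi p)" and X = X and deg = deg])
  show "Vector_Spaces.linear scaleQ scaleQ (\<lambda>p. psi (phi p))"
    by (rule linear_scaleQI) (simp_all add: phi.h_add psi.h_add phi.h_scale psi.h_scale)
  show "psi (phi gone) = gone"
    by (simp add: phi.h_gone psi.h_gone)
  show "psi (phi (gmul deg p q)) = gmul deg (psi (phi p)) (psi (phi q))" if "p \<in> AX" "q \<in> AX" for p q
    using that by (simp add: phi.h_gmul psi.h_gmul phi.h_free)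
  show "psi (phi (gen x)) = gen x" if "x \<in> X" for x
    unfolding phi.h_gen e'_def psi.h_sum psi.h_scale psi.h_gen by (rule coord[OF that, symmetric])
qed

lemma phi_e:
  assumes i: "i < N"
  shows "phi (e i) = gen i"
proof -
  have g: "gen j \<in> Q.span (gen ` {..<N})" if "j < N" for j
    using that by (auto intro!: Q.span_base)
  have "gen_space X \<subseteq> {p. phi p \<in> Q.span (gen ` {..<N})}"
    unfolding gen_space_def
  proof (rule Q.span_minimal)
    show "Q.subspace {p. phi p \<in> Q.span (gen ` {..<N})}"
      by (rule module_hom.subspace_linear_preimage[OF phi.h_module Q.subspace_span])
    show "gen ` X \<subseteq> {p. phi p \<in> Q.span (gen ` {..<N})}"
      by (auto simp: phi.h_gen e'_def intro!: Q.span_sum Q.span_scale g)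
  qed
  then have "phi (e i) \<in> Q.span (gen ` {..<N})"
    using e_gen[OF i] by blast
  then have "phi (e i) - gen i \<in> Q.span (gen ` {..<N})"
    using g[OF i] by (rule Q.span_diff)
  then obtain a where a: "phi (e i) - gen i = (\<Sum>j<N. scaleQ (a j) (gen j))"
    using span_image_lessThan by blast
  have "psi (phi (e i) - gen i) = 0"
    by (simp add: psi.h_diff psi_phi e_AX i psi.h_gen)
  then have "(\<Sum>j<N. scaleQ (a j) (e j)) = 0"
    by (simp add: a psi.h_sum psi.h_scale psi.h_gen)
  then have "phi (e i) - gen i = 0"
    using e_indep[of a] by (simp add: a)
  then show ?thesis
    by simp
qed

lemma phi_psi: "p \<in> AY \<Longrightarrow> phi (psi p) = p"
proof (rule hom_eq_id[where f = "\<lambda>p. phi (psi p)" and X = "{..<N}" and deg = dg])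
  show "Vector_Spaces.linear scaleQ scaleQ (\<lambda>p. phi (psi p))"
    by (rule linear_scaleQI) (simp_all add: phi.h_add psi.h_add phi.h_scale psi.h_scale)
  show "phi (psi gone) = gone"
    by (simp add: phi.h_gone psi.h_gone)
  show "phi (psi (gmul dg p q)) = gmul dg (phi (psi p)) (phi (psi q))" if "p \<in> AY" "q \<in> AY" for p q
    using that by (simp add: phi.h_gmul psi.h_gmul psi.h_free)
  show "phi (psi (gen i)) = gen i" if "i \<in> {..<N}" for i
    using that by (simp add: psi.h_gen phi_e)
qed

definition cut :: "nat gca \<Rightarrow> nat gca" where
  "cut = linext (\<lambda>k. if k \<in> good {..<N} dg then xpow k else 0)"

lemmas cut_module = linear_linext[of "\<lambda>k. if k \<in> good {..<N} dg then xpow k else 0", folded cut_def module_hom_iff_linear]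
lemmas cut_add = module_hom.add[OF cut_module] and cut_scale = module_hom.scale[OF cut_module]
  and cut_zero = module_hom.zero[OF cut_module]

lemma cut_xpow: "cut (xpow k) = (if k \<in> good {..<N} dg then xpow k else 0)"
  by (simp add: cut_def)

lemma lookup_cut: "lkp (cut p) k = (if k \<in> good {..<N} dg then lkp p k else 0)"
  using subset_UNIV[of "supp p"]
  by (induction rule: gca_induct)
     (auto simp: cut_zero cut_add cut_scale cut_xpow lookup_add lookup_scaleQ lookup_xpow)

lemma cut_AY: "cut p \<in> AY"
  by (auto simp: free_gca_good in_keys_iff lookup_cut split: if_splits)

lemma cut_id: "p \<in> AY \<Longrightarrow> cut p = p"
  by (rule poly_mapping_eqI) (auto simp: lookup_cut free_gca_good in_keys_iff)

text \<open>The differential in the coordinates \<open>e\<close>, extended by zero to a linear map on all polynomials.\<close>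

definition d' :: "nat gca \<Rightarrow> nat gca" where
  "d' p = phi (d (psi (cut p)))"

lemma d'_AY: "p \<in> AY \<Longrightarrow> d' p = phi (d (psi p))"
  by (simp add: d'_def cut_id)

lemma d'_gen: "i < N \<Longrightarrow> d' (gen i) = phi (d (e i))"
  by (simp add: d'_AY gen_free psi.h_gen)

lemma d'_free: "d' p \<in> AY"
  by (simp add: d'_def phi.h_free d_AX psi.h_free cut_AY)

text \<open>
  The elements that \<open>phi\<close> maps into the polynomials in the generators of \<open>U\<close> form a subalgebra containing \<open>U\<close>.
\<close>

lemma phi_gen_subalgebra:
  assumes "p \<in> gen_subalgebra deg (Q.span (e ` {n..<N}))" "k \<in> supp (phi p)"
  shows "supp k \<subseteq> {n..<N}"
proof -
  define A where "A = {p \<in> AX. supp (phi p) \<subseteq> {k. supp k \<subseteq> {n..<N}}}"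
  have A_sub: "Q.subspace A"
  proof -
    have "A = AX \<inter> {p. phi p \<in> {q. supp q \<subseteq> {k. supp k \<subseteq> {n..<N}}}}"
      by (auto simp: A_def)
    then show ?thesis
      using Q.subspace_inter[OF subspace_free_gca module_hom.subspace_linear_preimage[OF phi.h_module subspace_keys]]
      by simp
  qed
  have "subalgebra deg A"
    unfolding subalgebra_def
  proof (intro conjI ballI A_sub)
    show "gone \<in> A"
      by (auto simp: A_def phi.h_gone gone_xpow[where ?'a = nat])
    show "gmul deg p q \<in> A" if "p \<in> A" "q \<in> A" for p q
    proof -
      have pq: "p \<in> AX" "q \<in> AX"
        using that by (auto simp: A_def)
      have "supp k \<subseteq> {n..<N}" if k: "k \<in> supp (gmul dg (phi p) (phi q))" for k
      proof -
        obtain a b where "k = a + b" "a \<in> supp (phi p)" "b \<in> supp (phi q)"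
          using k by (rule keys_gmul)
        then show ?thesis
          using \<open>p \<in> A\<close> \<open>q \<in> A\<close> by (auto simp: A_def keys_plus_nat)
      qed
      then show ?thesis
        using pq by (auto simp: A_def gmul_free phi.h_gmul)
    qed
  qed
  moreover have "Q.span (e ` {n..<N}) \<subseteq> A"
  proof (rule Q.span_minimal[OF _ A_sub])
    show "e ` {n..<N} \<subseteq> A"
      by (auto simp: A_def e_AX phi_e gen_xpow)
  qed
  ultimately have "p \<in> A"
    using assms(1) unfolding gen_subalgebra_def by blast
  then show ?thesis
    using assms(2) by (auto simp: A_def)
qed

lemma e'_linear: "homogeneous (\<lambda>_. 1) 1 (e' x)"
  unfolding e'_def using homogeneous_gen[of "\<lambda>_. 1"] by (intro homogeneous_sum homogeneous_scale)

sublocale C: coord_model n m N dg d'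
proof (rule coord_model.intro)
  show "n \<le> m" "m \<le> N"
    by (rule nm)+
  show "0 < dg i" if "i < N" for i
    using dg_pos that .
  show "odd (dg i)" if "n \<le> i" "i < m" for i
    using dg_odd that .
  show "even (dg i)" if "m \<le> i" "i < N" for i
    using dg_even that .
  show "Vector_Spaces.linear scaleQ scaleQ d'"
    by (rule linear_scaleQI)
       (simp_all add: d'_def cut_add cut_scale psi.h_add psi.h_scale d_add d_scale psi.h_free cut_AY phi.h_add phi.h_scale)
  show "d' (xpow k) = 0" if "k \<notin> good {..<N} dg" for k
    using that by (simp add: d'_def cut_xpow psi.h_zero d_0 phi.h_zero)
  show "d' p \<in> AY" for p
    by (rule d'_free)
  show "homogeneous dg (Suc j) (d' p)" if "p \<in> AY" "homogeneous dg j p" for j p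
    using that d_homogeneous[OF psi.h_free psi.h_homogeneous]
    by (auto simp: d'_AY intro!: phi.h_homogeneous d_AX psi.h_free)
  show "d' (gmul dg p q) = gmul dg (d' p) q + scaleQ ((- 1) ^ j) (gmul dg p (d' q))"
    if pq: "p \<in> AY" "q \<in> AY" "homogeneous dg j p" for p q j
    using d_Leibniz[OF psi.h_free psi.h_free psi.h_homogeneous, OF pq(1,2,1,3)] pq
    by (simp add: d'_AY gmul_free psi.h_gmul phi.h_add phi.h_scale phi.h_gmul d_AX psi.h_free phi_psi)
  show "d' (gen i) = 0" if "n \<le> i" "i < N" for i
    using that by (simp add: d'_gen d_U phi.h_zero)
  show "d' (d' p) = 0" for p
  proof -
    have "d' (d' p) = phi (d (psi (phi (d (psi (cut p))))))"
      by (simp add: d'_AY[OF d'_free]) (simp add: d'_def)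
    then show ?thesis
      by (simp add: psi_phi d_AX psi.h_free cut_AY d_d phi.h_zero)
  qed
  show "supp k \<subseteq> {n..<N} \<and> 2 \<le> msize k" if i: "i < n" and k: "k \<in> supp (d' (gen i))" for i k
  proof
    have iN: "i < N"
      using i nm by simp
    have k': "k \<in> supp (phi (d (e i)))"
      using k by (simp add: d'_gen iN)
    show "supp k \<subseteq> {n..<N}"
      by (rule phi_gen_subalgebra[OF d_V[OF i] k'])
    obtain l where l: "l \<in> supp (d (e i))" "msize k = msize l"
      using phi.h_word_length[OF e'_linear d_AX[OF e_AX[OF iN]] k'] by blast
    have lX: "supp l \<subseteq> X"
      using d_AX[OF e_AX[OF iN]] l(1) by (auto simp: free_gca_good good_def)
    have "homogeneous deg (dg i + 1) (d (e i))"
      by (rule d_homogeneous[OF e_AX[OF iN] e_homogeneous[OF iN]])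
    then have "monom_deg deg l = dg i + 1"
      using l(1) by (simp add: homogeneous_def)
    then have "l \<noteq> 0"
      by auto
    then obtain x l' where x: "l = sg x + l'"
      by (rule min_split)
    then have xX: "x \<in> X"
      using lX by (simp add: keys_plus_nat)
    have "l' \<noteq> 0"
      using minimal[OF iN xX] l(1) by (auto simp: x in_keys_iff)
    then obtain y l'' where "l' = sg y + l''"
      by (rule min_split)
    then show "2 \<le> msize k"
      by (simp add: l(2) x msize_plus)
  qed
qed

text \<open>
  \<open>phi\<close> and \<open>psi\<close> are mutually inverse isomorphisms of complexes.
\<close>

lemma hdim_le_coordinates:
  assumes S: "finite S" "S \<subseteq> cocycles X deg d"
    and Sz: "\<And>z. z \<in> cocycles X deg d \<Longrightarrow> \<exists>s\<in>Q.span S. z - s \<in> coboundaries X deg d"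
  shows "Q.hdim_le d' (C.ideal {}) (card S)"
  unfolding Q.hdim_le_def Q.qdim_le_def
proof (intro exI[of _ "phi ` S"] conjI ballI)
  have ideal0: "p = 0" if "p \<in> AY" "p \<in> C.ideal {}" for p
  proof -
    have "k \<notin> supp p" for k
      using that by (auto simp: free_gca_good C.ideal_def C.bad_def)
    then show ?thesis
      by (intro poly_mapping_eqI) (simp add: in_keys_iff)
  qed
  show "finite (phi ` S)" "card (phi ` S) \<le> card S"
    using S card_image_le by auto
  show "phi ` S \<subseteq> {z. d' z \<in> C.ideal {}}"
  proof
    fix z assume "z \<in> phi ` S"
    then obtain s where s: "z = phi s" "s \<in> AX" "d s = 0"
      using S(2) by (auto simp: cocycles_def)
    then have "d' z = 0"
      by (simp add: d'_AY phi.h_free psi_phi phi.h_zero)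
    then show "z \<in> {z. d' z \<in> C.ideal {}}"
      using Q.subspace_0[OF C.subspace_ideal] by simp
  qed
  fix z assume "z \<in> {z. d' z \<in> C.ideal {}}"
  then have "d' z = 0"
    using ideal0[OF d'_free] by simp
  then have "psi (phi (d (psi (cut z)))) = 0"
    by (simp add: d'_def psi.h_zero)
  then have "d (psi (cut z)) = 0"
    by (simp add: psi_phi d_AX psi.h_free cut_AY)
  then have "psi (cut z) \<in> cocycles X deg d"
    by (simp add: cocycles_def psi.h_free cut_AY)
  then obtain s b where s: "s \<in> Q.span S" "psi (cut z) - s = d b" "b \<in> AX"
    using Sz by (fastforce simp: coboundaries_def)
  have "phi (psi (cut z)) - phi s = phi (d b)"
    by (simp flip: phi.h_diff add: s(2))
  then have "cut z - phi s = d' (phi b)"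
    by (simp add: phi_psi cut_AY d'_AY phi.h_free s(3) psi_phi)
  then have "z - phi s = d' (phi b) + (z - cut z)"
    by (simp add: algebra_simps)
  moreover have "z - cut z \<in> C.ideal {}"
    by (auto simp: C.ideal_def C.bad_def in_keys_iff lookup_minus lookup_cut)
  moreover have "phi s \<in> Q.span (phi ` S)"
    using s(1) module_hom.span_image[OF phi.h_module] by blast
  ultimately show "\<exists>s\<in>Q.span (phi ` S). z - s \<in> {d' b + i | b i. i \<in> C.ideal {}}"
    by blast
qed

end

section \<open>The rank inequality\<close>

lemma quotient_basis_spans:
  assumes "quotient_basis Z B S" "z \<in> Z"
  shows "\<exists>s\<in>Q.span S. z - s \<in> B"
proof -
  have "\<forall>z\<in>Z. \<exists>T c. finite T \<and> T \<subseteq> S \<and> z - (\<Sum>s\<in>T. scaleQ (c s) s) \<in> B"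
    using assms(1) unfolding quotient_basis_def by (elim conjE)
  from bspec[OF this assms(2)] obtain T c where T: "finite T" "T \<subseteq> S" "z - (\<Sum>s\<in>T. scaleQ (c s) s) \<in> B"
    by (elim exE conjE)
  moreover have "(\<Sum>s\<in>T. scaleQ (c s) s) \<in> Q.span S"
    using T(2) by (intro Q.span_sum Q.span_scale Q.span_base) auto
  ultimately show ?thesis
    by blast
qed

lemma quotient_basis_subset: "quotient_basis Z B S \<Longrightarrow> S \<subseteq> Z"
  by (simp add: quotient_basis_def)

lemma quotient_basis_independent:
  assumes "quotient_basis Z B S" "finite T" "T \<subseteq> S" "(\<Sum>s\<in>T. scaleQ (c s) s) \<in> B"
  shows "\<forall>s\<in>T. c s = 0"
  using assms by (simp add: quotient_basis_def)

text \<open>A finite basis of the quotient bounds every other one, so the basis chosen by \<open>dim_quotient\<close> is finite.\<close>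

lemma dim_quotient_basis:
  assumes B: "Q.subspace B" and fin: "finite_dim_quotient Z B"
  obtains S where "finite S" "card S = dim_quotient Z B" "quotient_basis Z B S"
proof -
  obtain S where S: "finite S" "quotient_basis Z B S"
    using fin unfolding finite_dim_quotient_def by blast
  define S' where "S' = (SOME S. quotient_basis Z B S)"
  have S': "quotient_basis Z B S'"
    unfolding S'_def using S(2) by (rule someI)
  have "finite S'"
  proof (rule ccontr)
    assume "infinite S'"
    then obtain T where T: "finite T" "card T = Suc (card S)" "T \<subseteq> S'"
      using infinite_arbitrarily_large by blast
    have "card T \<le> card S"
    proof (rule Q.card_le_if_independent_mod[OF B S(1) _ T(1)])
      show "\<exists>s\<in>Q.span S. z - s \<in> B" if "z \<in> T" for z
        using that T(3) quotient_basis_subset[OF S'] by (intro quotient_basis_spans[OF S(2)]) blast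
      show "\<forall>t\<in>T. c t = 0" if "(\<Sum>t\<in>T. scaleQ (c t) t) \<in> B" for c
        using quotient_basis_independent[OF S' T(1,3) that] .
    qed
    then show False
      using T(2) by simp
  qed
  then show ?thesis
    using that[of S'] S' by (simp add: dim_quotient_def S'_def)
qed

lemma homogeneous_basis:
  assumes "graded_subspace deg U"
  obtains E where "Q.independent E" "Q.span E = U" "\<forall>p\<in>E. \<exists>k. homogeneous deg k p"
proof -
  let ?H = "{p \<in> U. \<exists>k. homogeneous deg k p}"
  obtain E where E: "E \<subseteq> ?H" "Q.independent E" "?H \<subseteq> Q.span E"
    using Q.maximal_independent_subset by blast
  have "Q.span E \<subseteq> U"
    using E(1) assms by (intro Q.span_minimal) (auto simp: graded_subspace_def)
  moreover have "U \<subseteq> Q.span E"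
    using assms E(3) Q.span_minimal[OF E(3) Q.subspace_span] unfolding graded_subspace_def by blast
  ultimately show ?thesis
    using that E by blast
qed

theorem theorem2p3:
  fixes X :: "'g::linorder set" and deg :: "'g \<Rightarrow> nat"
    and d :: "'g gca \<Rightarrow> 'g gca" and U V :: "'g gca set"
  assumes "minimal_model X deg d"
    and "elliptic X deg d"
    and "two_stage X deg d U V"
  shows "real (dim_cohomology X deg d) \<ge>
         2 powi (int (Q.dim V) - int (Q.dim (even_part deg U)))"
proof -
  have diff: "differential X deg d" and deg2: "\<And>x. x \<in> X \<Longrightarrow> 2 \<le> deg x"
    and minimal: "\<And>w x. w \<in> gen_space X \<Longrightarrow> x \<in> X \<Longrightarrow> lkp (d w) (sg x) = 0"
    using assms(1) by (auto simp: minimal_model_def sg_def)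
  have gU: "graded_subspace deg U" and gV: "graded_subspace deg V"
    and UV: "gen_space X = {u + v | u v. u \<in> U \<and> v \<in> V}" and disj: "U \<inter> V = {0}"
    and dU: "\<And>u. u \<in> U \<Longrightarrow> d u = 0" and dV: "\<And>v. v \<in> V \<Longrightarrow> d v \<in> gen_subalgebra deg U"
    using assms(3) unfolding two_stage_def by blast+
  have sU: "Q.subspace U" and sV: "Q.subspace V"
    using gU gV by (auto simp: graded_subspace_def)
  have U_gen: "U \<subseteq> gen_space X"
  proof
    fix u assume "u \<in> U"
    then have "u + 0 \<in> gen_space X"
      unfolding UV using Q.subspace_0[OF sV] by blast
    then show "u \<in> gen_space X"
      by simp
  qed
  have V_gen: "V \<subseteq> gen_space X"
  proof
    fix v assume "v \<in> V"
    then have "0 + v \<in> gen_space X"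
      unfolding UV using Q.subspace_0[OF sU] by blast
    then show "v \<in> gen_space X"
      by simp
  qed
  obtain S where S: "finite S" "gen_space X \<subseteq> Q.span S"
    and fdq: "finite_dim_quotient (cocycles X deg d) (coboundaries X deg d)"
    using assms(2) unfolding elliptic_def by blast

  obtain EU where EU: "Q.independent EU" "Q.span EU = U" "\<forall>p\<in>EU. \<exists>k. homogeneous deg k p"
    using gU by (rule homogeneous_basis)
  obtain EV where EV: "Q.independent EV" "Q.span EV = V" "\<forall>p\<in>EV. \<exists>k. homogeneous deg k p"
    using gV by (rule homogeneous_basis)
  have EU_U: "EU \<subseteq> U" and EV_V: "EV \<subseteq> V"
    using EU(2) EV(2) Q.span_superset by blast+
  have fEU: "finite EU" and fEV: "finite EV"
    using Q.independent_span_bound[OF S(1) EU(1)] Q.independent_span_bound[OF S(1) EV(1)]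
      order_trans[OF EU_U order_trans[OF U_gen S(2)]] order_trans[OF EV_V order_trans[OF V_gen S(2)]]
    by simp_all
  have EUV: "EU \<inter> EV = {}"
  proof -
    have "EU \<inter> EV \<subseteq> {0}"
      using disj EU_U EV_V by blast
    moreover have "0 \<notin> EU"
      using EU(1) Q.dependent_zero by blast
    ultimately show ?thesis
      by blast
  qed
  have nz: "p \<noteq> 0" if "p \<in> EU \<union> EV" for p
    using that Q.dependent_zero[of EU] Q.dependent_zero[of EV] EU(1) EV(1) by auto
  \<comment> \<open>The basis elements are nonzero, so \<open>degree\<close> is their unique degree.\<close>
  define degree where "degree p = (SOME k. homogeneous deg k p)" for p
  have degree: "homogeneous deg (degree p) p" if "p \<in> EU \<union> EV" for p
    using that EU(3) EV(3) someI_ex[of "\<lambda>k. homogeneous deg k p"] unfolding degree_def by blast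
  define E1 where "E1 = {p \<in> EU. odd (degree p)}"
  define E0 where "E0 = {p \<in> EU. even (degree p)}"
  have E01: "EU = E1 \<union> E0" "E1 \<inter> E0 = {}"
    by (auto simp: E1_def E0_def)
  obtain vs us1 us0 where vs: "set vs = EV" "distinct vs" and us1: "set us1 = E1" "distinct us1"
    and us0: "set us0 = E0" "distinct us0"
    using finite_distinct_list fEV fEU E01 by (metis finite_Un)
  define es where "es = vs @ us1 @ us0"
  define n where "n = length vs"
  define m where "m = length vs + length us1"
  define N where "N = length es"
  have dist: "distinct es"
    using vs us1 us0 E01 EUV by (auto simp: es_def)
  have set_es: "set es = EU \<union> EV"
    using vs us1 us0 E01 by (auto simp: es_def)
  define e where "e i = es ! i" for i
  have e_in: "e i \<in> EU \<union> EV" if "i < N" for i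
    using that set_es nth_mem unfolding e_def N_def by blast
  have e_V: "e i \<in> EV" if "i < n" for i
    using that vs(1) nth_mem[of i vs] by (auto simp: e_def es_def n_def nth_append)
  have e_1: "e i \<in> E1" if "n \<le> i" "i < m" for i
    using that us1(1) nth_mem[of "i - n" us1] by (auto simp: e_def es_def n_def m_def nth_append)
  have e_0: "e i \<in> E0" if "m \<le> i" "i < N" for i
    using that us0(1) nth_mem[of "i - m" us0] by (auto simp: e_def es_def m_def N_def nth_append)
  have e_U: "e i \<in> EU" if "n \<le> i" "i < N" for i
    using that e_0 e_1 E01(1) by (cases "i < m") auto
  have img: "e ` {..<N} = EU \<union> EV"
    unfolding e_def N_def set_es[symmetric] by (auto simp: set_conv_nth)
  have inj_e: "inj_on e {..<N}"
    using dist by (auto simp: inj_on_def e_def N_def nth_eq_iff_index_eq)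
  have img_U: "e ` {n..<N} = EU"
  proof
    show "e ` {n..<N} \<subseteq> EU"
      using e_U by auto
    show "EU \<subseteq> e ` {n..<N}"
    proof
      fix p assume p: "p \<in> EU"
      then obtain i where i: "i < N" "p = e i"
        using img by blast
      then have "\<not> i < n"
        using e_V[of i] p EUV by blast
      then show "p \<in> e ` {n..<N}"
        using i by auto
    qed
  qed

  have indep: "a i = 0" if s: "(\<Sum>i<N. scaleQ (a i) (e i)) = 0" and i: "i < N" for a i
  proof -
    define b where "b p = a (the_inv_into {..<N} e p)" for p
    have b: "b (e j) = a j" if "j < N" for j
      using that inj_e by (simp add: b_def the_inv_into_f_f)
    have "(\<Sum>p\<in>EU \<union> EV. scaleQ (b p) p) = (\<Sum>i<N. scaleQ (b (e i)) (e i))"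
      unfolding img[symmetric] using inj_e by (simp add: sum.reindex)
    also have "\<dots> = 0"
      using s by (simp add: b)
    finally have "(\<Sum>p\<in>EU. scaleQ (b p) p) + (\<Sum>p\<in>EV. scaleQ (b p) p) = 0"
      using fEU fEV EUV by (simp add: sum.union_disjoint)
    then have eq: "(\<Sum>p\<in>EU. scaleQ (b p) p) = - (\<Sum>p\<in>EV. scaleQ (b p) p)"
      by (simp add: eq_neg_iff_add_eq_0)
    have 1: "(\<Sum>p\<in>EU. scaleQ (b p) p) \<in> U"
      using EU_U by (intro Q.subspace_sum[OF sU] Q.subspace_scale[OF sU]) auto
    have 2: "(\<Sum>p\<in>EV. scaleQ (b p) p) \<in> V"
      using EV_V by (intro Q.subspace_sum[OF sV] Q.subspace_scale[OF sV]) auto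
    have "(\<Sum>p\<in>EU. scaleQ (b p) p) = 0"
      using 1 Q.subspace_neg[OF sV 2] disj unfolding eq by blast
    moreover from this have "(\<Sum>p\<in>EV. scaleQ (b p) p) = 0"
      using eq by simp
    ultimately have "b (e i) = 0"
      using Q.independentD[OF EU(1) fEU order_refl, of b "e i"] Q.independentD[OF EV(1) fEV order_refl, of b "e i"]
        e_in[OF i] by blast
    then show ?thesis
      using b[OF i] by simp
  qed

  interpret B: adapted_basis X deg d n m N e "\<lambda>i. degree (e i)"
  proof
    show "differential X deg d"
      by (rule diff)
    show "n \<le> m" "m \<le> N"
      by (auto simp: n_def m_def N_def es_def)
    show gen: "e i \<in> gen_space X" if "i < N" for i
      using e_in[OF that] EU_U EV_V U_gen V_gen by blast
    show hom: "homogeneous deg (degree (e i)) (e i)" if "i < N" for i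
      using degree e_in[OF that] .
    show "0 < degree (e i)" if i: "i < N" for i
      using homogeneous_gen_space[OF gen[OF i] hom[OF i] nz[OF e_in[OF i]]] deg2 by fastforce
    show "odd (degree (e i))" if "n \<le> i" "i < m" for i
      using e_1[OF that] by (simp add: E1_def)
    show "even (degree (e i))" if "m \<le> i" "i < N" for i
      using e_0[OF that] by (simp add: E0_def)
    show "gen_space X \<subseteq> Q.span (e ` {..<N})"
      unfolding img UV Q.span_Un EU(2) EV(2) by blast
    show "a i = 0" if "(\<Sum>i<N. scaleQ (a i) (e i)) = 0" "i < N" for a i
      using indep that .
    show "d (e i) = 0" if "n \<le> i" "i < N" for i
      using e_U[OF that] EU_U dU by blast
    show "d (e i) \<in> gen_subalgebra deg (Q.span (e ` {n..<N}))" if "i < n" for i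
      unfolding img_U EU(2) using e_V[OF that] EV_V dV by blast
    show "lkp (d (e i)) (sg x) = 0" if "i < N" "x \<in> X" for i x
      using minimal[OF gen] that by blast
  qed

  have cob: "Q.subspace (coboundaries X deg d)"
  proof (rule Q.subspaceI)
    show "0 \<in> coboundaries X deg d"
      unfolding coboundaries_def using B.d_0 Q.subspace_0[OF subspace_free_gca] by (metis image_eqI)
  next
    fix p q assume "p \<in> coboundaries X deg d" "q \<in> coboundaries X deg d"
    then obtain a b where "a \<in> free_gca X deg" "b \<in> free_gca X deg" "p = d a" "q = d b"
      by (auto simp: coboundaries_def)
    then show "p + q \<in> coboundaries X deg d"
      unfolding coboundaries_def using B.d_add Q.subspace_add[OF subspace_free_gca]
      by (metis image_eqI)
  next
    fix c p assume "p \<in> coboundaries X deg d"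
    then obtain a where "a \<in> free_gca X deg" "p = d a"
      by (auto simp: coboundaries_def)
    then show "scaleQ c p \<in> coboundaries X deg d"
      unfolding coboundaries_def using B.d_scale Q.subspace_scale[OF subspace_free_gca]
      by (metis image_eqI)
  qed
  obtain S0 where S0: "finite S0" "card S0 = dim_cohomology X deg d"
      "quotient_basis (cocycles X deg d) (coboundaries X deg d) S0"
    using dim_quotient_basis[OF cob fdq] unfolding dim_cohomology_def by blast
  have "S0 \<subseteq> cocycles X deg d"
    using S0(3) by (rule quotient_basis_subset)
  from B.C.hdim_le_bound[OF B.hdim_le_coordinates[OF S0(1) this quotient_basis_spans[OF S0(3)]]]
  have main: "2 ^ n \<le> 2 ^ (N - m) * dim_cohomology X deg d"
    by (simp add: S0(2))

  have dimV: "Q.dim V = n"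
    using Q.dim_span_eq_card_independent[OF EV(1)] distinct_card[OF vs(2)] by (simp add: EV(2) n_def vs(1))
  have "N - m \<le> Q.dim (even_part deg U)"
  proof -
    have E0_even: "E0 \<subseteq> even_part deg U"
    proof
      fix p assume p: "p \<in> E0"
      then have "p \<in> U" "even (degree p)" "homogeneous deg (degree p) p"
        using EU_U degree by (auto simp: E0_def)
      then show "p \<in> even_part deg U"
        unfolding even_part_def by (intro Q.span_base) blast
    qed
    have "even_part deg U \<subseteq> U"
      unfolding even_part_def using sU by (intro Q.span_minimal) auto
    obtain W where W: "W \<subseteq> even_part deg U" "Q.independent W" "even_part deg U \<subseteq> Q.span W"
        "card W = Q.dim (even_part deg U)"
      using Q.basis_exists by blast
    have "W \<subseteq> Q.span S"
      using W(1) \<open>even_part deg U \<subseteq> U\<close> U_gen S(2) by blast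
    then have "finite W"
      using Q.independent_span_bound[OF S(1) W(2)] by blast
    moreover have "Q.independent E0"
      using EU(1) E01(1) Q.independent_mono by blast
    moreover have "E0 \<subseteq> Q.span W"
      using E0_even W(3) by blast
    ultimately have "card E0 \<le> card W"
      using Q.independent_span_bound by blast
    moreover have "card E0 = N - m"
      using distinct_card[OF us0(2)] by (simp add: us0(1) N_def m_def es_def)
    ultimately show ?thesis
      using W(4) by simp
  qed
  then have "(2::nat) ^ (N - m) \<le> 2 ^ Q.dim (even_part deg U)"
    by (intro power_increasing) auto
  then have "2 ^ Q.dim V \<le> 2 ^ Q.dim (even_part deg U) * dim_cohomology X deg d"
    using main unfolding dimV by (meson le_trans mult_le_mono1)
  then have "(2::real) ^ Q.dim V \<le> 2 ^ Q.dim (even_part deg U) * real (dim_cohomology X deg d)"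
    by (metis (mono_tags) of_nat_le_iff of_nat_mult of_nat_numeral of_nat_power)
  then show ?thesis
    by (simp add: power_int_diff divide_le_eq mult.commute)
qed

end
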